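(* Let $\{\omega_k\}_{k=1}^N$, $\omega_k=[a_k,b_k]$, be intervals with $\sum_{k=1}^N\mathbf 1_{\omega_k}\le B$, let $\mathbb{P}=\bigcup_{k=1}^N\mathbb{P}_k$ be an associated finite collection of tiles with $L^1$-normalized wave packets $\{\phi_P\}_{P\in\mathbb{P}}$, and let $\Lambda_{\mathbb{P}}$ be the associated model form (all as described in the context). Then there exists a positive constant $K$, independent of $N$, $\mathbb{P}$, $f$ and $\vec g$, such that the following holds. For every $f\in C_0^\infty(\mathbb{R})$ and $\vec g=\{g_k\}_{k=1}^N$ with each $g_k\in C_0^\infty(\mathbb{R})$, there exists a $\frac16$-sparse collection $\mathcal S$ of intervals (depending on $f$ and $\vec g$) such that $$ \Lambda_{\mathbb{P}}(f,\vec g)\le K\sum_{I\in\mathcal S}|I|\,\langle f\rangle_{2,I}\,\langle|\vec g|\rangle_I . $$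
   Context: $\mathcal D=\{2^{-k}([0,1)+m):k,m\in\mathbb{Z}\}$ is the standard dyadic system. A tile is a rectangle $P=I_P\times\omega_P$ of area one with $I_P\in\mathcal D$ and $\omega_P\in\mathcal D$ (or $\omega_P$ in a shifted variant of $\mathcal D$). An $L^1$-normalized wave packet on $P$ is a smooth function $\phi_P$ whose Fourier transform is supported in $\omega_P$ and which is $L^1$-adapted to $I_P$: with $c(\omega_P)$ the center of $\omega_P$, $$\Big|\frac{d^n}{dx^n}\big(e^{-2\pi i c(\omega_P)x}\phi_P(x)\big)\Big|\le C_{n,M}\frac1{|I_P|^{n+1}}\Big(1+\frac{\operatorname{dist}(x,I_P)}{|I_P|}\Big)^{-M}$$ for sufficiently many derivatives $n$ and a large number $M$, with constants $C_{n,M}$ independent of $P$. For each $k$, $\mathbb{W}_k$ denotes the Whitney decomposition of $[a_k,b_k]$ with respect to its endpoints: the collection of maximal dyadic intervals $J\subset[a_k,b_k]$ with $\operatorname{dist}(J,a_k)\ge|J|$ and $\operatorname{dist}(J,b_k)\ge|J|$. $\mathbb{P}_k$ is a finite collection of tiles $P$ with $\omega_P\in\mathbb{W}_k$; the frequency intervals $\omega_P$, $P\in\mathbb{P}_k$, are assumed lacunary with respect to the left endpoint $a_k$ only (i.e. $\operatorname{dist}(\omega_P,a_k)$ is comparable to $|\omega_P|$). The model form is $$\Lambda_{\mathbb{P}}(f,\vec g)=\sum_{k=1}^N\sum_{P\in\mathbb{P}_k}|I_P|\,|\langle f,\phi_P\rangle|\,|\langle g_k,\phi_P\rangle|,$$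 where $\langle\cdot,\cdot\rangle$ is the $L^2$ inner product. $|\vec g(x)|:=\big(\sum_{k}|g_k(x)|^2\big)^{1/2}$; $\langle h\rangle_{r,I}:=\big(\frac1{|I|}\int_I|h|^r\big)^{1/r}$, $\langle h\rangle_I:=\langle h\rangle_{1,I}$. For $0<\eta<1$, a family $\mathcal S$ of intervals is $\eta$-sparse if for each $I\in\mathcal S$ there is $E_I\subset I$ with $\eta|I|\le|E_I|$ and the sets $E_I$ are pairwise disjoint. *)

theory Defs
  imports "HOL-Analysis.Analysis"
begin

abbreviation len :: "real set \<Rightarrow> real"
  where "len I \<equiv> measure lborel I"

definition dyadic_system :: "real set set"
  where "dyadic_system = {{2 powi (-k) * m ..< 2 powi (-k) * (m + 1)} | (k::int) m. m \<in> \<int>}"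

(* The factor (-1)^k makes the shifted system nested again when s = 1/3 or s = 2/3. *)
definition shifted_dyadic :: "real \<Rightarrow> real set set"
  where "shifted_dyadic s =
    {{2 powi (-k) * (m + (-1) powi k * s) ..< 2 powi (-k) * (m + 1 + (-1) powi k * s)}
      | (k::int) m. m \<in> \<int>}"

lemma shifted_dyadic_0: "shifted_dyadic 0 = dyadic_system"
  by (simp add: shifted_dyadic_def dyadic_system_def)

definition dyadic_grids :: "real set set set"
  where "dyadic_grids = {dyadic_system, shifted_dyadic (1/3), shifted_dyadic (2/3)}"

(* A tile I \<times> \<omega> is represented by the pair (I, \<omega>); G is the grid of the frequency intervals. *)
type_synonym tile = "real set \<times> real set"

definition is_tile :: "real set set \<Rightarrow> tile \<Rightarrow> bool"
  where "is_tile G P \<longleftrightarrow>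
    fst P \<in> dyadic_system \<and> snd P \<in> G \<and> len (fst P) * len (snd P) = 1"

definition nth_deriv :: "nat \<Rightarrow> (real \<Rightarrow> complex) \<Rightarrow> real \<Rightarrow> complex"
  where "nth_deriv n = (\<lambda>f x. vector_derivative f (at x)) ^^ n"

definition smooth :: "(real \<Rightarrow> complex) \<Rightarrow> bool"
  where "smooth f \<longleftrightarrow> (\<forall>n x. nth_deriv n f differentiable at x)"

definition test_function :: "(real \<Rightarrow> complex) \<Rightarrow> bool"
  where "test_function f \<longleftrightarrow> smooth f \<and> compact (closure {x. f x \<noteq> 0})"

definition fourier :: "(real \<Rightarrow> complex) \<Rightarrow> real \<Rightarrow> complex"
  where "fourier f \<xi> = (LINT x|lborel. f x * cis (- 2 * pi * \<xi> * x))"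

definition L2_inner :: "(real \<Rightarrow> complex) \<Rightarrow> (real \<Rightarrow> complex) \<Rightarrow> complex"
  where "L2_inner f h = (LINT x|lborel. f x * cnj (h x))"

definition center :: "real set \<Rightarrow> real"
  where "center J = (Inf J + Sup J) / 2"

(* Bounds on the derivatives of order at most n0, with decay of order M and constants C n M. *)
definition L1_adapted ::
    "nat \<Rightarrow> nat \<Rightarrow> (nat \<Rightarrow> nat \<Rightarrow> real) \<Rightarrow> tile \<Rightarrow> (real \<Rightarrow> complex) \<Rightarrow> bool"
  where "L1_adapted n0 M C P \<phi> \<longleftrightarrow>
    (\<forall>n\<le>n0. \<forall>x.
      norm (nth_deriv n (\<lambda>y. cis (- 2 * pi * center (snd P) * y) * \<phi> y) x)
        \<le> C n M * (1 / len (fst P) ^ (n + 1))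
            * (1 + infdist x (fst P) / len (fst P)) powi (- int M))"

definition wave_packet ::
    "nat \<Rightarrow> nat \<Rightarrow> (nat \<Rightarrow> nat \<Rightarrow> real) \<Rightarrow> tile \<Rightarrow> (real \<Rightarrow> complex) \<Rightarrow> bool"
  where "wave_packet n0 M C P \<phi> \<longleftrightarrow>
    smooth \<phi> \<and> (\<forall>\<xi>. \<xi> \<notin> snd P \<longrightarrow> fourier \<phi> \<xi> = 0) \<and> L1_adapted n0 M C P \<phi>"

definition whitney_candidates :: "real set set \<Rightarrow> real \<Rightarrow> real \<Rightarrow> real set set"
  where "whitney_candidates G a b =
    {J \<in> G. J \<subseteq> {a..b} \<and> infdist a J \<ge> len J \<and> infdist b J \<ge> len J}"

definition whitney :: "real set set \<Rightarrow> real \<Rightarrow> real \<Rightarrow> real set set"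
  where "whitney G a b =
    {J \<in> whitney_candidates G a b. \<forall>J' \<in> whitney_candidates G a b. J \<subseteq> J' \<longrightarrow> J' = J}"

definition lacunary :: "real \<Rightarrow> real \<Rightarrow> real set \<Rightarrow> bool"
  where "lacunary c a \<omega> \<longleftrightarrow> len \<omega> \<le> c * infdist a \<omega> \<and> infdist a \<omega> \<le> c * len \<omega>"

definition tile_collection ::
    "real set set \<Rightarrow> real \<Rightarrow> real \<Rightarrow> real \<Rightarrow> tile set \<Rightarrow> bool"
  where "tile_collection G c a b Q \<longleftrightarrow>
    finite Q \<and> (\<forall>P\<in>Q. is_tile G P \<and> snd P \<in> whitney G a b \<and> lacunary c a (snd P))"

definition model_form ::
    "nat \<Rightarrow> (nat \<Rightarrow> tile set) \<Rightarrow> (tile \<Rightarrow> real \<Rightarrow> complex)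
      \<Rightarrow> (real \<Rightarrow> complex) \<Rightarrow> (nat \<Rightarrow> real \<Rightarrow> complex) \<Rightarrow> real"
  where "model_form N \<P> \<phi> f g =
    (\<Sum>k=1..N. \<Sum>P\<in>\<P> k.
      len (fst P) * norm (L2_inner f (\<phi> P)) * norm (L2_inner (g k) (\<phi> P)))"

definition l2_norm_fun :: "nat \<Rightarrow> (nat \<Rightarrow> real \<Rightarrow> complex) \<Rightarrow> real \<Rightarrow> real"
  where "l2_norm_fun N g x = sqrt (\<Sum>k=1..N. (norm (g k x))\<^sup>2)"

definition avg :: "real \<Rightarrow> real set \<Rightarrow> (real \<Rightarrow> 'a::real_normed_vector) \<Rightarrow> real"
  where "avg r I h = (1 / len I * (LINT x:I|lborel. norm (h x) powr r)) powr (1 / r)"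

definition sparse_family :: "real \<Rightarrow> real set set \<Rightarrow> bool"
  where "sparse_family \<eta> S \<longleftrightarrow>
    (\<forall>I\<in>S. is_interval I \<and> bounded I \<and> len I > 0) \<and>
    (\<exists>E. (\<forall>I\<in>S. E I \<in> sets lborel \<and> E I \<subseteq> I \<and> \<eta> * len I \<le> len (E I)) \<and>
         disjoint_family_on E S)"

end

theory Submission
  imports Defs "HOL-Probability.Probability"
begin

text \<open>
  Colour the tiles with at most \<open>B\<close> colours so that frequency intervals of one colour are disjoint or equal.
  Packets with different frequency intervals are then orthogonal, which gives Bessel inequalities for \<open>f\<close>,
  globally and, at one fixed interval, with rapidly decaying weights.

  Select dyadic stopping intervals \<open>R\<close> by a jump of the dilated averages of \<open>\<bar>f\<bar>\<^sup>2\<close> or of the length of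
  the vector \<open>g\<close>; the maximal inequality makes them sparse. For the tiles attached to \<open>R\<close>, decompose every
  \<open>g k\<close>, demodulated at \<open>a k\<close>, on the maximal stopping intervals inside \<open>R\<close>. The good part is square
  integrable and is paired with \<open>f\<close> by Bessel. The bad part has mean zero, and lacunarity makes the demodulated
  packets Lipschitz at their own scale, so its pairings are summable in \<open>L\<^sup>1\<close>; there the sum over frequencies
  at a fixed interval is controlled by the local Bessel inequality for \<open>f\<close>.

  This bounds the form by a sum over \<open>R\<close> of products of dilated averages, each of which is at most a constant times
  the product of the averages over a single interval containing \<open>R\<close>, taken from one of two shifted dyadic grids.
  A second stopping argument in these grids extracts the sparse family.
\<close>

section \<open>Orthogonality of functions with disjoint Fourier supports\<close>

text \<open>The frequency intervals may touch, so a packet cannot be cut off smoothly in space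
  without losing orthogonality. Polynomial weights can be used instead: on the Fourier side they act
  as derivatives and keep the supports. Of the decay of order 10, up to 8 orders are spent on such
  weights and 2 on integrability; one derivative provides the cancellation. In this way
  \<open>f\<close> is handled in L^2 at every single interval. For the functions \<open>g k\<close>
  only L^1 averages of the vector length are available, to which Bessel does not apply; hence their
  splitting. The mean subtracted from \<open>g k\<close> must not depend on the tile although the
  packets of index \<open>k\<close> have many frequencies: lacunarity places all frequencies of
  tiles over \<open>I\<close> within a bounded multiple of \<open>1 / len I\<close> of the single
  frequency \<open>a k\<close>, and it also bounds the number of such tiles. The stopping arguments
  leave disjoint portions of half the length. Families belonging to the two grids or to different
  colours are never united: the one with the largest sum is kept, and the number of competitors
  enters the constant.\<close>

lemma borel_measurable_cnj [measurable]: "cnj \<in> borel_measurable borel"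
  by (intro borel_measurable_continuous_onI continuous_intros)

lemma borel_measurable_cis [measurable]: "cis \<in> borel_measurable borel"
  by (intro borel_measurable_continuous_onI continuous_intros)

lemma lborel2_product_integrable:
  fixes u v :: "real \<Rightarrow> complex"
  assumes "integrable lborel u" "integrable lborel v"
  shows "integrable (lborel \<Otimes>\<^sub>M lborel) (\<lambda>(x, y). u x * v y)"
proof (rule lborel_pair.Fubini_integrable)
  show "(\<lambda>(x, y). u x * v y) \<in> borel_measurable (lborel \<Otimes>\<^sub>M lborel)"
    using assms by measurable
  show "integrable lborel (\<lambda>x. LINT y|lborel. norm (case (x, y) of (x, y) \<Rightarrow> u x * v y))"
    using assms by (simp add: norm_mult)
  show "AE x in lborel. integrable lborel (\<lambda>y. case (x, y) of (x, y) \<Rightarrow> u x * v y)"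
    using assms by simp
qed

text \<open>Parseval in averaged form. For each \<open>\<xi>\<close> the double integral of
  \<open>u x * cnj (v y) * cis (2 * pi * s * (y - x) * \<xi>)\<close> factors into two Fourier
  transforms at \<open>s * \<xi>\<close> and vanishes. Averaging in \<open>\<xi>\<close> over the
  standard normal distribution and exchanging the integrals turns the phase into a characteristic
  function, a Gaussian in \<open>y - x\<close> that concentrates as \<open>s\<close> grows.\<close>

lemma gaussian_pairing_zero:
  fixes u v :: "real \<Rightarrow> complex"
  assumes u: "integrable lborel u" and v: "integrable lborel v"
    and z: "\<And>\<xi>. fourier u \<xi> = 0 \<or> fourier v \<xi> = 0"
  shows "(LINT x|lborel. u x * (LINT y|lborel. cnj (v y) * exp (- (2 * pi * s * (y - x))\<^sup>2 / 2))) = 0"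
proof -
  let ?N = std_normal_distribution
  let ?L = "lborel \<Otimes>\<^sub>M lborel :: (real \<times> real) measure"
  let ?F = "\<lambda>\<xi> (x, y). u x * cnj (v y) * cis (2 * pi * s * (y - x) * \<xi>)"
  have N: "real_distribution ?N" by (rule real_dist_normal_dist)
  interpret N: real_distribution ?N by (rule N)
  interpret PP: pair_sigma_finite ?N ?L by standard
  have [measurable]: "u \<in> borel_measurable lborel" "v \<in> borel_measurable lborel" using u v by auto
  have [measurable]: "u \<in> borel_measurable borel" "v \<in> borel_measurable borel" using u v by auto
  have vc: "integrable lborel (\<lambda>y. cnj (v y))" using v by simp
  have iuv: "integrable ?L (\<lambda>(x, y). u x * cnj (v y))"
    by (rule lborel2_product_integrable[OF u vc])
  have [measurable_cong]: "sets ?N = sets borel" by simp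
  have Fm: "case_prod ?F \<in> borel_measurable (?N \<Otimes>\<^sub>M ?L)"
    by measurable
  have Fx: "integrable ?L (?F \<xi>)" for \<xi>
  proof -
    have m: "?F \<xi> \<in> borel_measurable ?L"
      by measurable
    show ?thesis
      by (rule Bochner_Integration.integrable_bound[OF iuv m]) (auto simp: norm_mult)
  qed
  have Fint: "integrable (?N \<Otimes>\<^sub>M ?L) (case_prod ?F)"
  proof (rule PP.Fubini_integrable[OF Fm])
    show "integrable ?N (\<lambda>x. LINT y|?L. norm (case (x, y) of (x, xa) \<Rightarrow> ?F x xa))"
      by (simp add: norm_mult split_beta')
    show "AE x in ?N. integrable ?L (\<lambda>y. case (x, y) of (x, xa) \<Rightarrow> ?F x xa)"
      using Fx by (simp only: prod.case) simp
  qed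
  have L1: "(LINT p|?L. ?F \<xi> p) = 0" for \<xi>
  proof -
    have i: "integrable ?L (\<lambda>(x,y). (u x * cis (- 2 * pi * (s * \<xi>) * x)) * cnj (v y * cis (- 2 * pi * (s * \<xi>) * y)))"
      using Fx[of \<xi>] by (simp add: cis_mult cis_cnj algebra_simps split_beta')
    have "(LINT p|?L. ?F \<xi> p) = (LINT p|?L. (case p of (x,y) \<Rightarrow> (u x * cis (- 2 * pi * (s * \<xi>) * x)) * cnj (v y * cis (- 2 * pi * (s * \<xi>) * y))))"
      by (simp add: cis_mult cis_cnj algebra_simps split_beta')
    also have "\<dots> = (LINT x|lborel. (LINT y|lborel. (u x * cis (- 2 * pi * (s * \<xi>) * x)) * cnj (v y * cis (- 2 * pi * (s * \<xi>) * y))))"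
      using lborel_pair.integral_fst'[OF i] by simp
    also have "\<dots> = fourier u (s * \<xi>) * cnj (fourier v (s * \<xi>))"
      unfolding fourier_def Bochner_Integration.integral_cnj[symmetric] integral_mult_right_zero integral_mult_left_zero ..
    also have "\<dots> = 0" using z[of "s * \<xi>"] by auto
    finally show ?thesis .
  qed
  have "(LINT p|?L. (LINT \<xi>|?N. ?F \<xi> p)) = (LINT \<xi>|?N. (LINT p|?L. ?F \<xi> p))"
    by (rule PP.Fubini_integral[OF Fint])
  also have "\<dots> = 0" by (simp only: L1) simp
  finally have Z: "(LINT p|?L. (LINT \<xi>|?N. ?F \<xi> p)) = 0" .
  have ch: "(LINT \<xi>|?N. cis (t * \<xi>)) = exp (- t\<^sup>2 / 2)" for t :: real
    using fun_cong[OF char_std_normal_distribution, of t]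
    by (simp add: char_def cis_conv_exp exp_of_real[symmetric])
  have G: "(LINT \<xi>|?N. ?F \<xi> p) = (case p of (x,y) \<Rightarrow> u x * (cnj (v y) * exp (- (2 * pi * s * (y - x))\<^sup>2 / 2)))" for p
  proof (cases p)
    case (Pair x y)
    have "(LINT \<xi>|?N. ?F \<xi> p) = u x * cnj (v y) * (LINT \<xi>|?N. cis ((2 * pi * s * (y - x)) * \<xi>))"
      unfolding Pair prod.case integral_mult_right_zero ..
    thus ?thesis using Pair ch[of "2 * pi * s * (y - x)"] by simp
  qed
  have i2: "integrable ?L (\<lambda>(x,y). u x * (cnj (v y) * exp (- (2 * pi * s * (y - x))\<^sup>2 / 2)))"
  proof (rule Bochner_Integration.integrable_bound[OF iuv])
    show "(\<lambda>(x,y). u x * (cnj (v y) * exp (- (2 * pi * s * (y - x))\<^sup>2 / 2))) \<in> borel_measurable ?L"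
      by measurable
    show "AE x in ?L. norm (case x of (x, y) \<Rightarrow> u x * (cnj (v y) * exp (- (2 * pi * s * (y - x))\<^sup>2 / 2)))
         \<le> norm (case x of (x, y) \<Rightarrow> u x * cnj (v y))"
      by (auto simp: norm_mult exp_of_real mult_left_le mult_left_mono intro!: AE_I2 mult_left_mono)
  qed
  have "0 = (LINT p|?L. (case p of (x,y) \<Rightarrow> u x * (cnj (v y) * exp (- (2 * pi * s * (y - x))\<^sup>2 / 2))))"
    using Z unfolding G by simp
  also have "\<dots> = (LINT x|lborel. (LINT y|lborel. u x * (cnj (v y) * exp (- (2 * pi * s * (y - x))\<^sup>2 / 2))))"
    using lborel_pair.integral_fst'[OF i2] by simp
  finally show ?thesis by (simp add: exp_of_real)
qed

text \<open>The Gaussians of \<open>gaussian_pairing_zero\<close> with \<open>s = k + 1\<close>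
  form, up to normalization, an approximate identity. Continuity and boundedness of \<open>v\<close>
  let the smoothed pairings, all zero, converge to a multiple of the true pairing.\<close>

lemma disjoint_fourier_orthogonal:
  fixes u v :: "real \<Rightarrow> complex"
  assumes u: "integrable lborel u" and v: "integrable lborel v"
    and cv: "continuous_on UNIV v" and bv: "\<And>x. norm (v x) \<le> B"
    and z: "\<And>\<xi>. fourier u \<xi> = 0 \<or> fourier v \<xi> = 0"
  shows "(LINT x|lborel. u x * cnj (v x)) = 0"
proof -
  define g :: "real \<Rightarrow> real" where "g w = exp (- (2 * pi * w)\<^sup>2 / 2)" for w
  define n where "n = (\<lambda>w::real. normal_density 0 (1 / (2 * pi)) w)"
  define K where "K = sqrt (2 * pi * (1 / (2 * pi))\<^sup>2)"
  have K: "K > 0" unfolding K_def by simp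
  have gn: "g = (\<lambda>w. K * n w)"
    unfolding g_def n_def K_def normal_density_def by (auto simp: field_simps power2_eq_square)
  have ig: "integrable lborel g" unfolding gn n_def by simp
  have Ig: "(LINT w|lborel. g w) = K" unfolding gn n_def by simp
  have gpos: "g w \<ge> 0" for w by (simp add: g_def)
  have [measurable]: "u \<in> borel_measurable borel" "v \<in> borel_measurable borel" "g \<in> borel_measurable borel"
    using u v ig by auto
  \<comment> \<open>\<open>J k x\<close> is the Gaussian average of \<open>cnj v\<close> around
    \<open>x\<close> after the substitution \<open>y = x + w / (k + 1)\<close>; in this form the
    limit is taken under a fixed integrable majorant.\<close>
  define J where "J k x = (LINT w|lborel. cnj (v (x + (1 / real (Suc k)) * w)) * complex_of_real (g w))" for k x
  have Jm[measurable]: "J k \<in> borel_measurable borel" for k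
    unfolding J_def by measurable
  have B0: "B \<ge> 0" using bv[of 0] norm_ge_zero[of "v 0"] by linarith
  have Jb: "norm (J k x) \<le> B * K" for k x
  proof -
    have "norm (J k x) \<le> (LINT w|lborel. B * g w)"
      unfolding J_def
    proof (rule Bochner_Integration.integral_norm_bound_integral)
      show "integrable lborel (\<lambda>w. B * g w)" using ig by simp
      show "integrable lborel (\<lambda>w. cnj (v (x + (1 / real (Suc k)) * w)) * complex_of_real (g w))"
        by (rule Bochner_Integration.integrable_bound[where f="\<lambda>w. B * g w"])
          (use ig bv gpos B0 in \<open>auto simp: norm_mult intro!: AE_I2 mult_right_mono\<close>)
    qed (use bv gpos in \<open>auto simp: norm_mult intro!: mult_right_mono\<close>)
    thus ?thesis using Ig by simp
  qed
  have Jlim: "(\<lambda>k. J k x) \<longlonglongrightarrow> cnj (v x) * K" for x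
  proof -
    have "(\<lambda>k. J k x) \<longlonglongrightarrow> (LINT w|lborel. cnj (v x) * complex_of_real (g w))"
      unfolding J_def
    proof (rule integral_dominated_convergence[where w="\<lambda>w. B * g w"])
      show "AE w in lborel. (\<lambda>k. cnj (v (x + 1 / real (Suc k) * w)) * complex_of_real (g w))
          \<longlonglongrightarrow> cnj (v x) * complex_of_real (g w)"
      proof (intro AE_I2 tendsto_intros)
        fix w
        have "(\<lambda>k. 1 / real (Suc k)) \<longlonglongrightarrow> 0" by (rule lim_1_over_n[THEN LIMSEQ_Suc])
        hence "(\<lambda>k. x + 1 / real (Suc k) * w) \<longlonglongrightarrow> x + 0 * w" by (intro tendsto_intros)
        hence t: "(\<lambda>k. x + 1 / real (Suc k) * w) \<longlonglongrightarrow> x" by (simp only: mult_zero_left add_0_right)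
        have "isCont v x" using cv by (simp add: continuous_on_eq_continuous_at)
        thus "(\<lambda>k. v (x + 1 / real (Suc k) * w)) \<longlonglongrightarrow> v x"
          by (rule isCont_tendsto_compose[OF _ t])
      qed
    qed (use ig bv gpos in \<open>auto simp: norm_mult intro!: AE_I2 mult_right_mono\<close>)
    also have "(LINT w|lborel. cnj (v x) * complex_of_real (g w)) = cnj (v x) * K"
      using Ig by simp
    finally show ?thesis .
  qed
  have "(\<lambda>k. (LINT x|lborel. u x * J k x)) \<longlonglongrightarrow> (LINT x|lborel. u x * (cnj (v x) * K))"
  proof (rule integral_dominated_convergence[where w="\<lambda>x. norm (u x) * (B * K)"])
    show "AE x in lborel. (\<lambda>k. u x * J k x) \<longlonglongrightarrow> u x * (cnj (v x) * complex_of_real K)"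
      by (intro AE_I2 tendsto_intros Jlim)
    show "AE x in lborel. norm (u x * J k x) \<le> norm (u x) * (B * K)" for k
      using Jb by (auto simp: norm_mult intro!: AE_I2 mult_left_mono)
  qed (use u in auto)
  moreover have "(LINT x|lborel. u x * J k x) = 0" for k
  proof -
    let ?s = "real (Suc k)"
    have "J k x = ?s * (LINT y|lborel. cnj (v y) * exp (- (2 * pi * ?s * (y - x))\<^sup>2 / 2))" for x
    proof -
      have "(LINT y|lborel. cnj (v y) * exp (- (2 * pi * ?s * (y - x))\<^sup>2 / 2)) =
         \<bar>1 / ?s\<bar> *\<^sub>R (LINT w|lborel. cnj (v (x + (1 / ?s) * w)) * exp (- (2 * pi * ?s * ((x + (1 / ?s) * w) - x))\<^sup>2 / 2))"
        by (rule lborel_integral_real_affine) simp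
      also have "\<dots> = \<bar>1 / ?s\<bar> *\<^sub>R J k x"
        unfolding J_def g_def by (simp add: exp_of_real power_mult_distrib del: of_nat_Suc)
      finally show ?thesis by (simp add: scaleR_conv_of_real field_simps del: of_nat_Suc)
    qed
    hence "(LINT x|lborel. u x * J k x) =
       (LINT x|lborel. ?s * (u x * (LINT y|lborel. cnj (v y) * exp (- (2 * pi * ?s * (y - x))\<^sup>2 / 2))))"
      by (simp add: mult_ac del: of_nat_Suc)
    also have "\<dots> = ?s * 0"
      unfolding integral_mult_right_zero gaussian_pairing_zero[OF u v z] by simp
    finally show ?thesis by simp
  qed
  ultimately have "(LINT x|lborel. u x * (cnj (v x) * K)) = 0"
    by (simp only: LIMSEQ_const_iff)
  hence "(LINT x|lborel. (u x * cnj (v x)) * complex_of_real K) = 0" by (simp add: mult_ac)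
  thus ?thesis using K unfolding integral_mult_left_zero by simp
qed

section \<open>Bounded functions with bounded support\<close>

text \<open>The decompositions below cut functions by indicators of intervals, so smoothness is
  lost. This class survives multiplication by indicators and by continuous functions and makes all
  integrals converge. One \<open>R\<close> serves both as bound and as radius of the
  support.\<close>

definition bdd_supp :: "(real \<Rightarrow> 'a::{banach,second_countable_topology}) \<Rightarrow> bool"
  where "bdd_supp h \<longleftrightarrow> h \<in> borel_measurable borel \<and> (\<exists>R\<ge>0. (\<forall>x. norm (h x) \<le> R) \<and> (\<forall>x. R < \<bar>x\<bar> \<longrightarrow> h x = 0))"

lemma bdd_supp_measurable [measurable_dest]: "bdd_supp h \<Longrightarrow> h \<in> borel_measurable borel"
  by (simp add: bdd_supp_def)

lemma bdd_suppI:
  assumes "h \<in> borel_measurable borel" "\<And>x. norm (h x) \<le> A" "\<And>x. B < \<bar>x\<bar> \<Longrightarrow> h x = 0"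
  shows "bdd_supp h"
  unfolding bdd_supp_def
proof (intro conjI exI[of _ "max (max A B) 0"] allI impI)
  show "norm (h x) \<le> max (max A B) 0" for x using assms(2)[of x] by linarith
qed (use assms in auto)

lemma bdd_supp_integrable:
  assumes "bdd_supp h" shows "integrable lborel h"
proof -
  obtain R where R: "R \<ge> 0" "\<And>x. norm (h x) \<le> R" "\<And>x. R < \<bar>x\<bar> \<Longrightarrow> h x = 0"
    using assms unfolding bdd_supp_def by blast
  have m: "h \<in> borel_measurable lborel" using assms by (simp add: bdd_supp_def)
  show ?thesis
  proof (rule Bochner_Integration.integrable_bound[OF _ m])
    show "integrable lborel (\<lambda>x. R * indicator {-R..R} x :: real)"
      by (intro integrable_mult_right integrable_real_indicator) (auto simp: R(1))
    show "AE x in lborel. norm (h x) \<le> norm (R * indicator {- R..R} x)"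
      using R by (intro AE_I2) (auto simp: indicator_def abs_le_iff not_le)
  qed
qed

lemma bdd_supp_dominated:
  assumes "bdd_supp h" "k \<in> borel_measurable borel" "\<And>x. norm (k x) \<le> C * norm (h x)"
  shows "bdd_supp k"
proof -
  obtain R where R: "R \<ge> 0" "\<And>x. norm (h x) \<le> R" "\<And>x. R < \<bar>x\<bar> \<Longrightarrow> h x = 0"
    using assms(1) unfolding bdd_supp_def by blast
  show ?thesis
  proof (rule bdd_suppI[OF assms(2), of "\<bar>C\<bar> * R" R])
    show "norm (k x) \<le> \<bar>C\<bar> * R" for x
    proof -
      have "C * norm (h x) \<le> \<bar>C\<bar> * R" using R(2)[of x] by (intro mult_mono) auto
      thus ?thesis using assms(3)[of x] by linarith
    qed
    show "k x = 0" if "R < \<bar>x\<bar>" for x using assms(3)[of x] R(3)[OF that] by simp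
  qed
qed

lemma bdd_supp_mult_continuous:
  fixes h :: "real \<Rightarrow> 'a::{banach,second_countable_topology,real_normed_algebra}"
  assumes "bdd_supp h" "continuous_on UNIV k"
  shows "bdd_supp (\<lambda>x. h x * k x)"
proof -
  obtain R where R: "R \<ge> 0" "\<And>x. norm (h x) \<le> R" "\<And>x. R < \<bar>x\<bar> \<Longrightarrow> h x = 0"
    using assms(1) unfolding bdd_supp_def by blast
  have "compact (k ` {-R..R})"
    by (rule compact_continuous_image) (use assms(2) in \<open>auto intro: continuous_on_subset\<close>)
  then obtain D where D: "\<And>y. y \<in> k ` {-R..R} \<Longrightarrow> norm y \<le> D"
    using compact_imp_bounded bounded_iff by metis
  have [measurable]: "k \<in> borel_measurable borel" by (rule borel_measurable_continuous_onI[OF assms(2)])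
  have [measurable]: "h \<in> borel_measurable borel" using assms by (simp add: bdd_supp_def)
  have "norm (h x * k x) \<le> \<bar>D\<bar> * norm (h x)" for x
  proof (cases "R < \<bar>x\<bar>")
    case False
    hence "norm (k x) \<le> \<bar>D\<bar>" using D[of "k x"] by fastforce
    hence "norm (h x) * norm (k x) \<le> norm (h x) * \<bar>D\<bar>" by (rule mult_left_mono) simp
    thus ?thesis using norm_mult_ineq[of "h x" "k x"] by (simp add: mult.commute)
  qed (simp add: R)
  thus ?thesis by (intro bdd_supp_dominated[OF assms(1)]) measurable
qed

lemma bdd_supp_mult_bounded:
  fixes h :: "real \<Rightarrow> 'a::{banach,second_countable_topology,real_normed_algebra}"
  assumes "bdd_supp h" and [measurable]: "k \<in> borel_measurable borel" and "\<And>x. norm (k x) \<le> D"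
  shows "bdd_supp (\<lambda>x. h x * k x)"
proof -
  have [measurable]: "h \<in> borel_measurable borel" using assms by (simp add: bdd_supp_def)
  have "norm (h x * k x) \<le> D * norm (h x)" for x
    using norm_mult_ineq[of "h x" "k x"] mult_left_mono[OF assms(3)[of x] norm_ge_zero[of "h x"]]
    by (simp add: mult.commute)
  thus ?thesis by (intro bdd_supp_dominated[OF assms(1)]) measurable
qed

lemma bdd_supp_indicator:
  fixes h :: "real \<Rightarrow> 'a::{banach,second_countable_topology,real_normed_algebra_1}"
  assumes "bdd_supp h" and "A \<in> sets borel"
  shows "bdd_supp (\<lambda>x. indicator A x * h x)"
proof -
  have [measurable]: "h \<in> borel_measurable borel" "A \<in> sets borel" using assms by (auto simp: bdd_supp_def)
  show ?thesis
    by (rule bdd_supp_dominated[OF assms(1), where C=1]) (measurable, auto simp: indicator_def)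
qed

lemma bdd_supp_norm: "bdd_supp h \<Longrightarrow> bdd_supp (\<lambda>x. norm (h x))"
  by (rule bdd_supp_dominated[where C=1]) (auto simp: bdd_supp_def)

lemma bdd_supp_norm_square: "bdd_supp h \<Longrightarrow> bdd_supp (\<lambda>x. (norm (h x))\<^sup>2)"
proof -
  assume a: "bdd_supp h"
  obtain R where R: "R \<ge> 0" "\<And>x. norm (h x) \<le> R" "\<And>x. R < \<bar>x\<bar> \<Longrightarrow> h x = 0"
    using a unfolding bdd_supp_def by blast
  have [measurable]: "h \<in> borel_measurable borel" using a by (simp add: bdd_supp_def)
  show ?thesis
    by (rule bdd_supp_dominated[OF a, where C=R])
      (measurable, use R in \<open>auto simp: power2_eq_square intro!: mult_right_mono\<close>)
qed

lemma bdd_supp_add: "bdd_supp h \<Longrightarrow> bdd_supp k \<Longrightarrow> bdd_supp (\<lambda>x. h x + k x)"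
proof -
  assume a: "bdd_supp h" "bdd_supp k"
  obtain R where R: "R \<ge> 0" "\<And>x. norm (h x) \<le> R" "\<And>x. R < \<bar>x\<bar> \<Longrightarrow> h x = 0"
    using a(1) unfolding bdd_supp_def by blast
  obtain S where S: "S \<ge> 0" "\<And>x. norm (k x) \<le> S" "\<And>x. S < \<bar>x\<bar> \<Longrightarrow> k x = 0"
    using a(2) unfolding bdd_supp_def by blast
  have [measurable]: "h \<in> borel_measurable borel" "k \<in> borel_measurable borel" using a by (auto simp: bdd_supp_def)
  show ?thesis
    by (rule bdd_suppI[where A="R + S" and B="R + S"])
      (measurable, use R S in \<open>auto intro!: norm_triangle_le add_mono\<close>)
qed

lemma bdd_supp_const0: "bdd_supp (\<lambda>x. 0)"
  by (rule bdd_suppI[of _ 0 0]) auto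

lemma bdd_supp_sum: "(\<And>i. i \<in> A \<Longrightarrow> bdd_supp (h i)) \<Longrightarrow> bdd_supp (\<lambda>x. \<Sum>i\<in>A. h i x)"
  by (induction A rule: infinite_finite_induct) (auto intro: bdd_supp_add bdd_supp_const0)

section \<open>Moments, weights and Bessel inequalities\<close>

lemma norm_cis_minus_one_le: "norm (cis t - 1) \<le> \<bar>t\<bar>"
proof -
  have "norm (cis t - 1) = 2 * \<bar>sin (t / 2)\<bar>"
    using dist_exp_i_1[of t] by (simp add: cis_conv_exp)
  thus ?thesis using abs_sin_x_le_abs_x[of "t / 2"] by simp
qed

lemma cis_difference_quotient:
  "(\<lambda>n. of_nat (Suc n) * (cis (- (x / real (Suc n))) - 1)) \<longlonglongrightarrow> - \<i> * complex_of_real x"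
proof -
  define z where "z = - \<i> * complex_of_real x"
  have "((\<lambda>t. exp (z * t)) has_field_derivative z) (at 0)"
    by (auto intro!: derivative_eq_intros)
  hence d: "((\<lambda>h. (exp (z * h) - 1) / h) \<longlongrightarrow> z) (at 0)"
    by (simp add: DERIV_def)
  have "filterlim (\<lambda>n. 1 / of_nat (Suc n) :: complex) (at 0) sequentially"
    unfolding filterlim_at
    by (intro conjI eventuallyI lim_1_over_n[THEN LIMSEQ_Suc]) (auto simp del: of_nat_Suc)
  from filterlim_compose[OF d this]
  have "(\<lambda>n. (exp (z * (1 / of_nat (Suc n))) - 1) / (1 / of_nat (Suc n))) \<longlonglongrightarrow> z" .
  moreover have "(exp (z * (1 / of_nat (Suc n))) - 1) / (1 / of_nat (Suc n)) =
     of_nat (Suc n) * (cis (- (x / real (Suc n))) - 1)" for n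
    by (simp add: z_def cis_conv_exp mult.commute del: of_nat_Suc)
  ultimately show ?thesis unfolding z_def by (simp only:)
qed

text \<open>The polynomial factors are produced by difference quotients in \<open>\<eta>\<close>. Only one sign of \<open>\<eta>\<close> is
  available, since a modulation must not move one of two adjacent frequency intervals into the other.\<close>

lemma moments_vanish:
  fixes F :: "real \<Rightarrow> complex"
  assumes int: "\<And>j. j \<le> m \<Longrightarrow> integrable lborel (\<lambda>x. complex_of_real (((x - c) / l) ^ j) * F x)"
    and z: "\<And>\<eta>. \<eta> \<ge> 0 \<Longrightarrow> (LINT x|lborel. cis (- (\<eta> * x)) * F x) = 0"
    and l: "l > 0"
  shows "j \<le> m \<Longrightarrow> \<eta> \<ge> 0 \<Longrightarrow>
    (LINT x|lborel. cis (- (\<eta> * ((x - c) / l))) * (complex_of_real (((x - c) / l) ^ j) * F x)) = 0"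
proof (induction j arbitrary: \<eta>)
  case 0
  have "(LINT x|lborel. cis (- (\<eta> * ((x - c) / l))) * (complex_of_real (((x - c) / l) ^ 0) * F x)) =
     (LINT x|lborel. cis (\<eta> * c / l) * (cis (- ((\<eta> / l) * x)) * F x))"
    by (simp add: mult.assoc[symmetric] cis_mult diff_divide_distrib right_diff_distrib)
  also have "\<dots> = cis (\<eta> * c / l) * 0"
    unfolding integral_mult_right_zero using z[of "\<eta> / l"] 0 l by simp
  finally show ?case by simp
next
  case (Suc j)
  let ?y = "\<lambda>x. (x - c) / l"
  let ?H = "\<lambda>x. complex_of_real (?y x ^ j) * F x"
  have iH: "integrable lborel ?H" using int[of j] Suc by simp
  have iS: "integrable lborel (\<lambda>x. complex_of_real (?y x ^ Suc j) * F x)" using int[of "Suc j"] Suc by simp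
  have iHc: "integrable lborel (\<lambda>x. cis (- (\<theta> * ?y x)) * ?H x)" for \<theta>
    by (rule Bochner_Integration.integrable_bound[OF iH]) (use iH in \<open>auto simp: norm_mult\<close>)
  have "(\<lambda>n. (LINT x|lborel. of_nat (Suc n) * (cis (- (?y x / real (Suc n))) - 1) * (cis (- (\<eta> * ?y x)) * ?H x)))
     \<longlonglongrightarrow> (LINT x|lborel. (- \<i> * complex_of_real (?y x)) * (cis (- (\<eta> * ?y x)) * ?H x))"
  \<comment> \<open>By \<open>norm (cis t - 1) \<le> \<bar>t\<bar>\<close> the quotients are bounded
    by the next moment, which is integrable by assumption.\<close>
  proof (rule integral_dominated_convergence[where w="\<lambda>x. norm (complex_of_real (?y x ^ Suc j) * F x)"])
    show "AE x in lborel. (\<lambda>n. of_nat (Suc n) * (cis (- (?y x / real (Suc n))) - 1) * (cis (- (\<eta> * ?y x)) * ?H x))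
      \<longlonglongrightarrow> (- \<i> * complex_of_real (?y x)) * (cis (- (\<eta> * ?y x)) * ?H x)"
      by (intro AE_I2 tendsto_mult[OF cis_difference_quotient tendsto_const])
    show "AE x in lborel. norm (of_nat (Suc n) * (cis (- (?y x / real (Suc n))) - 1) * (cis (- (\<eta> * ?y x)) * ?H x))
       \<le> norm (complex_of_real (?y x ^ Suc j) * F x)" for n
    proof (intro AE_I2)
      fix x
      have "norm (of_nat (Suc n) * (cis (- (?y x / real (Suc n))) - 1)) \<le> \<bar>?y x\<bar>"
        using mult_left_mono[OF norm_cis_minus_one_le[of "- (?y x / real (Suc n))"], of "real (Suc n)"]
        unfolding norm_mult norm_of_nat abs_minus abs_divide abs_of_nat by (simp del: of_nat_Suc)
      hence "norm (of_nat (Suc n) * (cis (- (?y x / real (Suc n))) - 1)) * norm (?H x) \<le> \<bar>?y x\<bar> * norm (?H x)"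
        by (rule mult_right_mono) simp
      also have "\<dots> = norm (complex_of_real (?y x ^ Suc j) * F x)"
        by (simp only: norm_mult norm_of_real power_Suc abs_mult mult.assoc)
      finally show "norm (of_nat (Suc n) * (cis (- (?y x / real (Suc n))) - 1) * (cis (- (\<eta> * ?y x)) * ?H x))
       \<le> norm (complex_of_real (?y x ^ Suc j) * F x)"
        by (simp only: norm_mult norm_cis mult_1_left)
    qed
    have "integrable lborel F" using int[of 0] by simp
    hence [measurable]: "F \<in> borel_measurable borel" by auto
    show "(\<lambda>x. (- \<i> * complex_of_real (?y x)) * (cis (- (\<eta> * ?y x)) * ?H x)) \<in> borel_measurable lborel"
      by (intro borel_measurable_times) measurable
    show "(\<lambda>x. of_nat (Suc n) * (cis (- (?y x / real (Suc n))) - 1) * (cis (- (\<eta> * ?y x)) * ?H x)) \<in> borel_measurable lborel" for n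
      by (intro borel_measurable_times) measurable
  qed (use iS in simp)
  \<comment> \<open>The quotient at \<open>\<eta>\<close> evaluates the induction hypothesis at
    \<open>\<eta>\<close> and at \<open>\<eta> + 1 / (n + 1)\<close>, both nonnegative; this is why
    the induction carries all \<open>\<eta> \<ge> 0\<close> and not just 0.\<close>
  moreover have "(LINT x|lborel. of_nat (Suc n) * (cis (- (?y x / real (Suc n))) - 1) * (cis (- (\<eta> * ?y x)) * ?H x)) = 0" for n
  proof -
    have e: "cis (- ((\<eta> + 1 / real (Suc n)) * y)) = cis (- (y / real (Suc n))) * cis (- (\<eta> * y))" for y
      by (simp add: cis_mult algebra_simps del: of_nat_Suc)
    have "(LINT x|lborel. of_nat (Suc n) * (cis (- (?y x / real (Suc n))) - 1) * (cis (- (\<eta> * ?y x)) * ?H x)) =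
       (LINT x|lborel. of_nat (Suc n) * (cis (- ((\<eta> + 1 / real (Suc n)) * ?y x)) * ?H x) - of_nat (Suc n) * (cis (- (\<eta> * ?y x)) * ?H x))"
      by (rule Bochner_Integration.integral_cong[OF refl]) (simp only: e, simp only: algebra_simps mult_1_left)
    also have "\<dots> = of_nat (Suc n) * (LINT x|lborel. cis (- ((\<eta> + 1 / real (Suc n)) * ?y x)) * ?H x) - of_nat (Suc n) * (LINT x|lborel. cis (- (\<eta> * ?y x)) * ?H x)"
      by (subst Bochner_Integration.integral_diff) (use iHc in \<open>auto simp del: of_nat_Suc\<close>)
    also have "\<dots> = 0" using Suc by (simp del: of_nat_Suc)
    finally show ?thesis .
  qed
  ultimately have "(LINT x|lborel. (- \<i> * complex_of_real (?y x)) * (cis (- (\<eta> * ?y x)) * ?H x)) = 0"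
    by (simp only: LIMSEQ_const_iff)
  hence "(LINT x|lborel. - \<i> * (cis (- (\<eta> * ?y x)) * (complex_of_real (?y x ^ Suc j) * F x))) = 0"
    by (simp add: mult_ac)
  thus ?case unfolding integral_mult_right_zero by simp
qed

text \<open>Distances are measured from the centre of an interval and not from the interval. This
  costs a constant factor (\<open>adapted_weight_le\<close>) and makes weights at two centres
  comparable by the triangle inequality.\<close>

definition wt :: "real \<Rightarrow> real \<Rightarrow> real \<Rightarrow> real"
  where "wt c l x = 1 + \<bar>x - c\<bar> / l"

lemma wt_ge_1: "l > 0 \<Longrightarrow> wt c l x \<ge> 1"
  by (simp add: wt_def)

lemma wt_pos: "l > 0 \<Longrightarrow> wt c l x > 0"
  using wt_ge_1[of l c x] by linarith

lemma wt_commute: "wt c l x = wt x l c"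
  by (simp add: wt_def abs_minus_commute)

lemma wt_measurable [measurable]: "wt c l \<in> borel_measurable borel"
  unfolding wt_def by measurable

lemma wt_product: "l > 0 \<Longrightarrow> wt a l b \<le> wt a l x * wt b l x"
proof -
  assume l: "l > 0"
  have "\<bar>b - a\<bar> / l \<le> \<bar>x - a\<bar> / l + \<bar>x - b\<bar> / l"
    using l by (simp add: add_divide_distrib[symmetric] divide_right_mono)
  moreover have "0 \<le> (\<bar>x - a\<bar> / l) * (\<bar>x - b\<bar> / l)" using l by simp
  moreover have "wt a l x * wt b l x = 1 + \<bar>x - a\<bar> / l + \<bar>x - b\<bar> / l + (\<bar>x - a\<bar> / l) * (\<bar>x - b\<bar> / l)"
    by (simp only: wt_def distrib_left distrib_right mult_1_left mult_1_right add.assoc)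
  ultimately show ?thesis unfolding wt_def[of a l b] by linarith
qed

lemma wt_power_antimono: "l > 0 \<Longrightarrow> m \<le> n \<Longrightarrow> 1 / wt c l x ^ n \<le> 1 / wt c l x ^ m"
  by (intro divide_left_mono power_increasing wt_ge_1 mult_pos_pos zero_less_power wt_pos) auto

text \<open>Comparison with a rescaled \<open>inverse (1 + x\<^sup>2)\<close>, whose integral is
  \<open>pi\<close>; rounding \<open>pi\<close> up gives the 4.\<close>

lemma wt_integrable:
  assumes l: "l > 0" and n: "2 \<le> n"
  shows "integrable lborel (\<lambda>x. 1 / wt c l x ^ n)"
    and "(LINT x|lborel. 1 / wt c l x ^ n) \<le> 4 * l"
proof -
  let ?q = "\<lambda>x::real. inverse (1 + x\<^sup>2)"
  have q: "integrable lborel ?q" and Q: "(LINT x|lborel. ?q x) = pi"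
    using integrable_inverse_1_plus_square LBINT_inverse_1_plus_square
    by (auto simp: set_integrable_def interval_lebesgue_integral_def set_lebesgue_integral_def)
  have q2: "integrable lborel (\<lambda>x. ?q (- c / l + (1 / l) * x))"
    using l by (intro lborel_integrable_real_affine[OF q]) auto
  have "(LINT x|lborel. ?q x) = \<bar>1 / l\<bar> *\<^sub>R (LINT x|lborel. ?q (- c / l + (1 / l) * x))"
    by (rule lborel_integral_real_affine) (use l in simp)
  hence Q2: "(LINT x|lborel. ?q (- c / l + (1 / l) * x)) = pi * l" using Q l by (simp add: field_simps)
  have le: "1 / wt c l x ^ n \<le> ?q (- c / l + (1 / l) * x)" for x
  proof -
    have "1 / wt c l x ^ n \<le> 1 / wt c l x ^ 2" by (rule wt_power_antimono[OF l n])
    also have "\<dots> \<le> 1 / (1 + (- c / l + (1 / l) * x)\<^sup>2)"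
    proof (rule divide_left_mono)
      have e: "- c / l + (1 / l) * x = (x - c) / l" using l by (simp add: field_simps)
      have "(wt c l x)\<^sup>2 = 1 + 2 * (\<bar>x - c\<bar> / l) + (\<bar>x - c\<bar> / l)\<^sup>2"
        unfolding wt_def by (simp add: power2_eq_square algebra_simps)
      thus "1 + (- c / l + (1 / l) * x)\<^sup>2 \<le> (wt c l x)\<^sup>2"
        unfolding e using l by (simp add: power_divide)
    qed (use l wt_pos[OF l, of c x] in \<open>auto intro!: mult_pos_pos add_pos_nonneg\<close>)
    finally show ?thesis by (simp add: inverse_eq_divide)
  qed
  have pos: "0 \<le> 1 / wt c l x ^ n" for x using wt_pos[OF l, of c x] by simp
  show i: "integrable lborel (\<lambda>x. 1 / wt c l x ^ n)"
    by (rule Bochner_Integration.integrable_bound[OF q2])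
      (measurable, use le pos order_trans in \<open>auto intro!: AE_I2 simp: abs_of_nonneg intro: order_trans\<close>)
  have "(LINT x|lborel. 1 / wt c l x ^ n) \<le> pi * l"
    unfolding Q2[symmetric] by (rule integral_mono[OF i q2 le])
  also have "\<dots> \<le> 4 * l" using pi_less_4 l by (intro mult_right_mono) auto
  finally show "(LINT x|lborel. 1 / wt c l x ^ n) \<le> 4 * l" .
qed

text \<open>Schur test on the Gram matrix combined with duality. With \<open>v\<close> the sum of
  the \<open>c i * u i\<close>, the squared norm of \<open>v\<close> is at most \<open>D * S\<close>
  by the row sums. The pairing of \<open>f\<close> with \<open>v\<close> equals \<open>S\<close> and
  is at most \<open>D / 2\<close> times the squared norm of \<open>f\<close> plus
  \<open>S / 2\<close>; the last term is absorbed on the left.\<close>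

lemma schur_bessel:
  fixes u :: "'i \<Rightarrow> real \<Rightarrow> complex" and f :: "real \<Rightarrow> complex"
  assumes X: "finite X" and D: "D > 0"
    and f: "integrable lborel (\<lambda>x. (norm (f x))\<^sup>2)"
    and fu: "\<And>i. i \<in> X \<Longrightarrow> integrable lborel (\<lambda>x. f x * cnj (u i x))"
    and uu: "\<And>i j. i \<in> X \<Longrightarrow> j \<in> X \<Longrightarrow> integrable lborel (\<lambda>x. u i x * cnj (u j x))"
    and g: "\<And>i. i \<in> X \<Longrightarrow> (\<Sum>j\<in>X. norm (LINT x|lborel. u i x * cnj (u j x))) \<le> D"
  shows "(\<Sum>i\<in>X. (norm (LINT x|lborel. f x * cnj (u i x)))\<^sup>2) \<le> D * (LINT x|lborel. (norm (f x))\<^sup>2)"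
proof -
  define c where "c i = (LINT x|lborel. f x * cnj (u i x))" for i
  define G where "G i j = (LINT x|lborel. u i x * cnj (u j x))" for i j
  define S where "S = (\<Sum>i\<in>X. (norm (c i))\<^sup>2)"
  define v where "v x = (\<Sum>i\<in>X. c i * u i x)" for x
  have Gsym: "norm (G j i) = norm (G i j)" for i j
  proof -
    have "G j i = cnj (G i j)" unfolding G_def Bochner_Integration.integral_cnj[symmetric] by (simp add: mult.commute)
    thus ?thesis by simp
  qed
  have fv: "f x * cnj (v x) = (\<Sum>i\<in>X. cnj (c i) * (f x * cnj (u i x)))" for x
    by (simp add: v_def sum_distrib_left mult_ac)
  have ifv: "integrable lborel (\<lambda>x. f x * cnj (v x))"
    unfolding fv by (intro Bochner_Integration.integrable_sum integrable_mult_right fu)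
  have Ifv: "(LINT x|lborel. f x * cnj (v x)) = complex_of_real S"
  proof -
    have "(LINT x|lborel. f x * cnj (v x)) = (\<Sum>i\<in>X. cnj (c i) * c i)"
      unfolding fv c_def by (subst Bochner_Integration.integral_sum) (auto intro: fu)
    thus ?thesis unfolding S_def by (simp add: complex_norm_square mult.commute del: of_real_power)
  qed
  have vv: "v x * cnj (v x) = (\<Sum>i\<in>X. \<Sum>j\<in>X. c i * cnj (c j) * (u i x * cnj (u j x)))" for x
    by (simp add: v_def sum_product cnj_sum mult_ac)
  have ivv: "integrable lborel (\<lambda>x. v x * cnj (v x))"
    unfolding vv by (intro Bochner_Integration.integrable_sum integrable_mult_right uu)
  have Ivv: "(LINT x|lborel. v x * cnj (v x)) = (\<Sum>i\<in>X. \<Sum>j\<in>X. c i * cnj (c j) * G i j)"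
    unfolding vv G_def
    by (subst Bochner_Integration.integral_sum, intro Bochner_Integration.integrable_sum integrable_mult_right uu,
        assumption+, intro sum.cong refl,
        subst Bochner_Integration.integral_sum, auto intro: uu)
  have "norm (LINT x|lborel. v x * cnj (v x)) \<le> (\<Sum>i\<in>X. \<Sum>j\<in>X. norm (c i) * norm (c j) * norm (G i j))"
    unfolding Ivv by (intro sum_norm_le) (simp add: norm_mult)
  \<comment> \<open>Splitting the product into squares and using the symmetry of the Gram matrix
    leaves only row sums.\<close>
  also have "\<dots> \<le> (\<Sum>i\<in>X. \<Sum>j\<in>X. ((norm (c i))\<^sup>2 * norm (G i j) + (norm (c j))\<^sup>2 * norm (G j i)) / 2)"
  proof (intro sum_mono)
    fix i j
    have "2 * (norm (c i) * norm (c j)) \<le> (norm (c i))\<^sup>2 + (norm (c j))\<^sup>2"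
      using sum_squares_bound[of "norm (c i)" "norm (c j)"] by simp
    hence "2 * (norm (c i) * norm (c j)) * norm (G i j) \<le> ((norm (c i))\<^sup>2 + (norm (c j))\<^sup>2) * norm (G i j)"
      by (rule mult_right_mono) simp
    thus "norm (c i) * norm (c j) * norm (G i j) \<le> ((norm (c i))\<^sup>2 * norm (G i j) + (norm (c j))\<^sup>2 * norm (G j i)) / 2"
      by (simp add: Gsym[of i j] algebra_simps)
  qed
  also have "\<dots> = ((\<Sum>i\<in>X. \<Sum>j\<in>X. (norm (c i))\<^sup>2 * norm (G i j)) + (\<Sum>i\<in>X. \<Sum>j\<in>X. (norm (c j))\<^sup>2 * norm (G j i))) / 2"
    by (simp add: sum.distrib sum_divide_distrib[symmetric])
  also have "(\<Sum>i\<in>X. \<Sum>j\<in>X. (norm (c j))\<^sup>2 * norm (G j i)) = (\<Sum>i\<in>X. \<Sum>j\<in>X. (norm (c i))\<^sup>2 * norm (G i j))"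
    by (rule sum.swap)
  also have "((\<Sum>i\<in>X. \<Sum>j\<in>X. (norm (c i))\<^sup>2 * norm (G i j)) + (\<Sum>i\<in>X. \<Sum>j\<in>X. (norm (c i))\<^sup>2 * norm (G i j))) / 2
      = (\<Sum>i\<in>X. (norm (c i))\<^sup>2 * (\<Sum>j\<in>X. norm (G i j)))"
    unfolding sum_distrib_left by simp
  also have "\<dots> \<le> (\<Sum>i\<in>X. (norm (c i))\<^sup>2 * D)"
    using g unfolding G_def by (intro sum_mono mult_left_mono) auto
  also have "\<dots> = D * S" by (simp only: S_def sum_distrib_right mult.commute[of D])
  finally have V: "norm (LINT x|lborel. v x * cnj (v x)) \<le> D * S" .
  have rv: "Re (v x * cnj (v x)) = (norm (v x))\<^sup>2" for x by (simp add: complex_mult_cnj cmod_power2)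
  have iv2: "integrable lborel (\<lambda>x. (norm (v x))\<^sup>2)"
    using integrable_Re[OF ivv] unfolding rv .
  have "(LINT x|lborel. (norm (v x))\<^sup>2) = Re (LINT x|lborel. v x * cnj (v x))"
    using integral_Re[OF ivv] unfolding rv .
  hence V2: "(LINT x|lborel. (norm (v x))\<^sup>2) \<le> D * S"
    using V complex_Re_le_cmod[of "LINT x|lborel. v x * cnj (v x)"] by linarith
  have "S = (LINT x|lborel. Re (f x * cnj (v x)))"
    using integral_Re[OF ifv] Ifv by simp
  also have "\<dots> \<le> (LINT x|lborel. (D / 2) * (norm (f x))\<^sup>2 + (1 / (2 * D)) * (norm (v x))\<^sup>2)"
  proof (rule integral_mono)
    show "integrable lborel (\<lambda>x. D / 2 * (norm (f x))\<^sup>2 + 1 / (2 * D) * (norm (v x))\<^sup>2)"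
      using f iv2 by simp
    fix x
    have "Re (f x * cnj (v x)) \<le> norm (f x) * norm (v x)"
      using complex_Re_le_cmod[of "f x * cnj (v x)"] by (simp add: norm_mult)
    moreover have "0 \<le> (D * norm (f x) - norm (v x))\<^sup>2 / (2 * D)" using D by simp
    hence "norm (f x) * norm (v x) \<le> D / 2 * (norm (f x))\<^sup>2 + 1 / (2 * D) * (norm (v x))\<^sup>2"
      using D by (simp add: power2_eq_square field_simps)
    ultimately show "Re (f x * cnj (v x)) \<le> D / 2 * (norm (f x))\<^sup>2 + 1 / (2 * D) * (norm (v x))\<^sup>2"
      by linarith
  qed (rule integrable_Re[OF ifv])
  also have "\<dots> = D / 2 * (LINT x|lborel. (norm (f x))\<^sup>2) + 1 / (2 * D) * (LINT x|lborel. (norm (v x))\<^sup>2)"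
    using f iv2 by simp
  also have "\<dots> \<le> D / 2 * (LINT x|lborel. (norm (f x))\<^sup>2) + 1 / (2 * D) * (D * S)"
    using V2 D by (intro add_left_mono mult_left_mono) auto
  finally have "S \<le> D * (LINT x|lborel. (norm (f x))\<^sup>2)" using D by simp
  thus ?thesis by (simp only: S_def c_def)
qed

section \<open>Dyadic grids\<close>

lemma two_powi_le_iff: "(2::real) powi i \<le> 2 powi j \<longleftrightarrow> i \<le> j"
  using power_int_increasing[of i j "2::real"] power_int_strict_increasing[of j i "2::real"]
  by (cases "i \<le> j") auto

lemma two_powi_eq_iff: "(2::real) powi i = 2 powi j \<longleftrightarrow> i = j"
  by (metis order_antisym order_refl two_powi_le_iff)

definition gridpt :: "real \<Rightarrow> int \<Rightarrow> int \<Rightarrow> real"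
  where "gridpt s k m = 2 powi (-k) * (of_int m + (-1) powi k * s)"

definition cell :: "real \<Rightarrow> int \<Rightarrow> int \<Rightarrow> real set"
  where "cell s k m = {gridpt s k m ..< gridpt s k (m + 1)}"

lemma gridpt_less_iff: "gridpt s k m < gridpt s k n \<longleftrightarrow> m < n"
  by (simp add: gridpt_def)

lemma gridpt_le_iff: "gridpt s k m \<le> gridpt s k n \<longleftrightarrow> m \<le> n"
  by (simp add: gridpt_def)

lemma gridpt_diff: "gridpt s k n - gridpt s k m = 2 powi (-k) * of_int (n - m)"
  by (simp add: gridpt_def algebra_simps)

lemma shifted_dyadic_cell: "shifted_dyadic s = range (\<lambda>(k, m). cell s k m)"
proof -
  have "shifted_dyadic s = {cell s k m | k m. True}"
    unfolding shifted_dyadic_def cell_def gridpt_def Ints_def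
    by (auto simp: algebra_simps)
  thus ?thesis by auto
qed

lemma center_ivl: "\<alpha> < \<beta> \<Longrightarrow> center {\<alpha>..<\<beta>} = (\<alpha> + \<beta>) / 2"
  by (simp add: center_def)

lemma cell_ivl: "cell s k m = {gridpt s k m ..< gridpt s k m + 2 powi (-k)}"
proof -
  have "gridpt s k (m + 1) = gridpt s k m + 2 powi (-k)" using gridpt_diff[of s k "m + 1" m] by simp
  thus ?thesis by (simp only: cell_def)
qed

lemma len_cell: "len (cell s k m) = 2 powi (-k)"
  by (simp add: cell_ivl)

lemma center_cell: "center (cell s k m) = gridpt s k m + 2 powi (-k) / 2"
  by (subst cell_ivl) (simp add: center_ivl)

lemma dyadic_grids_shift:
  assumes "G \<in> dyadic_grids"
  obtains s where "G = shifted_dyadic s" "3 * s \<in> \<int>"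
proof -
  have "dyadic_grids = {shifted_dyadic 0, shifted_dyadic (1/3), shifted_dyadic (2/3)}"
    by (simp add: dyadic_grids_def shifted_dyadic_0)
  with assms have "G = shifted_dyadic 0 \<or> G = shifted_dyadic (1/3) \<or> G = shifted_dyadic (2/3)" by blast
  thus ?thesis using that[of 0] that[of "1/3"] that[of "2/3"] by auto
qed

text \<open>Passing to the next scale doubles the shift and flips its sign: with
  \<open>\<epsilon> = (-1) powi k\<close>,
  \<open>2 * \<epsilon> * s = 3 * \<epsilon> * s - \<epsilon> * s\<close>, and the integer
  \<open>3 * \<epsilon> * s\<close> is absorbed into the index. So every endpoint of a grid is an
  endpoint at all finer scales, which is what makes the shifted grids nested.\<close>

lemma gridpt_refine:
  assumes "3 * s \<in> \<int>"
  shows "\<exists>m'. gridpt s k m = gridpt s (k + int n) m'"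
proof (induction n)
  case (Suc n)
  then obtain i where i: "gridpt s k m = gridpt s (k + int n) i" by blast
  let ?j = "k + int n"
  obtain t where t: "3 * s = of_int t" using assms by (auto simp: Ints_def)
  have o: "(-1::real) powi ?j \<in> {1, -1}" by (auto simp: power_int_def minus_one_power_iff)
  define u :: int where "u = (if (-1::real) powi ?j = 1 then t else - t)"
  have u: "of_int u = 3 * s * (-1) powi ?j" using o t by (auto simp: u_def)
  have "gridpt s ?j i = gridpt s (?j + 1) (2 * i + u)"
    unfolding gridpt_def using u
    by (simp add: power_int_add power_int_diff power_int_minus field_simps)
  thus ?case using i by (auto simp: algebra_simps)
qed auto

lemma cell_nested:
  assumes s: "3 * s \<in> \<int>" and j: "j \<le> k" and ne: "cell s k m \<inter> cell s j i \<noteq> {}"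
  shows "cell s k m \<subseteq> cell s j i"
proof -
  define n where "n = nat (k - j)"
  have k: "k = j + int n" using j by (simp add: n_def)
  obtain a b where a: "gridpt s j i = gridpt s k a" and b: "gridpt s j (i + 1) = gridpt s k b"
    using gridpt_refine[OF s, of j _ n] unfolding k by metis
  obtain x where x: "gridpt s k m \<le> x" "x < gridpt s k (m + 1)" "gridpt s k a \<le> x" "x < gridpt s k b"
    using ne unfolding cell_def a b by fastforce
  have "gridpt s k a < gridpt s k (m + 1)" "gridpt s k m < gridpt s k b" using x by linarith+
  hence "a \<le> m" "m + 1 \<le> b" unfolding gridpt_less_iff by linarith+
  thus ?thesis unfolding cell_def a b using gridpt_le_iff[of s k a m] gridpt_le_iff[of s k "m + 1" b] by auto
qed

lemma grid_nested:
  assumes "3 * s \<in> \<int>" "I \<in> shifted_dyadic s" "J \<in> shifted_dyadic s" "len I \<le> len J" "I \<inter> J \<noteq> {}"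
  shows "I \<subseteq> J"
proof -
  obtain k m j i where "I = cell s k m" "J = cell s j i" using assms by (auto simp: shifted_dyadic_cell)
  thus ?thesis using assms cell_nested[OF assms(1), of j k m i] by (simp add: len_cell two_powi_le_iff)
qed

lemma grid_ivl:
  assumes "I \<in> shifted_dyadic s"
  obtains \<alpha> k where "I = {\<alpha>..<\<alpha> + 2 powi k}" "len I = 2 powi k" "center I = \<alpha> + 2 powi k / 2"
proof -
  obtain k m where k: "I = cell s k m" using assms by (auto simp: shifted_dyadic_cell)
  show ?thesis
    by (rule that[of "gridpt s k m" "-k"]) (simp_all only: k len_cell center_cell cell_ivl[symmetric])
qed

lemma gridpt_le_real_iff: "gridpt s k j \<le> x \<longleftrightarrow> real_of_int j \<le> x * 2 powi k - (-1) powi k * s"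
proof -
  have "gridpt s k j = (of_int j + (-1) powi k * s) / 2 powi k"
    by (simp add: gridpt_def power_int_minus divide_inverse mult.commute)
  thus ?thesis by (simp only:) (auto simp: divide_le_eq)
qed

lemma cell_containing: "\<exists>i. x \<in> cell s k i"
proof -
  define i where "i = \<lfloor>x * 2 powi k - (-1) powi k * s\<rfloor>"
  have "gridpt s k i \<le> x" "\<not> gridpt s k (i + 1) \<le> x"
    unfolding gridpt_le_real_iff i_def by linarith+
  thus ?thesis unfolding cell_def by (intro exI[of _ i]) auto
qed

lemma grid_parent:
  assumes s: "3 * s \<in> \<int>" and I: "I \<in> shifted_dyadic s"
  obtains J where "J \<in> shifted_dyadic s" "I \<subseteq> J" "len J = 2 * len I"
proof -
  obtain k m where k: "I = cell s k m" using I by (auto simp: shifted_dyadic_cell)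
  define x where "x = gridpt s k m"
  obtain i where "x \<in> cell s (k - 1) i" using cell_containing by blast
  moreover have "x \<in> I" by (simp add: k cell_ivl x_def)
  ultimately have "I \<subseteq> cell s (k - 1) i"
    using cell_nested[OF s, of "k - 1" k m i] k by auto
  thus ?thesis
    by (rule that[rotated]) (auto simp: shifted_dyadic_cell len_cell k power_int_diff power_int_minus power_int_add field_simps)
qed

lemma grid_cover:
  obtains I where "I \<in> shifted_dyadic s" "x \<in> I" "len I = 2 powi k"
proof -
  obtain i where "x \<in> cell s (- k) i" using cell_containing by blast
  thus ?thesis by (rule that[rotated]) (auto simp: shifted_dyadic_cell len_cell)
qed

lemma grid_center_lattice:
  assumes "I \<in> shifted_dyadic s" "J \<in> shifted_dyadic s" "len I = len J"
  shows "(center I - center J) / len I \<in> \<int>"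
proof -
  obtain k m j i where "I = cell s k m" "J = cell s j i" using assms by (auto simp: shifted_dyadic_cell)
  moreover hence "j = k" using assms(3) by (simp add: len_cell two_powi_eq_iff)
  ultimately show ?thesis by (simp add: center_cell len_cell gridpt_diff)
qed

lemma grid_center_inj:
  assumes "I \<in> shifted_dyadic s" "J \<in> shifted_dyadic s" "len I = len J" "center I = center J"
  shows "I = J"
proof -
  obtain k m j i where "I = cell s k m" "J = cell s j i" using assms by (auto simp: shifted_dyadic_cell)
  moreover hence "j = k" using assms(3) by (simp add: len_cell two_powi_eq_iff)
  ultimately show ?thesis using assms(4) by (simp add: center_cell gridpt_def)
qed

lemma power_two_between: "\<exists>k::int. x < 2 powi k \<and> 2 powi k \<le> 2 * x" if "x > 0" for x :: real
proof -
  define k where "k = \<lfloor>log 2 x\<rfloor>"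
  have a: "2 powr (real_of_int k) \<le> x" "x < 2 powr (real_of_int (k + 1))"
    using that unfolding k_def by (auto simp: powr_le_iff less_powr_iff floor_le_iff) 
  show ?thesis
    by (rule exI[of _ "k + 1"]) (use a in \<open>simp_all add: powr_real_of_int' power_int_add powr_add\<close>)
qed

lemma finite_grid_bounded:
  assumes "\<delta> > 0"
  shows "finite {X \<in> shifted_dyadic s. X \<subseteq> {-R..R} \<and> \<delta> \<le> len X}"
proof -
  obtain k1 where k1: "(1 / \<delta>) < 2 powi k1" using power_two_between[of "1 / \<delta>"] assms by auto
  \<comment> \<open>If a cell lies in \<open>{-R..R}\<close>, so do its left endpoint and its
    midpoint; hence its length is at most \<open>4 * \<bar>R\<bar>\<close>.\<close>
  obtain k0 where k0: "(4 * \<bar>R\<bar> + 1) < 2 powi k0" using power_two_between[of "4 * \<bar>R\<bar> + 1"] by fastforce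
  define m0 where "m0 = \<lceil>\<bar>R\<bar> / \<delta> + \<bar>s\<bar>\<rceil> + 1"
  have "{X \<in> shifted_dyadic s. X \<subseteq> {-R..R} \<and> \<delta> \<le> len X} \<subseteq> (\<lambda>(k, m). cell s k m) ` ({- k0..k1} \<times> {- m0..m0})"
  proof
    fix X assume "X \<in> {X \<in> shifted_dyadic s. X \<subseteq> {-R..R} \<and> \<delta> \<le> len X}"
    then obtain k m where X: "X = cell s k m" and sub: "cell s k m \<subseteq> {-R..R}" and d: "\<delta> \<le> 2 powi (-k)"
      by (auto simp: shifted_dyadic_cell len_cell)
    let ?p = "gridpt s k m" and ?l = "(2::real) powi (-k)"
    have p: "?p \<in> {-R..R}" and mid: "?p + ?l / 2 \<in> {-R..R}" 
    proof -
      have "?p \<in> cell s k m" "?p + ?l / 2 \<in> cell s k m" by (auto simp: cell_ivl)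
      thus "?p \<in> {-R..R}" "?p + ?l / 2 \<in> {-R..R}" using sub by blast+
    qed
    hence "?l < 2 powi k0" using k0 by auto
    hence 1: "- k0 \<le> k" using two_powi_le_iff[of k0 "- k"] by linarith
    have "2 powi k \<le> 1 / \<delta>" using d assms by (simp add: power_int_minus field_simps)
    hence 2: "k \<le> k1" using k1 two_powi_le_iff[of k1 k] by linarith
    have "\<bar>(-1::real) powi k * s\<bar> = \<bar>s\<bar>" by (simp add: abs_mult power_int_abs)
    moreover have "\<bar>of_int m + (-1) powi k * s\<bar> \<le> \<bar>R\<bar> / \<delta>"
    proof -
      have "\<bar>of_int m + (-1) powi k * s\<bar> * \<delta> \<le> \<bar>of_int m + (-1) powi k * s\<bar> * ?l"
        using d by (rule mult_left_mono) simp
      also have "\<dots> = \<bar>?p\<bar>" by (simp add: gridpt_def abs_mult)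
      also have "\<dots> \<le> \<bar>R\<bar>" using p by auto
      finally show ?thesis using assms by (simp add: field_simps)
    qed
    ultimately have "\<bar>real_of_int m\<bar> \<le> \<bar>R\<bar> / \<delta> + \<bar>s\<bar>" by linarith
    hence "\<bar>real_of_int m\<bar> \<le> of_int m0" unfolding m0_def by linarith
    hence "- m0 \<le> m \<and> m \<le> m0" by linarith
    thus "X \<in> (\<lambda>(k, m). cell s k m) ` ({- k0..k1} \<times> {- m0..m0})" using 1 2 X by force
  qed
  thus ?thesis by (rule finite_subset) simp
qed

section \<open>Inverse-square sums over the intervals of a grid\<close>

lemma sum_inverse_squares_le: "(\<Sum>j=1..n. 1 / (real j)\<^sup>2) \<le> 2"
proof -
  have "(\<Sum>j=1..n. 1 / (real j)\<^sup>2) \<le> 2 - 1 / real n" if "n \<ge> 1"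
    using that
  proof (induction n rule: dec_induct)
    case (step n)
    have "1 / (real (Suc n))\<^sup>2 \<le> 1 / (real n * real (Suc n))"
      using step by (intro divide_left_mono) (auto simp: power2_eq_square)
    also have "\<dots> = 1 / real n - 1 / real (Suc n)" using step by (simp add: field_simps)
    finally show ?case using step by simp
  qed auto
  thus ?thesis by (cases "n = 0") (auto intro: order_trans)
qed

lemma finite_sum_inverse_squares_le:
  assumes "finite A"
  shows "(\<Sum>j\<in>A. 1 / (1 + real j)\<^sup>2) \<le> 2"
proof -
  obtain n where n: "A \<subseteq> {..<n}" using assms finite_nat_bounded by blast
  have "(\<Sum>j\<in>A. 1 / (1 + real j)\<^sup>2) \<le> (\<Sum>j<n. 1 / (1 + real j)\<^sup>2)"
    by (rule sum_mono2) (use n in auto)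
  also have "\<dots> = (\<Sum>j=1..n. 1 / (real j)\<^sup>2)"
    by (rule sum.reindex_bij_witness[of _ "\<lambda>j. j - 1" Suc]) auto
  finally show ?thesis using sum_inverse_squares_le[of n] by linarith
qed

text \<open>Split at the floor of \<open>t\<close>: on either side the distances dominate 0, 1, 2,
  and so on, and each half contributes at most 2.\<close>

lemma integer_sum_inverse_squares_le:
  fixes t :: real
  assumes "finite A"
  shows "(\<Sum>m\<in>A. 1 / (1 + \<bar>t - of_int m\<bar>)\<^sup>2) \<le> 4"
proof -
  define m0 where "m0 = \<lfloor>t\<rfloor>"
  have m0: "of_int m0 \<le> t" "t < of_int m0 + 1" unfolding m0_def by linarith+
  have 1: "(\<Sum>m\<in>{m\<in>A. m \<le> m0}. 1 / (1 + \<bar>t - of_int m\<bar>)\<^sup>2) \<le> 2"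
  proof -
    have "(\<Sum>m\<in>{m\<in>A. m \<le> m0}. 1 / (1 + \<bar>t - of_int m\<bar>)\<^sup>2) \<le> (\<Sum>m\<in>{m\<in>A. m \<le> m0}. 1 / (1 + real (nat (m0 - m)))\<^sup>2)"
      using m0 by (intro sum_mono divide_left_mono power_mono) auto
    also have "\<dots> = (\<Sum>j\<in>(\<lambda>m. nat (m0 - m)) ` {m\<in>A. m \<le> m0}. 1 / (1 + real j)\<^sup>2)"
      by (subst sum.reindex) (auto simp: inj_on_def)
    also have "\<dots> \<le> 2" using assms by (intro finite_sum_inverse_squares_le) auto
    finally show ?thesis .
  qed
  have 2: "(\<Sum>m\<in>{m\<in>A. \<not> m \<le> m0}. 1 / (1 + \<bar>t - of_int m\<bar>)\<^sup>2) \<le> 2"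
  proof -
    have "(\<Sum>m\<in>{m\<in>A. \<not> m \<le> m0}. 1 / (1 + \<bar>t - of_int m\<bar>)\<^sup>2) \<le> (\<Sum>m\<in>{m\<in>A. \<not> m \<le> m0}. 1 / (1 + real (nat (m - m0 - 1)))\<^sup>2)"
      using m0 by (intro sum_mono divide_left_mono power_mono) auto
    also have "\<dots> = (\<Sum>j\<in>(\<lambda>m. nat (m - m0 - 1)) ` {m\<in>A. \<not> m \<le> m0}. 1 / (1 + real j)\<^sup>2)"
      by (subst sum.reindex) (auto simp: inj_on_def)
    also have "\<dots> \<le> 2" using assms by (intro finite_sum_inverse_squares_le) auto
    finally show ?thesis .
  qed
  have "(\<Sum>m\<in>A. 1 / (1 + \<bar>t - of_int m\<bar>)\<^sup>2) =
     (\<Sum>m\<in>{m\<in>A. m \<le> m0}. 1 / (1 + \<bar>t - of_int m\<bar>)\<^sup>2) + (\<Sum>m\<in>{m\<in>A. \<not> m \<le> m0}. 1 / (1 + \<bar>t - of_int m\<bar>)\<^sup>2)"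
    using assms by (subst sum.union_disjoint[symmetric]) (auto intro!: sum.cong)
  thus ?thesis using 1 2 by linarith
qed

text \<open>Centres of grid intervals of one length lie in an arithmetic progression whose step is
  that length, so in units of the length the weights become distances from one point to distinct
  integers.\<close>

lemma grid_scale_sum_le:
  assumes F: "finite F" "F \<subseteq> shifted_dyadic s" and l: "\<And>I. I \<in> F \<Longrightarrow> len I = l"
  shows "(\<Sum>I\<in>F. 1 / (wt (center I) (len I) e)\<^sup>2) \<le> 4"
proof (cases "F = {}")
  case False
  then obtain J where J: "J \<in> F" by blast
  have l0: "l > 0" using J l F by (metis grid_ivl subsetD zero_less_numeral zero_less_power_int)
  define h where "h I = \<lfloor>(center I - center J) / l\<rfloor>" for I
  have h: "center I = center J + l * of_int (h I)" if "I \<in> F" for I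
  proof -
    have "(center I - center J) / l \<in> \<int>" using grid_center_lattice[of I s J] that J F l by auto
    hence "of_int (h I) = (center I - center J) / l" unfolding h_def by simp
    thus ?thesis using l0 by (simp add: field_simps)
  qed
  have inj: "inj_on h F"
    using grid_center_inj[of _ s] h F l by (metis (no_types, lifting) inj_onI subsetD)
  have "wt (center I) (len I) e = 1 + \<bar>(e - center J) / l - of_int (h I)\<bar>" if "I \<in> F" for I
  proof -
    have "(e - center J) / l - of_int (h I) = (e - center I) / l"
      using h[OF that] l0 by (simp add: field_simps)
    thus ?thesis using l[OF that] l0 by (simp add: wt_def)
  qed
  hence "(\<Sum>I\<in>F. 1 / (wt (center I) (len I) e)\<^sup>2) = (\<Sum>m\<in>h ` F. 1 / (1 + \<bar>(e - center J) / l - of_int m\<bar>)\<^sup>2)"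
    by (subst sum.reindex[OF inj]) simp
  thus ?thesis using integer_sum_inverse_squares_le[of "h ` F"] F by simp
qed auto

lemma sum_half_powers_le: "finite A \<Longrightarrow> (\<Sum>n\<in>A. (1/2::real) ^ n) \<le> 2"
  using sum_le_suminf[of "\<lambda>n. (1/2::real) ^ n" A] suminf_geometric[of "1/2::real"]
  by (simp add: summable_geometric)

lemma two_powi_ratio:
  "(2::real) powi i \<le> 2 powi j \<Longrightarrow> \<exists>n. (2::real) powi j = 2 powi i * 2 ^ n"
proof -
  assume "(2::real) powi i \<le> 2 powi j"
  hence "j = i + int (nat (j - i))" by (simp add: two_powi_le_iff)
  hence "(2::real) powi j = 2 powi i * 2 ^ nat (j - i)" by (metis power_int_add power_int_of_nat zero_neq_numeral)
  thus ?thesis by blast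
qed

text \<open>Scale by scale: the intervals of length \<open>2 powi k / 2 ^ j\<close> contribute at
  most 4 times that length, and the geometric series adds a factor 2. It is applied with
  \<open>e\<close> an endpoint of a stopping interval, to tile intervals not longer than it.\<close>

lemma grid_sum_small_le:
  assumes F: "finite F" "F \<subseteq> shifted_dyadic s" and le: "\<And>I. I \<in> F \<Longrightarrow> len I \<le> 2 powi k"
  shows "(\<Sum>I\<in>F. len I * (1 / (wt (center I) (len I) e)\<^sup>2)) \<le> 8 * 2 powi k"
proof -
  let ?L = "(2::real) powi k"
  define n where "n I = (SOME n. len I * 2 ^ n = ?L)" for I
  have n: "len I * 2 ^ n I = ?L" if IF: "I \<in> F" for I
  proof -
    obtain i where i: "len I = 2 powi i" using F(2) IF grid_ivl[of I s] by blast
    have "\<exists>n. len I * 2 ^ n = ?L" using two_powi_ratio[of i k] le[OF IF] unfolding i by metis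
    thus ?thesis unfolding n_def by (rule someI_ex)
  qed
  have n': "len I = ?L * (1 / 2) ^ n I" if "I \<in> F" for I using n[OF that] by (simp add: power_one_over field_simps)
  have "(\<Sum>I\<in>F. len I * (1 / (wt (center I) (len I) e)\<^sup>2)) =
     (\<Sum>j\<in>n ` F. \<Sum>I\<in>{I\<in>F. n I = j}. len I * (1 / (wt (center I) (len I) e)\<^sup>2))"
    by (rule sum.image_gen[OF F(1)])
  also have "\<dots> \<le> (\<Sum>j\<in>n ` F. (?L * (1 / 2) ^ j) * 4)"
  proof (rule sum_mono)
    fix j
    have "(\<Sum>I\<in>{I\<in>F. n I = j}. len I * (1 / (wt (center I) (len I) e)\<^sup>2)) =
      (\<Sum>I\<in>{I\<in>F. n I = j}. (?L * (1 / 2) ^ j) * (1 / (wt (center I) (len I) e)\<^sup>2))"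
      using n' by (intro sum.cong refl) auto
    also have "\<dots> = (?L * (1 / 2) ^ j) * (\<Sum>I\<in>{I\<in>F. n I = j}. (1 / (wt (center I) (len I) e)\<^sup>2))"
      by (rule sum_distrib_left[symmetric])
    also have "\<dots> \<le> (?L * (1 / 2) ^ j) * 4"
      by (intro mult_left_mono grid_scale_sum_le[where s=s and l="?L * (1 / 2) ^ j"]) (use F n' in auto)
    finally show "(\<Sum>I\<in>{I\<in>F. n I = j}. len I * (1 / (wt (center I) (len I) e)\<^sup>2)) \<le> (?L * (1 / 2) ^ j) * 4" .
  qed
  also have "\<dots> = ?L * 4 * (\<Sum>j\<in>n ` F. (1 / 2) ^ j)" by (simp add: sum_distrib_left mult_ac)
  also have "\<dots> \<le> ?L * 4 * 2" using F by (intro mult_left_mono sum_half_powers_le) auto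
  finally show ?thesis by simp
qed

text \<open>The companion for long intervals: here the summable quantity is
  \<open>2 powi k / len I\<close>, the gain that smooth packets over long intervals have against
  mean-zero functions on short ones.\<close>

lemma grid_sum_large_le:
  assumes F: "finite F" "F \<subseteq> shifted_dyadic s" and le: "\<And>I. I \<in> F \<Longrightarrow> 2 powi k \<le> len I"
  shows "(\<Sum>I\<in>F. (2 powi k / len I) * (1 / (wt (center I) (len I) e)\<^sup>2)) \<le> 8"
proof -
  let ?L = "(2::real) powi k"
  define n where "n I = (SOME n. len I = ?L * 2 ^ n)" for I
  have n: "len I = ?L * 2 ^ n I" if IF: "I \<in> F" for I
  proof -
    obtain i where i: "len I = 2 powi i" using F(2) IF grid_ivl[of I s] by blast
    have "\<exists>n. len I = ?L * 2 ^ n" using two_powi_ratio[of k i] le[OF IF] unfolding i by metis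
    thus ?thesis unfolding n_def by (rule someI_ex)
  qed
  have n': "?L / len I = (1 / 2) ^ n I" if "I \<in> F" for I using n[OF that] by (simp add: power_one_over)
  have "(\<Sum>I\<in>F. (?L / len I) * (1 / (wt (center I) (len I) e)\<^sup>2)) =
     (\<Sum>j\<in>n ` F. \<Sum>I\<in>{I\<in>F. n I = j}. (?L / len I) * (1 / (wt (center I) (len I) e)\<^sup>2))"
    by (rule sum.image_gen[OF F(1)])
  also have "\<dots> \<le> (\<Sum>j\<in>n ` F. (1 / 2) ^ j * 4)"
  proof (rule sum_mono)
    fix j
    have "(\<Sum>I\<in>{I\<in>F. n I = j}. (?L / len I) * (1 / (wt (center I) (len I) e)\<^sup>2)) =
      (\<Sum>I\<in>{I\<in>F. n I = j}. (1 / 2) ^ j * (1 / (wt (center I) (len I) e)\<^sup>2))"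
      using n' by (intro sum.cong refl) auto
    also have "\<dots> = (1 / 2) ^ j * (\<Sum>I\<in>{I\<in>F. n I = j}. (1 / (wt (center I) (len I) e)\<^sup>2))"
      by (rule sum_distrib_left[symmetric])
    also have "\<dots> \<le> (1 / 2) ^ j * 4"
      by (intro mult_left_mono grid_scale_sum_le[where s=s and l="?L * 2 ^ j"]) (use F n in auto)
    finally show "(\<Sum>I\<in>{I\<in>F. n I = j}. (?L / len I) * (1 / (wt (center I) (len I) e)\<^sup>2)) \<le> (1 / 2) ^ j * 4" .
  qed
  also have "\<dots> = 4 * (\<Sum>j\<in>n ` F. (1 / 2) ^ j)" by (simp add: sum_distrib_left mult_ac)
  also have "\<dots> \<le> 4 * 2" using F by (intro mult_left_mono sum_half_powers_le) auto
  finally show ?thesis by simp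
qed

section \<open>Dilated averages and stopping intervals\<close>

lemma sum_disjoint_integral_le:
  fixes h :: "real \<Rightarrow> real"
  assumes C: "finite C" "disjoint_family_on B C" "\<And>j. j \<in> C \<Longrightarrow> B j \<in> sets borel" "\<And>j. j \<in> C \<Longrightarrow> B j \<subseteq> U"
    and U: "U \<in> sets borel" and h: "integrable lborel h" "\<And>x. h x \<ge> 0"
  shows "(\<Sum>j\<in>C. (LINT x|lborel. indicator (B j) x * h x)) \<le> (LINT x|lborel. indicator U x * h x)"
proof -
  have i: "integrable lborel (\<lambda>x. indicator A x * h x)" if "A \<in> sets borel" for A
    using integrable_real_mult_indicator[of A lborel h] that h by (simp add: mult.commute)
  have "(\<Sum>j\<in>C. (LINT x|lborel. indicator (B j) x * h x)) = (LINT x|lborel. (\<Sum>j\<in>C. indicator (B j) x * h x))"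
    by (rule Bochner_Integration.integral_sum[symmetric]) (use i C in auto)
  also have "\<dots> \<le> (LINT x|lborel. indicator U x * h x)"
  proof (rule integral_mono)
    show "integrable lborel (\<lambda>x. \<Sum>j\<in>C. indicator (B j) x * h x)"
      using i C by (intro Bochner_Integration.integrable_sum) auto
    show "integrable lborel (\<lambda>x. indicator U x * h x)" by (rule i[OF U])
    fix x
    have "(\<Sum>j\<in>C. indicator (B j) x * h x) = indicator (\<Union>j\<in>C. B j) x * h x"
      by (simp add: indicator_UN_disjoint[OF C(1,2)] sum_distrib_right)
    also have "\<dots> \<le> indicator U x * h x"
      using C(4) h(2)[of x] by (auto simp: indicator_def)
    finally show "(\<Sum>j\<in>C. indicator (B j) x * h x) \<le> indicator U x * h x" .
  qed
  finally show ?thesis .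
qed

definition ball_int :: "(real \<Rightarrow> real) \<Rightarrow> real \<Rightarrow> real \<Rightarrow> real"
  where "ball_int h c \<rho> = (LINT x|lborel. indicator {c - \<rho>..c + \<rho>} x * h x)"

text \<open>The factor \<open>r ^ 3\<close> is large enough for the averages of \<open>f\<close> and \<open>g\<close>, which may be extremal
  at different dilates of \<open>I\<close>, to be compared with averages over one common dilate.\<close>

definition Phi :: "(real \<Rightarrow> real) \<Rightarrow> real set \<Rightarrow> real"
  where "Phi h I = (SUP r. ball_int h (center I) (real (Suc r) * len I) / (real (Suc r) ^ 3 * len I))"

definition ivl :: "real set \<Rightarrow> bool"
  where "ivl J \<longleftrightarrow> (\<exists>\<alpha> \<beta>. \<alpha> < \<beta> \<and> J = {\<alpha>..<\<beta>})"

lemma ivlD: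
  assumes "ivl J"
  shows "len J > 0" "center J \<in> J" "x \<in> J \<Longrightarrow> \<bar>x - center J\<bar> \<le> len J / 2" "J \<in> sets borel"
    "J \<in> fmeasurable lborel" "J \<noteq> {}" "J = {center J - len J / 2..<center J + len J / 2}"
proof -
  obtain \<alpha> \<beta> where J: "\<alpha> < \<beta>" "J = {\<alpha>..<\<beta>}" using assms by (auto simp: ivl_def)
  have c: "center J = (\<alpha> + \<beta>) / 2" "len J = \<beta> - \<alpha>" using J by (auto simp: center_ivl)
  show "len J > 0" using c J by simp
  show "center J \<in> J" unfolding c(1) using J by auto
  show "x \<in> J \<Longrightarrow> \<bar>x - center J\<bar> \<le> len J / 2" unfolding c using J by (auto simp: abs_le_iff field_simps)
  show "J \<in> sets borel" using J by simp
  show "J \<in> fmeasurable lborel" using J by (intro fmeasurableI) auto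
  show "J \<noteq> {}" using J by auto
  show "J = {center J - len J / 2..<center J + len J / 2}" unfolding c by (auto simp: J(2) field_simps)
qed

lemma grid_is_ivl: "I \<in> shifted_dyadic s \<Longrightarrow> ivl I"
  by (metis grid_ivl ivl_def less_add_same_cancel1 zero_less_numeral zero_less_power_int)

context
  fixes h :: "real \<Rightarrow> real"
  assumes hb: "bdd_supp h" and h0: "\<And>x. h x \<ge> 0"
begin

lemma nonneg_bdd_supp_indicator_integrable: "A \<in> sets borel \<Longrightarrow> integrable lborel (\<lambda>x. indicator A x * h x)"
  by (intro bdd_supp_integrable bdd_supp_indicator hb)

lemma ball_int_nonneg: "ball_int h c \<rho> \<ge> 0"
  unfolding ball_int_def by (intro integral_nonneg_AE AE_I2) (simp add: h0)

lemma ball_int_mono: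
  assumes "{c - \<rho>..c + \<rho>} \<subseteq> {c' - \<rho>'..c' + \<rho>'}"
  shows "ball_int h c \<rho> \<le> ball_int h c' \<rho>'"
  unfolding ball_int_def
  by (intro integral_mono nonneg_bdd_supp_indicator_integrable) (use assms h0 in \<open>auto simp: indicator_def\<close>)

lemma indicator_integral_le_ball_int:
  assumes "A \<subseteq> {c - \<rho>..c + \<rho>}" "A \<in> sets borel"
  shows "(LINT x|lborel. indicator A x * h x) \<le> ball_int h c \<rho>"
  unfolding ball_int_def
  by (intro integral_mono nonneg_bdd_supp_indicator_integrable) (use assms h0 in \<open>auto simp: indicator_def\<close>)

lemma Phi_bdd: "len I > 0 \<Longrightarrow> bdd_above (range (\<lambda>r. ball_int h (center I) (real (Suc r) * len I) / (real (Suc r) ^ 3 * len I)))"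
proof (rule bdd_aboveI2)
  fix r assume l: "len I > 0"
  have "ball_int h (center I) (real (Suc r) * len I) \<le> (LINT x|lborel. h x)"
    unfolding ball_int_def
    by (intro integral_mono nonneg_bdd_supp_indicator_integrable bdd_supp_integrable hb) (auto simp: indicator_def h0)
  moreover have "1 * len I \<le> real (Suc r) ^ 3 * len I"
    using l by (intro mult_right_mono one_le_power) auto
  ultimately show "ball_int h (center I) (real (Suc r) * len I) / (real (Suc r) ^ 3 * len I) \<le> (LINT x|lborel. h x) / (1 * len I)"
    using l ball_int_nonneg by (intro frac_le order_trans[OF ball_int_nonneg]) auto
qed

lemma Phi_upper:
  assumes "len I > 0" "r \<ge> 1"
  shows "ball_int h (center I) (real r * len I) \<le> real r ^ 3 * len I * Phi h I"
proof -
  obtain q where q: "r = Suc q" using assms(2) by (cases r) auto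
  have "ball_int h (center I) (real r * len I) / (real r ^ 3 * len I) \<le> Phi h I"
    unfolding Phi_def q by (rule cSUP_upper[OF _ Phi_bdd[OF assms(1)]]) simp
  thus ?thesis using assms by (simp add: divide_le_eq mult_ac)
qed

lemma Phi_nonneg: "len I > 0 \<Longrightarrow> Phi h I \<ge> 0"
proof -
  assume l: "len I > 0"
  have "0 \<le> ball_int h (center I) (real 1 * len I)" by (rule ball_int_nonneg)
  also have "\<dots> \<le> real 1 ^ 3 * len I * Phi h I" by (rule Phi_upper[OF l]) simp
  finally show ?thesis using l by (simp add: zero_le_mult_iff)
qed

lemma Phi_witness:
  assumes "len I > 0" "y < Phi h I"
  shows "\<exists>r\<ge>1. y * (real r ^ 3 * len I) < ball_int h (center I) (real r * len I)"
proof -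
  obtain q where "y < ball_int h (center I) (real (Suc q) * len I) / (real (Suc q) ^ 3 * len I)"
    using less_cSUP_iff[OF _ Phi_bdd[OF assms(1)], of y] assms(2) unfolding Phi_def by auto
  moreover have "0 < real (Suc q) ^ 3 * len I" using assms by simp
  ultimately show ?thesis by (intro exI[of _ "Suc q"]) (simp add: less_divide_eq del: of_nat_Suc)
qed

lemma weighted_integrable: "len I > 0 \<Longrightarrow> integrable lborel (\<lambda>x. h x * (1 / wt (center I) (len I) x ^ n))"
proof -
  assume l: "len I > 0"
  have "norm (1 / wt (center I) (len I) x ^ n) \<le> 1" for x
    using wt_ge_1[OF l, of "center I" x] by (simp add: divide_le_eq)
  thus ?thesis by (intro bdd_supp_integrable bdd_supp_mult_bounded[OF hb]) measurable
qed

text \<open>If \<open>r\<close> is \<open>\<bar>x - c\<bar> / l\<close> rounded up (at least 1), the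
  weight at \<open>x\<close> is at most \<open>1 / r ^ 5\<close> and \<open>x\<close> lies in the
  dilate of index \<open>r\<close>. In the sum over \<open>r\<close> the growth \<open>r ^ 3\<close>
  allowed by \<open>Phi\<close> leaves the series of \<open>1 / r\<^sup>2\<close>; hence the order
  5.\<close>

lemma Phi_weighted:
  assumes l: "len I > 0" and n: "n \<ge> 5"
  shows "(LINT x|lborel. h x * (1 / wt (center I) (len I) x ^ n)) \<le> 2 * len I * Phi h I"
proof -
  let ?c = "center I" and ?l = "len I"
  obtain R where R: "R \<ge> 0" "\<And>x. norm (h x) \<le> R" "\<And>x. R < \<bar>x\<bar> \<Longrightarrow> h x = 0"
    using hb unfolding bdd_supp_def by blast
  define N where "N = nat \<lceil>(R + \<bar>?c\<bar>) / ?l\<rceil> + 1"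
  let ?B = "\<lambda>r::nat. {?c - real r * ?l..?c + real r * ?l}"
  have pt: "h x * (1 / wt ?c ?l x ^ n) \<le> (\<Sum>r=1..N. (1 / real r ^ 5) * (indicator (?B r) x * h x))" for x
  proof (cases "R < \<bar>x\<bar>")
    case False
    define y where "y = \<bar>x - ?c\<bar> / ?l"
    have y0: "y \<ge> 0" using l by (simp add: y_def)
    define r where "r = max 1 (nat \<lceil>y\<rceil>)"
    have yr: "y \<le> real r" unfolding r_def by linarith
    have rw: "real r \<le> wt ?c ?l x" unfolding r_def wt_def y_def[symmetric] using y0 by linarith
    have "\<bar>x - ?c\<bar> \<le> R + \<bar>?c\<bar>" using False by linarith
    hence "y \<le> (R + \<bar>?c\<bar>) / ?l" unfolding y_def using l by (intro divide_right_mono) auto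
    hence "nat \<lceil>y\<rceil> \<le> nat \<lceil>(R + \<bar>?c\<bar>) / ?l\<rceil>" by (intro nat_mono ceiling_mono)
    hence rN: "r \<in> {1..N}" unfolding r_def N_def by auto
    have "\<bar>x - ?c\<bar> \<le> real r * ?l" using yr l unfolding y_def by (simp add: divide_le_eq)
    hence xB: "x \<in> ?B r" by (auto simp: abs_le_iff)
    have "1 / wt ?c ?l x ^ n \<le> 1 / wt ?c ?l x ^ 5" by (rule wt_power_antimono[OF l n])
    also have "\<dots> \<le> 1 / real r ^ 5"
      using rw rN by (intro divide_left_mono power_mono mult_pos_pos zero_less_power wt_pos[OF l]) auto
    finally have "h x * (1 / wt ?c ?l x ^ n) \<le> h x * (1 / real r ^ 5)"
      using h0 by (intro mult_left_mono) auto
    also have "\<dots> = (1 / real r ^ 5) * (indicator (?B r) x * h x)" using xB by simp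
    also have "\<dots> \<le> (\<Sum>r=1..N. (1 / real r ^ 5) * (indicator (?B r) x * h x))"
      by (rule member_le_sum[OF rN]) (auto simp: h0)
    finally show ?thesis .
  qed (simp add: R)
  have "(LINT x|lborel. h x * (1 / wt ?c ?l x ^ n)) \<le> (LINT x|lborel. (\<Sum>r=1..N. (1 / real r ^ 5) * (indicator (?B r) x * h x)))"
    by (intro integral_mono weighted_integrable[OF l] Bochner_Integration.integrable_sum integrable_mult_right nonneg_bdd_supp_indicator_integrable pt) auto
  also have "\<dots> = (\<Sum>r=1..N. (1 / real r ^ 5) * ball_int h ?c (real r * ?l))"
    unfolding ball_int_def
    by (subst Bochner_Integration.integral_sum) (auto intro!: integrable_mult_right nonneg_bdd_supp_indicator_integrable)
  also have "\<dots> \<le> (\<Sum>r=1..N. (1 / real r ^ 5) * (real r ^ 3 * ?l * Phi h I))"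
    by (intro sum_mono mult_left_mono Phi_upper[OF l]) auto
  also have "\<dots> = (\<Sum>r=1..N. 1 / (real r)\<^sup>2) * (?l * Phi h I)"
    unfolding sum_distrib_right
  proof (intro sum.cong refl)
    fix r :: nat assume "r \<in> {1..N}"
    hence "real r > 0" by auto
    thus "1 / real r ^ 5 * (real r ^ 3 * ?l * Phi h I) = 1 / (real r)\<^sup>2 * (?l * Phi h I)"
      by (simp add: field_simps eval_nat_numeral)
  qed
  also have "\<dots> \<le> 2 * (?l * Phi h I)"
    using Phi_nonneg[OF l] l by (intro mult_right_mono sum_inverse_squares_le) auto
  finally show ?thesis by simp
qed

text \<open>A Vitali covering argument for the maximal function behind \<open>Phi\<close>. Each
  \<open>J\<close> has a dilate, of radius \<open>\<rho> J\<close>, over which the integral of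
  \<open>h\<close> is large, so disjoint dilates near \<open>Q\<close> have small total radius. The
  constant is 320 = 4 * 10 * 8: the balls enlarged by Vitali have length
  \<open>10 * \<rho> J\<close>, the integral over the ball of radius \<open>2 * len Q\<close> is at
  most \<open>8 * len Q * Phi h Q\<close>, and only a quarter of \<open>len Q\<close> may be used,
  which leaves room for two stopping conditions.\<close>

lemma Phi_packing:
  assumes Q: "ivl Q" and fin: "finite \<J>" and J: "\<And>J. J \<in> \<J> \<Longrightarrow> ivl J \<and> J \<subseteq> Q \<and> 320 * Phi h Q < Phi h J"
    and disj: "disjoint \<J>"
  shows "(\<Sum>J\<in>\<J>. len J) \<le> len Q / 4"
proof -
  let ?L = "len Q" and ?c = "center Q" and ?P = "Phi h Q"
  have L: "?L > 0" using ivlD[OF Q] by simp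
  have P0: "?P \<ge> 0" by (rule Phi_nonneg[OF L])
  have l: "len J > 0" if "J \<in> \<J>" for J using J[OF that] ivlD(1) by blast
  have "\<forall>J\<in>\<J>. \<exists>r\<ge>1. 320 * ?P * (real r ^ 3 * len J) < ball_int h (center J) (real r * len J)"
    using Phi_witness[OF l] J by blast
  then obtain r where r: "\<And>J. J \<in> \<J> \<Longrightarrow> r J \<ge> (1::nat) \<and> 320 * ?P * (real (r J) ^ 3 * len J) < ball_int h (center J) (real (r J) * len J)"
    by metis
  define \<rho> where "\<rho> J = real (r J) * len J" for J
  have lr: "len J \<le> \<rho> J" if "J \<in> \<J>" for J
    using r[OF that] l[OF that] by (simp add: \<rho>_def)
  have cJ: "\<bar>center J - ?c\<bar> \<le> ?L" if "J \<in> \<J>" for J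
    using J[OF that] ivlD(2)[of J] ivlD(3)[OF Q, of "center J"] L by auto
  \<comment> \<open>A ball of radius at least \<open>len Q\<close> would fit into a dilate of
    \<open>Q\<close> itself, by a factor \<open>r'\<close> of at most
    \<open>3 * (\<rho> J / len Q)\<close>; cubing gives 27 < 320, against the choice of
    \<open>r J\<close>.\<close>
  have small: "\<rho> J < ?L" if "J \<in> \<J>" for J
  proof (rule ccontr)
    assume "\<not> \<rho> J < ?L"
    hence big: "1 \<le> \<rho> J / ?L" using L by (simp add: le_divide_eq)
    define r' where "r' = nat \<lceil>\<rho> J / ?L\<rceil> + 1"
    have r'1: "\<rho> J / ?L + 1 \<le> real r'" and r'2: "real r' \<le> 3 * (\<rho> J / ?L)"
      using big unfolding r'_def by linarith+
    have "(\<rho> J / ?L + 1) * ?L \<le> real r' * ?L" using r'1 L by (intro mult_right_mono) auto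
    hence "\<rho> J + ?L \<le> real r' * ?L" using L by (simp add: distrib_right)
    hence "ball_int h (center J) (\<rho> J) \<le> ball_int h ?c (real r' * ?L)"
      using cJ[OF that] by (intro ball_int_mono) (auto simp: abs_le_iff)
    also have "\<dots> \<le> real r' ^ 3 * ?L * ?P" by (rule Phi_upper[OF L]) (simp add: r'_def)
    also have "\<dots> \<le> (3 * (\<rho> J / ?L)) ^ 3 * ?L * ?P"
      using r'2 L P0 by (intro mult_right_mono power_mono) auto
    also have "\<dots> = (27 * ?P) * (real (r J) ^ 3 * len J) * (len J / ?L)\<^sup>2"
      using L by (simp add: \<rho>_def field_simps eval_nat_numeral)
    also have "\<dots> \<le> (27 * ?P) * (real (r J) ^ 3 * len J) * 1"
    proof (intro mult_left_mono)
      have "len J \<le> ?L"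
        using J[OF that] ivlD(5)[OF Q] ivlD(4)[of J] by (intro measure_mono_fmeasurable) auto
      thus "(len J / ?L)\<^sup>2 \<le> 1" using L l[OF that] by (intro power_le_one) auto
    qed (use P0 l[OF that] in auto)
    also have "\<dots> \<le> 320 * ?P * (real (r J) ^ 3 * len J)"
      using P0 l[OF that] by (simp add: mult_right_mono)
    finally show False using r[OF that] by (simp add: \<rho>_def)
  qed
  have Bsub: "{center J - \<rho> J..center J + \<rho> J} \<subseteq> {?c - real 2 * ?L..?c + real 2 * ?L}" if "J \<in> \<J>" for J
    using small[OF that] cJ[OF that] by (auto simp: abs_le_iff)
  have "\<Union>\<J> \<subseteq> (\<Union>J\<in>\<J>. cball (center J) (\<rho> J))"
  proof
    fix x assume "x \<in> \<Union>\<J>"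
    then obtain J0 where J0: "J0 \<in> \<J>" "x \<in> J0" by blast
    have "\<bar>x - center J0\<bar> \<le> \<rho> J0"
      using ivlD(3)[of J0 x] J[OF J0(1)] J0 lr[OF J0(1)] l[OF J0(1)] by auto
    thus "x \<in> (\<Union>J\<in>\<J>. cball (center J) (\<rho> J))" using J0 by (auto simp: dist_real_def abs_minus_commute)
  qed
  note sub\<J> = this
  have "0 < \<rho> J \<and> \<rho> J \<le> ?L" if "J \<in> \<J>" for J
    using small[OF that] lr[OF that] l[OF that] by simp
  note cov = this
  obtain C where C: "countable C" "C \<subseteq> \<J>"
     "pairwise (\<lambda>i j. disjnt (cball (center i) (\<rho> i)) (cball (center j) (\<rho> j))) C"
     "\<Union>\<J> \<subseteq> (\<Union>i\<in>C. cball (center i) (5 * \<rho> i))"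
    by (rule Vitali_covering_lemma_cballs[where a=center and r=\<rho> and B="?L", OF sub\<J> cov])
  have finC: "finite C" using C(2) fin finite_subset by blast
  have "(\<Sum>J\<in>\<J>. len J) = measure lborel (\<Union>\<J>)"
    by (rule measure_Union'[symmetric, OF fin _ disj]) (use J in \<open>simp add: ivlD(5)\<close>)
  also have "\<dots> \<le> measure lborel (\<Union>i\<in>C. cball (center i) (5 * \<rho> i))"
  proof (rule measure_mono_fmeasurable[OF C(4)])
    have "\<Union>\<J> \<in> sets borel" by (rule sets.finite_Union[OF fin]) (use J in \<open>auto simp: ivlD(4)\<close>)
    thus "\<Union>\<J> \<in> sets lborel" by simp
    show "(\<Union>i\<in>C. cball (center i) (5 * \<rho> i)) \<in> fmeasurable lborel"
      by (rule fmeasurable.finite_UN[OF finC]) (auto simp: cball_eq_atLeastAtMost emeasure_lborel_Icc_eq intro!: fmeasurableI)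
  qed
  also have "\<dots> \<le> (\<Sum>i\<in>C. measure lborel (cball (center i) (5 * \<rho> i)))"
    by (rule measure_UNION_le[OF finC]) auto
  also have "\<dots> = (\<Sum>i\<in>C. 10 * \<rho> i)"
  proof (intro sum.cong refl)
    fix J assume "J \<in> C"
    hence "\<rho> J > 0" using C(2) lr l by fastforce
    thus "measure lborel (cball (center J) (5 * \<rho> J)) = 10 * \<rho> J"
      by (simp add: cball_eq_atLeastAtMost)
  qed
  finally have 1: "(\<Sum>J\<in>\<J>. len J) \<le> (\<Sum>i\<in>C. 10 * \<rho> i)" .
  have "(\<Sum>J\<in>C. ball_int h (center J) (\<rho> J)) \<le> ball_int h ?c (real 2 * ?L)"
    unfolding ball_int_def
  proof (rule sum_disjoint_integral_le)
    show "disjoint_family_on (\<lambda>j. {center j - \<rho> j..center j + \<rho> j}) C"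
      using C(3) by (auto simp: disjoint_family_on_def pairwise_def disjnt_def cball_eq_atLeastAtMost)
  qed (use finC Bsub C(2) hb h0 bdd_supp_integrable in auto)
  also have "\<dots> \<le> real 2 ^ 3 * ?L * ?P" by (rule Phi_upper[OF L]) simp
  finally have 2: "(\<Sum>J\<in>C. ball_int h (center J) (\<rho> J)) \<le> 8 * ?L * ?P" by simp
  have 3: "320 * ?P * \<rho> J \<le> ball_int h (center J) (\<rho> J)" if "J \<in> \<J>" for J
  proof -
    have "real (r J) ^ 1 \<le> real (r J) ^ 3" using r[OF that] by (intro power_increasing) auto
    hence "\<rho> J \<le> real (r J) ^ 3 * len J" unfolding \<rho>_def using l[OF that] by (intro mult_right_mono) auto
    hence "320 * ?P * \<rho> J \<le> 320 * ?P * (real (r J) ^ 3 * len J)" using P0 by (intro mult_left_mono) auto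
    thus ?thesis using r[OF that] by (simp add: \<rho>_def)
  qed
  show ?thesis
  proof (cases "\<J> = {}")
    case False
    then obtain J0 where J0: "J0 \<in> \<J>" by blast
    \<comment> \<open>Needed to cancel \<open>?P\<close> below. If it vanished, \<open>h\<close>
      would have integral 0 over the ball of radius \<open>2 * len Q\<close> but a positive one over
      a ball inside it.\<close>
    have "?P > 0"
    proof (rule ccontr)
      assume "\<not> ?P > 0"
      hence "?P = 0" using P0 by simp
      hence "0 < ball_int h (center J0) (\<rho> J0)" using r[OF J0] by (simp add: \<rho>_def)
      also have "\<dots> \<le> ball_int h ?c (real 2 * ?L)" by (rule ball_int_mono[OF Bsub[OF J0]])
      also have "\<dots> \<le> real 2 ^ 3 * ?L * ?P" by (rule Phi_upper[OF L]) simp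
      finally show False using \<open>?P = 0\<close> by simp
    qed
    have "?P * (320 * (\<Sum>J\<in>C. \<rho> J)) = (\<Sum>J\<in>C. 320 * ?P * \<rho> J)"
      unfolding sum_distrib_left by (rule sum.cong) (simp_all only: mult_ac)
    also have "\<dots> \<le> (\<Sum>J\<in>C. ball_int h (center J) (\<rho> J))" using 3 C(2) by (intro sum_mono) auto
    also have "\<dots> \<le> ?P * (8 * ?L)" using 2 by (simp add: mult_ac)
    finally have "320 * (\<Sum>J\<in>C. \<rho> J) \<le> 8 * ?L" using \<open>?P > 0\<close> by (rule mult_left_le_imp_le)
    thus ?thesis using 1 by (simp add: sum_distrib_left[symmetric])
  qed (use L in simp)
qed

end

section \<open>Stopping families: principal intervals and Carleson packing\<close>

lemma finite_family_below_maximal: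
  assumes "finite \<B>" "J \<in> \<B>"
  obtains M where "M \<in> \<B>" "J \<subseteq> M" "\<And>X. X \<in> \<B> \<Longrightarrow> M \<subseteq> X \<Longrightarrow> X = M"
  using finite_has_maximal2[OF assms] by metis

definition laminar :: "'a set set \<Rightarrow> bool"
  where "laminar \<I> \<longleftrightarrow> (\<forall>I\<in>\<I>. \<forall>J\<in>\<I>. I \<inter> J \<noteq> {} \<longrightarrow> I \<subseteq> J \<or> J \<subseteq> I)"

definition maximals :: "'a set set \<Rightarrow> 'a set set"
  where "maximals \<B> = {M \<in> \<B>. \<forall>X\<in>\<B>. M \<subseteq> X \<longrightarrow> X = M}"

lemma maximals_subset: "maximals \<B> \<subseteq> \<B>"
  by (auto simp: maximals_def)

lemma Union_maximals: "finite \<B> \<Longrightarrow> \<Union>(maximals \<B>) = \<Union>\<B>"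
proof
  assume f: "finite \<B>"
  show "\<Union>\<B> \<subseteq> \<Union>(maximals \<B>)"
  proof
    fix x assume "x \<in> \<Union>\<B>"
    then obtain J where J: "J \<in> \<B>" "x \<in> J" by blast
    obtain M where "M \<in> \<B>" "J \<subseteq> M" "\<And>X. X \<in> \<B> \<Longrightarrow> M \<subseteq> X \<Longrightarrow> X = M"
      by (rule finite_family_below_maximal[OF f J(1)]) blast
    thus "x \<in> \<Union>(maximals \<B>)" using J by (auto simp: maximals_def)
  qed
qed (use maximals_subset in blast)

lemma disjoint_maximals: "laminar \<I> \<Longrightarrow> \<B> \<subseteq> \<I> \<Longrightarrow> disjoint (maximals \<B>)"
proof (rule disjointI)
  fix A B assume a: "laminar \<I>" "\<B> \<subseteq> \<I>" "A \<in> maximals \<B>" "B \<in> maximals \<B>" "A \<noteq> B"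
  show "A \<inter> B = {}"
  proof (rule ccontr)
    assume "A \<inter> B \<noteq> {}"
    hence "A \<subseteq> B \<or> B \<subseteq> A" using a maximals_subset[of \<B>] by (auto simp: laminar_def)
    thus False using a by (auto simp: maximals_def)
  qed
qed

text \<open>The portion 1/2 is what the stopping argument yields and what
  \<open>sparse_carleson\<close> uses; the 1/6 of the final family is deduced from it.\<close>

definition sparse_witness :: "real set set \<Rightarrow> (real set \<Rightarrow> real set) \<Rightarrow> bool"
  where "sparse_witness S E \<longleftrightarrow>
    (\<forall>R\<in>S. E R \<in> sets borel \<and> E R \<subseteq> R \<and> len R / 2 \<le> len (E R)) \<and> disjoint_family_on E S"

text \<open>Induction on the finite family. A maximal \<open>R\<close> takes all intervals reached
  from it without a stopping interval in between (\<open>Rem\<close>). The others inside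
  \<open>R\<close> lie below stopping intervals (\<open>Bad\<close>), whose union has at most half
  the length of \<open>R\<close>, so the rest of \<open>R\<close> can serve as its disjoint portion.
  The relation \<open>st\<close> stays abstract because the argument runs twice: with jumps of
  \<open>Phi\<close> and with jumps of \<open>pair_avg\<close>.\<close>

lemma principal_family:
  assumes fin: "finite \<I>" and lam: "laminar \<I>" and iv: "\<And>I. I \<in> \<I> \<Longrightarrow> ivl I"
    and pack: "\<And>R \<J>. R \<in> \<I> \<Longrightarrow> \<J> \<subseteq> \<I> \<Longrightarrow> disjoint \<J> \<Longrightarrow> (\<And>J. J \<in> \<J> \<Longrightarrow> J \<subseteq> R \<and> st J R)
      \<Longrightarrow> (\<Sum>J\<in>\<J>. len J) \<le> len R / 2"
  shows "\<exists>S E. S \<subseteq> \<I> \<and> sparse_witness S E \<and>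
    (\<forall>I\<in>\<I>. \<exists>R\<in>S. I \<subseteq> R \<and> (\<forall>I'\<in>\<I>. I \<subseteq> I' \<longrightarrow> I' \<subseteq> R \<longrightarrow> \<not> st I' R))"
  using assms
proof (induction \<I> rule: finite_psubset_induct)
  case (psubset \<I>)
  show ?case
  proof (cases "\<I> = {}")
    case True
    thus ?thesis by (auto simp: sparse_witness_def disjoint_family_on_def)
  next
    case False
    then obtain R where R: "R \<in> \<I>" "\<And>X. X \<in> \<I> \<Longrightarrow> R \<subseteq> X \<Longrightarrow> X = R"
      using finite_has_maximal[OF psubset.hyps] by metis
    define Rem where "Rem = {I \<in> \<I>. I \<subseteq> R \<and> (\<forall>I'\<in>\<I>. I \<subseteq> I' \<longrightarrow> I' \<subseteq> R \<longrightarrow> \<not> st I' R)}"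
    define Bad where "Bad = {J \<in> \<I>. J \<subseteq> R \<and> st J R}"
    have lenR: "len R > 0" by (rule ivlD(1)[OF psubset.prems(2)[OF R(1)]])
    \<comment> \<open>Packing for the single interval \<open>R\<close> excludes this; so
      \<open>R\<close> belongs to \<open>Rem\<close> and the family shrinks.\<close>
    have "\<not> st R R"
    proof
      assume "st R R"
      hence "(\<Sum>J\<in>{R}. len J) \<le> len R / 2" using R by (intro psubset.prems(3)) auto
      thus False using lenR by simp
    qed
    hence RRem: "R \<in> Rem" using R by (auto simp: Rem_def)
    have lt: "\<I> - Rem \<subset> \<I>" using R RRem by blast
    have "\<exists>S E. S \<subseteq> \<I> - Rem \<and> sparse_witness S E \<and>
      (\<forall>I\<in>\<I> - Rem. \<exists>R\<in>S. I \<subseteq> R \<and> (\<forall>I'\<in>\<I> - Rem. I \<subseteq> I' \<longrightarrow> I' \<subseteq> R \<longrightarrow> \<not> st I' R))"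
    proof (rule psubset.IH[OF lt])
      show "laminar (\<I> - Rem)" using psubset.prems(1) unfolding laminar_def by blast
      show "ivl I" if "I \<in> \<I> - Rem" for I using psubset.prems(2) that by blast
      show "(\<Sum>J\<in>\<J>. len J) \<le> len R' / 2"
        if "R' \<in> \<I> - Rem" "\<J> \<subseteq> \<I> - Rem" "disjoint \<J>" "\<And>J. J \<in> \<J> \<Longrightarrow> J \<subseteq> R' \<and> st J R'" for R' \<J>
        by (rule psubset.prems(3)) (use that in auto)
    qed
    then obtain S E where S: "S \<subseteq> \<I> - Rem" and E: "sparse_witness S E"
      and cov: "\<forall>I\<in>\<I> - Rem. \<exists>R\<in>S. I \<subseteq> R \<and> (\<forall>I'\<in>\<I> - Rem. I \<subseteq> I' \<longrightarrow> I' \<subseteq> R \<longrightarrow> \<not> st I' R)"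
      by (elim exE conjE) (rule that)
    \<comment> \<open>What remains and meets \<open>R\<close> sits inside a stopping interval; this
      makes the portion of \<open>R\<close> disjoint from all portions chosen for the remaining
      intervals.\<close>
    have inBad: "\<exists>B\<in>Bad. X \<subseteq> B" if "X \<in> \<I> - Rem" "X \<inter> R \<noteq> {}" for X
    proof -
      have "X \<subseteq> R \<or> R \<subseteq> X" using psubset.prems(1) R(1) that unfolding laminar_def by simp
      hence "X \<subseteq> R" using R(2)[of X] that by auto
      thus ?thesis using that by (auto simp: Rem_def Bad_def)
    qed
    define E' where "E' = E(R := R - \<Union>Bad)"
    have finB: "finite Bad" using psubset.hyps by (simp add: Bad_def)
    have ivB: "ivl J" if "J \<in> Bad" for J using that psubset.prems(2) by (auto simp: Bad_def)
    have UB: "\<Union>Bad \<in> sets borel" using finB ivB by (intro sets.finite_Union) (auto simp: ivlD(4))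
    have "len (R - \<Union>Bad) \<ge> len R / 2"
    proof -
      have "(\<Sum>J\<in>maximals Bad. len J) \<le> len R / 2"
        using disjoint_maximals[OF psubset.prems(1), of Bad] maximals_subset[of Bad]
        by (intro psubset.prems(3)[OF R(1)]) (auto simp: Bad_def)
      moreover have "measure lborel (\<Union>Bad) \<le> (\<Sum>J\<in>maximals Bad. len J)"
      proof -
        have f: "finite (maximals Bad)" using finB maximals_subset finite_subset by blast
        have "measure lborel (\<Union>J\<in>maximals Bad. J) \<le> (\<Sum>J\<in>maximals Bad. len J)"
          by (rule measure_UNION_le[OF f]) (use ivB maximals_subset[of Bad] in \<open>auto simp: ivlD(4)\<close>)
        thus ?thesis using Union_maximals[OF finB] by simp
      qed
      moreover have "len (R - \<Union>Bad) = len R - measure lborel (\<Union>Bad)"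
        by (rule measure_Diff) (use ivlD(4,5)[OF psubset.prems(2)[OF R(1)]] UB in \<open>auto simp: Bad_def fmeasurable_def\<close>)
      ultimately show ?thesis by simp
    qed
    hence "sparse_witness (insert R S) E'"
      unfolding sparse_witness_def disjoint_family_on_def
    proof (intro conjI ballI impI, goal_cases)
      case (1 X) thus ?case using E UB ivlD(4)[OF psubset.prems(2)[OF R(1)]] by (cases "X = R") (auto simp: E'_def sparse_witness_def)
    next
      case (2 X) thus ?case using E by (cases "X = R") (auto simp: E'_def sparse_witness_def)
    next
      case (3 X) thus ?case using E by (cases "X = R") (auto simp: E'_def sparse_witness_def)
    next
      case (4 X Y)
      have key: "E X \<inter> (R - \<Union>Bad) = {}" if "X \<in> S" for X
      proof -
        have "E X \<subseteq> X" using E that by (auto simp: sparse_witness_def)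
        moreover have "X \<inter> (R - \<Union>Bad) = {}" using inBad[of X] that S by (cases "X \<inter> R = {}") auto
        ultimately show ?thesis by auto
      qed
      have dis: "E X \<inter> E Y = {}" if "X \<in> S" "Y \<in> S" "X \<noteq> Y" for X Y
        using E that by (auto simp: sparse_witness_def disjoint_family_on_def)
      consider "X = R" "Y \<in> S" "Y \<noteq> R" | "Y = R" "X \<in> S" "X \<noteq> R" | "X \<in> S" "Y \<in> S" "X \<noteq> R" "Y \<noteq> R"
        using 4 by auto
      thus ?case
      proof cases
        case 1
        hence "E' X = R - \<Union>Bad" "E' Y = E Y" by (simp_all add: E'_def)
        thus ?thesis using key[OF 1(2)] by (simp add: Int_commute)
      next
        case 2
        hence "E' Y = R - \<Union>Bad" "E' X = E X" by (simp_all add: E'_def)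
        thus ?thesis using key[OF 2(2)] by simp
      next
        case 3
        hence "E' Y = E Y" "E' X = E X" by (simp_all add: E'_def)
        thus ?thesis using dis[OF 3(1,2)] 4 by simp
      qed
    qed
    moreover have "\<exists>R0\<in>insert R S. I \<subseteq> R0 \<and> (\<forall>I'\<in>\<I>. I \<subseteq> I' \<longrightarrow> I' \<subseteq> R0 \<longrightarrow> \<not> st I' R0)" if I: "I \<in> \<I>" for I
    proof (cases "I \<in> Rem")
      case True
      thus ?thesis unfolding Rem_def by blast
    next
      case False
      hence "\<exists>R\<in>S. I \<subseteq> R \<and> (\<forall>I'\<in>\<I> - Rem. I \<subseteq> I' \<longrightarrow> I' \<subseteq> R \<longrightarrow> \<not> st I' R)"
        using cov I by simp
      then obtain R0 where R0: "R0 \<in> S" "I \<subseteq> R0" "\<forall>I'\<in>\<I> - Rem. I \<subseteq> I' \<longrightarrow> I' \<subseteq> R0 \<longrightarrow> \<not> st I' R0"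
        by (elim bexE conjE)
      \<comment> \<open>The induction controls only intervals outside \<open>Rem\<close>. None of
        \<open>Rem\<close> occurs between \<open>I\<close> and \<open>R0\<close>: otherwise
        \<open>R0\<close> would meet \<open>R\<close> and lie in a stopping interval, which would
        separate that member of \<open>Rem\<close> from \<open>R\<close>.\<close>
      have "I' \<notin> Rem" if "I' \<in> \<I>" "I \<subseteq> I'" "I' \<subseteq> R0" for I'
      proof
        assume a: "I' \<in> Rem"
        have "I' \<noteq> {}" by (rule ivlD(6)[OF psubset.prems(2)[OF that(1)]])
        hence "R0 \<inter> R \<noteq> {}" using a that by (auto simp: Rem_def)
        then obtain B where "B \<in> Bad" "R0 \<subseteq> B" using inBad[of R0] R0(1) S by auto
        thus False using a that by (auto simp: Rem_def Bad_def)
      qed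
      thus ?thesis using R0 by blast
    qed
    moreover have "insert R S \<subseteq> \<I>" using S R by blast
    ultimately show ?thesis by blast
  qed
qed

text \<open>The disjoint portions of the members all fit into \<open>U\<close>, and each has at
  least half the length of its member.\<close>

lemma sparse_carleson:
  assumes E: "sparse_witness S E" and T: "finite T" "T \<subseteq> S" "\<And>R. R \<in> T \<Longrightarrow> R \<subseteq> U"
    and U: "U \<in> fmeasurable lborel"
  shows "(\<Sum>R\<in>T. len R) \<le> 2 * len U"
proof -
  have sub: "E R \<subseteq> U" "E R \<in> sets borel" "len R \<le> 2 * len (E R)" if "R \<in> T" for R
  proof -
    have "E R \<in> sets borel \<and> E R \<subseteq> R \<and> len R / 2 \<le> len (E R)" "R \<subseteq> U"
      using E T that unfolding sparse_witness_def by auto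
    thus "E R \<subseteq> U" "E R \<in> sets borel" "len R \<le> 2 * len (E R)" by auto
  qed
  have fm: "E R \<in> fmeasurable lborel" if "R \<in> T" for R
    using fmeasurableI2[OF U, of "E R"] sub[OF that] by auto
  have "(\<Sum>R\<in>T. len R) \<le> 2 * (\<Sum>R\<in>T. len (E R))"
    unfolding sum_distrib_left by (rule sum_mono) (use sub in auto)
  also have "(\<Sum>R\<in>T. len (E R)) = measure lborel (\<Union>R\<in>T. E R)"
  proof (rule measure_UNION'[symmetric, OF T(1)])
    show "pairwise (\<lambda>m n. disjnt (E m) (E n)) T"
    proof (rule pairwiseI)
      fix X Y assume "X \<in> T" "Y \<in> T" "X \<noteq> Y"
      moreover have "disjoint_family_on E S" using E by (simp add: sparse_witness_def)
      ultimately show "disjnt (E X) (E Y)" using T(2) unfolding disjoint_family_on_def disjnt_def by auto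
    qed
  qed (use fm in auto)
  also have "\<dots> \<le> len U"
    by (rule measure_mono_fmeasurable) (use sub U T in auto)
  finally show ?thesis by simp
qed

section \<open>Families of wave packets\<close>

text \<open>The constant depends on both intervals. This is harmless, since the comparison only
  serves to write two packets with one weight when an integral is shown to vanish, never in a
  bound.\<close>

lemma wt_compare:
  assumes l: "l > 0" "l' > 0"
  shows "\<exists>K>0. \<forall>x. wt c l x \<le> K * wt c' l' x"
proof (intro exI conjI allI)
  let ?K = "1 + \<bar>c' - c\<bar> / l + l' / l"
  show "?K > 0" using l by (simp add: add_pos_nonneg)
  fix x
  have "\<bar>x - c\<bar> / l \<le> (\<bar>c' - c\<bar> + \<bar>x - c'\<bar>) / l" using l by (intro divide_right_mono) auto
  also have "\<dots> = \<bar>c' - c\<bar> / l + (l' / l) * (\<bar>x - c'\<bar> / l')" using l by (simp add: add_divide_distrib)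
  also have "(l' / l) * (\<bar>x - c'\<bar> / l') \<le> (l' / l) * wt c' l' x"
    using l by (intro mult_left_mono) (auto simp: wt_def)
  also have "\<bar>c' - c\<bar> / l \<le> (\<bar>c' - c\<bar> / l) * wt c' l' x"
    using mult_left_mono[OF wt_ge_1[OF l(2), of c' x], of "\<bar>c' - c\<bar> / l"] l by simp
  finally have "\<bar>x - c\<bar> / l \<le> (\<bar>c' - c\<bar> / l + l' / l) * wt c' l' x" by (simp add: distrib_right)
  thus "wt c l x \<le> ?K * wt c' l' x"
    using wt_ge_1[OF l(2), of c' x] by (simp add: wt_def[of c l] distrib_right)
qed

lemma decay_integrable:
  fixes F :: "real \<Rightarrow> 'a::{banach,second_countable_topology}"
  assumes "l > 0" "F \<in> borel_measurable borel" "\<And>x. norm (F x) \<le> A / wt c l x ^ 2"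
  shows "integrable lborel F"
proof (rule Bochner_Integration.integrable_bound)
  show "integrable lborel (\<lambda>x. A * (1 / wt c l x ^ 2))"
    by (intro integrable_mult_right wt_integrable(1)[OF assms(1)]) simp
  show "AE x in lborel. norm (F x) \<le> norm (A * (1 / wt c l x ^ 2))"
  proof (rule AE_I2)
    fix x
    have "A / wt c l x ^ 2 \<le> \<bar>A\<bar> / wt c l x ^ 2" by (intro divide_right_mono) auto
    thus "norm (F x) \<le> norm (A * (1 / wt c l x ^ 2))" using assms(3)[of x] by simp
  qed
qed (use assms in auto)

text \<open>Multiplying \<open>\<phi>\<close> by \<open>cis (- (\<eta> * x))\<close> with
  \<open>\<eta> \<ge> 0\<close> moves its spectrum to the left, away from that of
  \<open>\<psi>\<close>, so \<open>moments_vanish\<close> applies to the product. The decay of order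
  10 of one packet pays for a power of at most 8 and leaves 2 for integrability.\<close>

lemma packet_moments_ordered:
  assumes l: "l > 0" and c\<phi>: "continuous_on UNIV \<phi>" and c\<psi>: "continuous_on UNIV \<psi>"
    and b\<phi>: "\<And>x. norm (\<phi> x) \<le> A / wt c l x ^ 10" and b\<psi>: "\<And>x. norm (\<psi> x) \<le> A' / wt c l x ^ 10"
    and s\<phi>: "\<And>\<xi>. \<xi> \<notin> {\<alpha>..<\<beta>} \<Longrightarrow> fourier \<phi> \<xi> = 0"
    and s\<psi>: "\<And>\<xi>. \<xi> \<notin> {\<alpha>'..<\<beta>'} \<Longrightarrow> fourier \<psi> \<xi> = 0"
    and ord: "\<beta> \<le> \<alpha>'" and j: "j \<le> 8"
  shows "integrable lborel (\<lambda>x. complex_of_real (((x - c) / l) ^ j) * (\<phi> x * cnj (\<psi> x)))"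
    and "(LINT x|lborel. complex_of_real (((x - c) / l) ^ j) * (\<phi> x * cnj (\<psi> x))) = 0"
proof -
  have [measurable]: "\<phi> \<in> borel_measurable borel" "\<psi> \<in> borel_measurable borel"
    using c\<phi> c\<psi> by (auto intro: borel_measurable_continuous_onI)
  have w1: "wt c l x \<ge> 1" for x by (rule wt_ge_1[OF l])
  have A: "A \<ge> 0" "A' \<ge> 0"
  proof -
    have "0 \<le> A / wt c l c ^ 10" "0 \<le> A' / wt c l c ^ 10"
      using b\<phi>[of c] b\<psi>[of c] norm_ge_zero order_trans by blast+
    thus "A \<ge> 0" "A' \<ge> 0" by (simp_all add: wt_def)
  qed
  have b\<psi>': "norm (\<psi> x) \<le> A'" for x
  proof -
    have "A' / wt c l x ^ 10 \<le> A' / 1" using A w1[of x] by (intro divide_left_mono) auto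
    thus ?thesis using b\<psi>[of x] by simp
  qed
  have dec: "norm (\<phi> x) \<le> A / wt c l x ^ 2" "norm (\<psi> x) \<le> A' / wt c l x ^ 2" for x
    using b\<phi>[of x] b\<psi>[of x] mult_left_mono[OF wt_power_antimono[OF l, of 2 10 c x] A(1)]
      mult_left_mono[OF wt_power_antimono[OF l, of 2 10 c x] A(2)] by auto
  have i\<phi>: "integrable lborel \<phi>" and i\<psi>: "integrable lborel \<psi>"
    by (rule decay_integrable[OF l _ dec(1)], measurable) (rule decay_integrable[OF l _ dec(2)], measurable)
  have int: "integrable lborel (\<lambda>x. complex_of_real (((x - c) / l) ^ j) * (\<phi> x * cnj (\<psi> x)))" if "j \<le> 8" for j
  proof (rule decay_integrable[OF l])
    fix x
    have "\<bar>(x - c) / l\<bar> ^ j \<le> wt c l x ^ j" using l by (intro power_mono) (auto simp: wt_def)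
    also have "\<dots> \<le> wt c l x ^ 8" by (rule power_increasing[OF that w1])
    finally have "\<bar>(x - c) / l\<bar> ^ j * (norm (\<phi> x) * norm (\<psi> x)) \<le> wt c l x ^ 8 * (A / wt c l x ^ 10 * A')"
      using b\<phi>[of x] b\<psi>'[of x] A w1[of x] by (intro mult_mono) auto
    also have "\<dots> = (A * A') / wt c l x ^ 2"
      using w1[of x] by (simp add: field_simps eval_nat_numeral)
    finally show "norm (complex_of_real (((x - c) / l) ^ j) * (\<phi> x * cnj (\<psi> x))) \<le> (A * A') / wt c l x ^ 2"
      by (simp only: norm_mult norm_of_real complex_mod_cnj power_abs)
  qed measurable
  show "integrable lborel (\<lambda>x. complex_of_real (((x - c) / l) ^ j) * (\<phi> x * cnj (\<psi> x)))" by (rule int[OF j])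
  have z: "(LINT x|lborel. cis (- (\<eta> * x)) * (\<phi> x * cnj (\<psi> x))) = 0" if \<eta>: "\<eta> \<ge> 0" for \<eta>
  proof -
    let ?u = "\<lambda>x. cis (- (\<eta> * x)) * \<phi> x"
    have iu: "integrable lborel ?u"
      by (rule Bochner_Integration.integrable_bound[OF i\<phi>]) (measurable, simp add: norm_mult)
    have e: "cis (- (\<eta> * x)) * \<phi> x * cis (- 2 * pi * \<xi> * x) = \<phi> x * cis (- 2 * pi * (\<xi> + \<eta> / (2 * pi)) * x)" for \<xi> x
    proof -
      have "- (\<eta> * x) + - 2 * pi * \<xi> * x = - 2 * pi * (\<xi> + \<eta> / (2 * pi)) * x" by (simp add: field_simps)
      thus ?thesis by (metis cis_mult mult.assoc mult.commute)
    qed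
    have fu: "fourier ?u \<xi> = fourier \<phi> (\<xi> + \<eta> / (2 * pi))" for \<xi>
      unfolding fourier_def e ..
    have "fourier ?u \<xi> = 0 \<or> fourier \<psi> \<xi> = 0" for \<xi>
    proof (cases "\<xi> < \<beta>")
      case True
      thus ?thesis using s\<psi>[of \<xi>] ord by auto
    next
      case False
      have "\<xi> + \<eta> / (2 * pi) \<ge> \<xi>" using \<eta> by simp
      hence "\<xi> + \<eta> / (2 * pi) \<notin> {\<alpha>..<\<beta>}" using False by auto
      thus ?thesis using s\<phi> fu by simp
    qed
    from disjoint_fourier_orthogonal[OF iu i\<psi> c\<psi> b\<psi>' this]
    show ?thesis by (simp add: mult.assoc)
  qed
  show "(LINT x|lborel. complex_of_real (((x - c) / l) ^ j) * (\<phi> x * cnj (\<psi> x))) = 0"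
    using moments_vanish[where F="\<lambda>x. \<phi> x * cnj (\<psi> x)" and m=8 and c=c and l=l, OF int z l j order_refl] by simp
qed

text \<open>Disjoint half-open intervals are ordered in one of two ways; conjugation exchanges the
  packets and reduces the second case to the first.\<close>

lemma packet_moments:
  assumes l: "l > 0" and c\<phi>: "continuous_on UNIV \<phi>" and c\<psi>: "continuous_on UNIV \<psi>"
    and b\<phi>: "\<And>x. norm (\<phi> x) \<le> A / wt c l x ^ 10" and b\<psi>: "\<And>x. norm (\<psi> x) \<le> A' / wt c l x ^ 10"
    and s\<phi>: "\<And>\<xi>. \<xi> \<notin> \<omega> \<Longrightarrow> fourier \<phi> \<xi> = 0" and s\<psi>: "\<And>\<xi>. \<xi> \<notin> \<omega>' \<Longrightarrow> fourier \<psi> \<xi> = 0"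
    and iv: "ivl \<omega>" "ivl \<omega>'" and disj: "\<omega> \<inter> \<omega>' = {}" and j: "j \<le> 8"
  shows "integrable lborel (\<lambda>x. complex_of_real (((x - c) / l) ^ j) * (\<phi> x * cnj (\<psi> x)))
    \<and> (LINT x|lborel. complex_of_real (((x - c) / l) ^ j) * (\<phi> x * cnj (\<psi> x))) = 0"
proof -
  obtain \<alpha> \<beta> where w: "\<alpha> < \<beta>" "\<omega> = {\<alpha>..<\<beta>}" using iv(1) by (auto simp: ivl_def)
  obtain \<alpha>' \<beta>' where w': "\<alpha>' < \<beta>'" "\<omega>' = {\<alpha>'..<\<beta>'}" using iv(2) by (auto simp: ivl_def)
  have "\<beta> \<le> \<alpha>' \<or> \<beta>' \<le> \<alpha>"
  proof (rule ccontr)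
    assume "\<not> (\<beta> \<le> \<alpha>' \<or> \<beta>' \<le> \<alpha>)"
    hence "max \<alpha> \<alpha>' \<in> \<omega> \<inter> \<omega>'" using w w' by auto
    thus False using disj by simp
  qed
  thus ?thesis
  proof
    assume "\<beta> \<le> \<alpha>'"
    with packet_moments_ordered[OF l c\<phi> c\<psi> b\<phi> b\<psi> s\<phi>[unfolded w] s\<psi>[unfolded w'] _ j] show ?thesis by blast
  next
    assume o: "\<beta>' \<le> \<alpha>"
    have e: "complex_of_real (((x - c) / l) ^ j) * (\<phi> x * cnj (\<psi> x)) = cnj (complex_of_real (((x - c) / l) ^ j) * (\<psi> x * cnj (\<phi> x)))" for x
      by (simp add: mult.commute)
    note * = packet_moments_ordered[OF l c\<psi> c\<phi> b\<psi> b\<phi> s\<psi>[unfolded w'] s\<phi>[unfolded w] o j]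
    show ?thesis
      unfolding e using integrable_cnj[OF *(1)] *(2) by (simp only: Bochner_Integration.integral_cnj) simp
  qed
qed

text \<open>Minkowski's integral inequality by duality: the sum of the squares of the integrals
  \<open>D k\<close> is the integral of the combination with coefficients \<open>D k\<close>.
  Cauchy-Schwarz under the integral bounds it by the norm of \<open>D\<close> times the integral on
  the right, and one factor cancels.\<close>

lemma minkowski_l2:
  fixes G :: "'k \<Rightarrow> real \<Rightarrow> real"
  assumes A: "finite A" and i: "\<And>k. k \<in> A \<Longrightarrow> integrable M (\<lambda>x. G k x * \<theta> x)"
    and iL: "integrable M (\<lambda>x. L2_set (\<lambda>k. G k x) A * \<theta> x)" and \<theta>: "\<And>x. \<theta> x \<ge> 0"
  shows "(\<Sum>k\<in>A. (LINT x|M. G k x * \<theta> x)\<^sup>2) \<le> (LINT x|M. L2_set (\<lambda>k. G k x) A * \<theta> x)\<^sup>2"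
proof -
  define D where "D k = (LINT x|M. G k x * \<theta> x)" for k
  define Y where "Y = (LINT x|M. L2_set (\<lambda>k. G k x) A * \<theta> x)"
  let ?r = "L2_set D A"
  have Y0: "Y \<ge> 0" unfolding Y_def by (intro integral_nonneg_AE AE_I2) (simp add: \<theta>)
  have "(\<Sum>k\<in>A. (D k)\<^sup>2) = (\<Sum>k\<in>A. D k * (LINT x|M. G k x * \<theta> x))"
    by (simp add: D_def power2_eq_square)
  also have "\<dots> = (LINT x|M. (\<Sum>k\<in>A. D k * (G k x * \<theta> x)))"
    by (subst Bochner_Integration.integral_sum) (auto intro: i)
  also have "\<dots> \<le> (LINT x|M. ?r * (L2_set (\<lambda>k. G k x) A * \<theta> x))"
  proof (rule integral_mono)
    show "integrable M (\<lambda>x. \<Sum>k\<in>A. D k * (G k x * \<theta> x))"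
      by (intro Bochner_Integration.integrable_sum integrable_mult_right i)
    show "integrable M (\<lambda>x. ?r * (L2_set (\<lambda>k. G k x) A * \<theta> x))" using iL by simp
    fix x
    have "(\<Sum>k\<in>A. D k * G k x) \<le> (\<Sum>k\<in>A. \<bar>D k\<bar> * \<bar>G k x\<bar>)"
      by (intro sum_mono) (metis abs_ge_self abs_mult)
    also have "\<dots> \<le> ?r * L2_set (\<lambda>k. G k x) A" by (rule L2_set_mult_ineq)
    finally have "(\<Sum>k\<in>A. D k * G k x) * \<theta> x \<le> ?r * L2_set (\<lambda>k. G k x) A * \<theta> x"
      using \<theta> by (rule mult_right_mono)
    thus "(\<Sum>k\<in>A. D k * (G k x * \<theta> x)) \<le> ?r * (L2_set (\<lambda>k. G k x) A * \<theta> x)"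
      by (simp add: sum_distrib_right mult.assoc)
  qed
  also have "\<dots> = ?r * Y" by (simp add: Y_def)
  finally have "?r * ?r \<le> ?r * Y" by (simp add: L2_set_def sum_nonneg)
  hence "?r \<le> Y"
    using Y0 L2_set_nonneg[of D A] by (cases "?r = 0") (auto simp: mult_le_cancel_left)
  hence "?r\<^sup>2 \<le> Y\<^sup>2" by (intro power_mono L2_set_nonneg)
  thus ?thesis by (simp add: L2_set_def sum_nonneg D_def Y_def)
qed

text \<open>The data of one colour. Tiles are paired with their index, which selects
  \<open>g k\<close> and \<open>a k\<close>. The condition \<open>lip\<close> is the form in which
  lacunarity is used: Lipschitz continuity at scale \<open>len (fst P)\<close> after removal of the
  frequency \<open>a k\<close>, with the decay taken at the centre \<open>z\<close> of a window,
  which will be a stopping interval.\<close>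

locale packet_family =
  fixes T :: "(nat \<times> tile) set" and \<phi> :: "tile \<Rightarrow> real \<Rightarrow> complex" and a :: "nat \<Rightarrow> real"
    and C0 C1 :: real and n N :: nat
  assumes finT: "finite T"
    and index: "(k, P) \<in> T \<Longrightarrow> k \<in> {1..N}"
    and dyadic: "(k, P) \<in> T \<Longrightarrow> fst P \<in> shifted_dyadic 0"
    and freq: "(k, P) \<in> T \<Longrightarrow> ivl (snd P)"
    and area: "(k, P) \<in> T \<Longrightarrow> len (fst P) * len (snd P) = 1"
    and sep: "(k, P) \<in> T \<Longrightarrow> (k', P') \<in> T \<Longrightarrow> snd P \<inter> snd P' \<noteq> {} \<Longrightarrow> k = k' \<and> snd P = snd P'"
    and C0: "C0 \<ge> 1" and C1: "C1 \<ge> 0"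
    and size: "(k, P) \<in> T \<Longrightarrow>
      norm (\<phi> P x) \<le> (C0 / len (fst P)) / wt (center (fst P)) (len (fst P)) x ^ 10"
    and cont: "(k, P) \<in> T \<Longrightarrow> continuous_on UNIV (\<phi> P)"
    and supp: "(k, P) \<in> T \<Longrightarrow> \<xi> \<notin> snd P \<Longrightarrow> fourier (\<phi> P) \<xi> = 0"
    and lip: "(k, P) \<in> T \<Longrightarrow> \<bar>x - z\<bar> \<le> len (fst P) / 2 \<Longrightarrow> \<bar>y - z\<bar> \<le> len (fst P) / 2 \<Longrightarrow>
      norm (cis (- 2 * pi * a k * x) * \<phi> P x - cis (- 2 * pi * a k * y) * \<phi> P y)
        \<le> C1 * \<bar>x - y\<bar> / (len (fst P))\<^sup>2 / wt (center (fst P)) (len (fst P)) z ^ 10"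
    and mult: "card {P. (k, P) \<in> T \<and> fst P = I} \<le> n"
begin

lemma len_pos: "(k, P) \<in> T \<Longrightarrow> len (fst P) > 0"
  using dyadic grid_is_ivl ivlD(1) by blast

lemma packet_measurable: "(k, P) \<in> T \<Longrightarrow> \<phi> P \<in> borel_measurable borel"
  by (rule borel_measurable_continuous_onI[OF cont])

lemma cross_integrable:
  assumes "(k, P) \<in> T" "(k', P') \<in> T"
  shows "integrable lborel (\<lambda>x. \<phi> P x * cnj (\<phi> P' x))"
proof (rule decay_integrable[OF len_pos[OF assms(1)]])
  have [measurable]: "\<phi> P \<in> borel_measurable borel" "\<phi> P' \<in> borel_measurable borel"
    using packet_measurable assms by auto
  show "(\<lambda>x. \<phi> P x * cnj (\<phi> P' x)) \<in> borel_measurable borel" by measurable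
  fix x
  let ?l = "len (fst P)" and ?l' = "len (fst P')" and ?c = "center (fst P)" and ?c' = "center (fst P')"
  note l = len_pos[OF assms(1)] len_pos[OF assms(2)]
  have "norm (\<phi> P x) \<le> (C0 / ?l) * (1 / wt ?c ?l x ^ 10)" using size[OF assms(1)] by simp
  also have "\<dots> \<le> (C0 / ?l) * (1 / wt ?c ?l x ^ 2)"
    using l C0 by (intro mult_left_mono wt_power_antimono) auto
  finally have 1: "norm (\<phi> P x) \<le> (C0 / ?l) * (1 / wt ?c ?l x ^ 2)" .
  have "norm (\<phi> P' x) \<le> (C0 / ?l') * (1 / wt ?c' ?l' x ^ 10)" using size[OF assms(2)] by simp
  also have "\<dots> \<le> (C0 / ?l') * (1 / wt ?c' ?l' x ^ 0)"
    using l C0 by (intro mult_left_mono wt_power_antimono) auto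
  finally have 2: "norm (\<phi> P' x) \<le> C0 / ?l'" by simp
  show "norm (\<phi> P x * cnj (\<phi> P' x)) \<le> (C0 / ?l * (C0 / ?l')) / wt ?c ?l x ^ 2"
    using mult_mono[OF 1 2] l C0 wt_pos[OF l(1), of ?c x] by (simp add: norm_mult mult_ac)
qed

lemma cross_zero:
  assumes P: "(k, P) \<in> T" and P': "(k', P') \<in> T" and d: "snd P \<inter> snd P' = {}"
  shows "(LINT x|lborel. \<phi> P x * cnj (\<phi> P' x)) = 0"
proof -
  let ?l = "len (fst P)" and ?l' = "len (fst P')" and ?c = "center (fst P)" and ?c' = "center (fst P')"
  note l = len_pos[OF P] len_pos[OF P']
  obtain K where K: "K > 0" "\<And>x. wt ?c ?l x \<le> K * wt ?c' ?l' x"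
    using wt_compare[OF l, of ?c ?c'] by auto
  have b: "norm (\<phi> P' x) \<le> (C0 / ?l' * K ^ 10) / wt ?c ?l x ^ 10" for x
  proof -
    have "wt ?c ?l x ^ 10 \<le> (K * wt ?c' ?l' x) ^ 10" by (intro power_mono K less_imp_le[OF wt_pos[OF l(1)]])
    hence "1 / wt ?c' ?l' x ^ 10 \<le> K ^ 10 / wt ?c ?l x ^ 10"
      using wt_pos[OF l(1), of ?c x] wt_pos[OF l(2), of ?c' x] by (simp add: field_simps power_mult_distrib)
    hence "(C0 / ?l') * (1 / wt ?c' ?l' x ^ 10) \<le> (C0 / ?l') * (K ^ 10 / wt ?c ?l x ^ 10)"
      using C0 l by (intro mult_left_mono) auto
    thus ?thesis using size[OF P', of x] by simp
  qed
  show ?thesis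
    using packet_moments[OF l(1) cont[OF P] cont[OF P'] size[OF P] b supp[OF P] supp[OF P'] freq[OF P] freq[OF P'] d, of 0]
    by simp
qed

text \<open>Two powers of the product of the decay factors are converted by
  \<open>wt_product\<close> into decay in the distance of the centres; 8 powers of the first factor
  remain for the integral.\<close>

lemma cross_bound:
  assumes P: "(k, P) \<in> T" and P': "(k', P') \<in> T" and e: "len (fst P') = len (fst P)"
  shows "norm (LINT x|lborel. \<phi> P x * cnj (\<phi> P' x))
    \<le> (4 * C0\<^sup>2 / len (fst P)) * (1 / (wt (center (fst P')) (len (fst P')) (center (fst P)))\<^sup>2)"
proof -
  let ?l = "len (fst P)" and ?c = "center (fst P)" and ?c' = "center (fst P')"
  let ?w = "wt ?c' ?l ?c"
  note l = len_pos[OF P]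
  have "norm (LINT x|lborel. \<phi> P x * cnj (\<phi> P' x)) \<le> (LINT x|lborel. (C0\<^sup>2 / ?l\<^sup>2 / ?w\<^sup>2) * (1 / wt ?c ?l x ^ 8))"
  proof (rule Bochner_Integration.integral_norm_bound_integral[OF cross_integrable[OF P P']])
    show "integrable lborel (\<lambda>x. (C0\<^sup>2 / ?l\<^sup>2 / ?w\<^sup>2) * (1 / wt ?c ?l x ^ 8))"
      using wt_integrable(1)[OF l, of 8 ?c] by (intro integrable_mult_right) auto
    fix x
    let ?p = "wt ?c ?l x" and ?q = "wt ?c' ?l x"
    have pq: "?p > 0" "?q > 0" "?q \<ge> 1" "?w > 0" using l by (auto intro: wt_pos wt_ge_1)
    have "norm (\<phi> P x * cnj (\<phi> P' x)) \<le> ((C0 / ?l) / ?p ^ 10) * ((C0 / ?l) / ?q ^ 10)"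
      unfolding norm_mult complex_mod_cnj
      using size[OF P, of x] size[OF P', of x] C0 l pq unfolding e by (intro mult_mono) auto
    also have "\<dots> = (C0\<^sup>2 / ?l\<^sup>2) * (1 / (?p ^ 10 * ?q ^ 10))" by (simp add: power2_eq_square)
    also have "\<dots> \<le> (C0\<^sup>2 / ?l\<^sup>2) * (1 / (?w\<^sup>2 * ?p ^ 8))"
    proof (intro mult_left_mono divide_left_mono)
      have "?w \<le> ?p * ?q" using wt_product[OF l, of ?c ?c' x] wt_commute[of ?c ?l ?c'] by simp
      hence "?w\<^sup>2 * ?p ^ 8 \<le> (?p * ?q)\<^sup>2 * ?p ^ 8" using pq by (intro mult_right_mono power_mono) auto
      also have "\<dots> = ?p ^ 10 * ?q ^ 2" by (simp add: power_mult_distrib eval_nat_numeral)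
      also have "\<dots> \<le> ?p ^ 10 * ?q ^ 10" using pq by (intro mult_left_mono power_increasing) auto
      finally show "?w\<^sup>2 * ?p ^ 8 \<le> ?p ^ 10 * ?q ^ 10" .
    qed (use pq in auto)
    finally show "norm (\<phi> P x * cnj (\<phi> P' x)) \<le> (C0\<^sup>2 / ?l\<^sup>2 / ?w\<^sup>2) * (1 / ?p ^ 8)" by simp
  qed
  also have "\<dots> = (C0\<^sup>2 / ?l\<^sup>2 / ?w\<^sup>2) * (LINT x|lborel. 1 / wt ?c ?l x ^ 8)" by (rule integral_mult_right_zero)
  also have "\<dots> \<le> (C0\<^sup>2 / ?l\<^sup>2 / ?w\<^sup>2) * (4 * ?l)"
    using wt_integrable(2)[OF l, of 8 ?c] by (intro mult_left_mono) auto
  also have "\<dots> = (4 * C0\<^sup>2 / ?l) * (1 / ?w\<^sup>2)" using l by (simp add: power2_eq_square)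
  finally show ?thesis unfolding e .
qed

lemma packet_pairing_integrable:
  assumes "(k, P) \<in> T" "bdd_supp h"
  shows "integrable lborel (\<lambda>x. h x * cnj (\<phi> P x))"
  by (intro bdd_supp_integrable bdd_supp_mult_continuous[OF assms(2)] continuous_on_cnj cont[OF assms(1)])

text \<open>Scaled by \<open>sqrt (len (fst P))\<close> the packets are bounded in L^2. Their Gram
  matrix vanishes unless the frequency intervals agree; then the area condition forces equal
  lengths, and \<open>cross_bound\<close> with \<open>grid_scale_sum_le\<close> bounds a row by
  \<open>4 * C0\<^sup>2 * 4\<close>.\<close>

lemma global_bessel:
  assumes h: "bdd_supp h" and X: "X \<subseteq> T"
  shows "(\<Sum>(k, P)\<in>X. len (fst P) * (norm (L2_inner h (\<phi> P)))\<^sup>2) \<le> 16 * C0\<^sup>2 * (LINT x|lborel. (norm (h x))\<^sup>2)"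
proof -
  have finX: "finite X" using X finT finite_subset by blast
  let ?u = "\<lambda>(k, P) x. complex_of_real (sqrt (len (fst P))) * \<phi> P x"
  have "(\<Sum>p\<in>X. (norm (LINT x|lborel. h x * cnj (?u p x)))\<^sup>2) \<le> 16 * C0\<^sup>2 * (LINT x|lborel. (norm (h x))\<^sup>2)"
  proof (rule schur_bessel[OF finX])
    show "16 * C0\<^sup>2 > 0" using C0 by simp
    show "integrable lborel (\<lambda>x. (norm (h x))\<^sup>2)" by (intro bdd_supp_integrable bdd_supp_norm_square h)
    show "integrable lborel (\<lambda>x. h x * cnj (?u p x))" if p: "p \<in> X" for p
    proof -
      obtain k P where kP: "p = (k, P)" by (cases p)
      have "integrable lborel (\<lambda>x. complex_of_real (sqrt (len (fst P))) * (h x * cnj (\<phi> P x)))"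
        using packet_pairing_integrable[of k P h] p kP X h by (intro integrable_mult_right) auto
      thus ?thesis by (simp add: kP mult_ac)
    qed
    have uu: "?u (k, P) x * cnj (?u (k', P') x) = complex_of_real (sqrt (len (fst P)) * sqrt (len (fst P'))) * (\<phi> P x * cnj (\<phi> P' x))"
      for k k' P P' x by (simp add: mult_ac)
    show "integrable lborel (\<lambda>x. ?u p x * cnj (?u q x))" if "p \<in> X" "q \<in> X" for p q
    proof -
      obtain k P k' P' where e: "p = (k, P)" "q = (k', P')" by (cases p, cases q)
      show ?thesis
        unfolding e uu using that X e by (intro integrable_mult_right cross_integrable[of k P k' P']) auto
    qed
    fix p assume p: "p \<in> X"
    obtain k P where kP: "p = (k, P)" by (cases p)
    have PT: "(k, P) \<in> T" using p kP X by auto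
    let ?l = "len (fst P)"
    define Y where "Y = {q \<in> X. snd (snd q) = snd P}"
    have finY: "finite Y" using finX by (simp add: Y_def)
    have Yk: "fst q = k" "(k, snd q) \<in> T" "len (fst (snd q)) = ?l" if "q \<in> Y" for q
    proof -
      have q: "(fst q, snd q) \<in> T" "snd (snd q) = snd P" using that X by (auto simp: Y_def)
      have ne: "snd P \<noteq> {}" by (rule ivlD(6)[OF freq[OF PT]])
      show 1: "fst q = k" using sep[OF q(1) PT] q(2) ne by auto
      thus "(k, snd q) \<in> T" using q by simp
      have "len (fst (snd q)) * len (snd P) = 1" using area[OF q(1)] q(2) by simp
      moreover have "?l * len (snd P) = 1" by (rule area[OF PT])
      ultimately show "len (fst (snd q)) = ?l" by (metis mult_cancel_right zero_neq_one mult_zero_right)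
    qed
    have "(\<Sum>q\<in>X. norm (LINT x|lborel. ?u p x * cnj (?u q x))) = (\<Sum>q\<in>Y. norm (LINT x|lborel. ?u p x * cnj (?u q x)))"
    proof (rule sum.mono_neutral_right[OF finX])
      show "\<forall>q\<in>X - Y. norm (LINT x|lborel. ?u p x * cnj (?u q x)) = 0"
      proof
        fix q assume q: "q \<in> X - Y"
        obtain k' P' where e: "q = (k', P')" by (cases q)
        have PT': "(k', P') \<in> T" using q e X by auto
        have "snd P \<inter> snd P' = {}" using sep[OF PT PT'] q e by (auto simp: Y_def)
        from cross_zero[OF PT PT' this] show "norm (LINT x|lborel. ?u p x * cnj (?u q x)) = 0"
          unfolding kP e uu integral_mult_right_zero by simp
      qed
    qed (simp add: Y_def)
    also have "\<dots> \<le> (\<Sum>q\<in>Y. 4 * C0\<^sup>2 * (1 / (wt (center (fst (snd q))) (len (fst (snd q))) (center (fst P)))\<^sup>2))"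
    proof (rule sum_mono)
      fix q assume q: "q \<in> Y"
      have qe: "q = (k, snd q)" using Yk(1)[OF q] by (metis prod.collapse)
      have "norm (LINT x|lborel. ?u p x * cnj (?u q x)) = ?l * norm (LINT x|lborel. \<phi> P x * cnj (\<phi> (snd q) x))"
        unfolding kP by (subst qe) (simp only: uu integral_mult_right_zero, use Yk(3)[OF q] len_pos[OF PT] in \<open>simp add: norm_mult abs_mult\<close>)
      also have "\<dots> \<le> ?l * ((4 * C0\<^sup>2 / ?l) * (1 / (wt (center (fst (snd q))) (len (fst (snd q))) (center (fst P)))\<^sup>2))"
        using cross_bound[OF PT Yk(2)[OF q] Yk(3)[OF q]] len_pos[OF PT] by (intro mult_left_mono) auto
      finally show "norm (LINT x|lborel. ?u p x * cnj (?u q x)) \<le> 4 * C0\<^sup>2 * (1 / (wt (center (fst (snd q))) (len (fst (snd q))) (center (fst P)))\<^sup>2)"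
        using len_pos[OF PT] by simp
    qed
    also have "\<dots> = 4 * C0\<^sup>2 * (\<Sum>q\<in>Y. 1 / (wt (center (fst (snd q))) (len (fst (snd q))) (center (fst P)))\<^sup>2)"
      by (simp add: sum_distrib_left)
    also have "(\<Sum>q\<in>Y. 1 / (wt (center (fst (snd q))) (len (fst (snd q))) (center (fst P)))\<^sup>2)
       = (\<Sum>I\<in>(fst \<circ> snd) ` Y. 1 / (wt (center I) (len I) (center (fst P)))\<^sup>2)"
    proof (subst sum.reindex)
      show "inj_on (fst \<circ> snd) Y"
      proof (rule inj_onI)
        fix q q' assume "q \<in> Y" "q' \<in> Y" "(fst \<circ> snd) q = (fst \<circ> snd) q'"
        thus "q = q'" using Yk(1)[of q] Yk(1)[of q'] by (auto simp: Y_def prod_eq_iff)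
      qed
    qed simp
    also have "4 * C0\<^sup>2 * \<dots> \<le> 4 * C0\<^sup>2 * 4"
      by (intro mult_left_mono grid_scale_sum_le[where s=0 and l="?l"]) (use finY Yk(3) dyadic[OF Yk(2)] in auto)
    finally show "(\<Sum>q\<in>X. norm (LINT x|lborel. ?u p x * cnj (?u q x))) \<le> 16 * C0\<^sup>2" by simp
  qed
  also have "(\<Sum>p\<in>X. (norm (LINT x|lborel. h x * cnj (?u p x)))\<^sup>2) = (\<Sum>(k, P)\<in>X. len (fst P) * (norm (L2_inner h (\<phi> P)))\<^sup>2)"
  proof (intro sum.cong refl)
    fix p assume p: "p \<in> X"
    obtain k P where kP: "p = (k, P)" by (cases p)
    have "(LINT x|lborel. h x * cnj (?u p x)) = complex_of_real (sqrt (len (fst P))) * L2_inner h (\<phi> P)"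
      unfolding L2_inner_def integral_mult_right_zero[symmetric] by (simp add: kP mult_ac)
    thus "(norm (LINT x|lborel. h x * cnj (?u p x)))\<^sup>2 = (case p of (k, P) \<Rightarrow> len (fst P) * (norm (L2_inner h (\<phi> P)))\<^sup>2)"
      using len_pos[of k P] p X by (simp add: kP norm_mult power_mult_distrib)
  qed
  finally show ?thesis .
qed

text \<open>Since all moments up to order 8 of the products of two packets vanish, the packets on one interval stay
  orthogonal when multiplied by the square of the polynomial weight \<open>W\<close>; this localizes Bessel's inequality.\<close>

lemma local_bessel:
  assumes h: "bdd_supp h" and I: "ivl I"
  shows "(\<Sum>(k, P)\<in>{p \<in> T. fst (snd p) = I}. (norm (L2_inner h (\<phi> P)))\<^sup>2)
    \<le> (64 * C0\<^sup>2 / len I) * (LINT x|lborel. (norm (h x))\<^sup>2 * (1 / wt (center I) (len I) x ^ 8))"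
proof -
  let ?c = "center I" and ?l = "len I"
  let ?X = "{p \<in> T. fst (snd p) = I}"
  have l: "?l > 0" by (rule ivlD(1)[OF I])
  \<comment> \<open>A polynomial comparable with the square of the weight, so that only powers of
    \<open>(x - ?c) / ?l\<close> will occur.\<close>
  define W where "W x = 1 + ((x - ?c) / ?l)\<^sup>2" for x
  have cW: "continuous_on UNIV W" unfolding W_def divide_inverse by (intro continuous_intros)
  have W1: "W x \<ge> 1" for x by (simp add: W_def)
  have W0: "W x > 0" for x using W1[of x] by linarith
  have Wle: "W x \<le> (wt ?c ?l x)\<^sup>2" for x
  proof -
    have "(wt ?c ?l x)\<^sup>2 = 1 + 2 * (\<bar>x - ?c\<bar> / ?l) + (\<bar>x - ?c\<bar> / ?l)\<^sup>2"
      unfolding wt_def by (simp add: power2_eq_square algebra_simps)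
    thus ?thesis unfolding W_def using l by (simp add: power_divide)
  qed
  have Wge: "(wt ?c ?l x)\<^sup>2 \<le> 2 * W x" for x
  proof -
    have "(1 + y)\<^sup>2 \<le> 2 * (1 + y\<^sup>2)" for y :: real
      using zero_le_power2[of "1 - y"] by (simp add: power2_eq_square algebra_simps)
    moreover have "((x - ?c) / ?l)\<^sup>2 = (\<bar>x - ?c\<bar> / ?l)\<^sup>2" by (simp add: power_divide)
    ultimately show ?thesis unfolding W_def wt_def by simp
  qed
  have [measurable]: "W \<in> borel_measurable borel" by (rule borel_measurable_continuous_onI[OF cW])
  \<comment> \<open>The pairing is unchanged when \<open>h\<close> is divided and the packet
    multiplied by \<open>(W x)\<^sup>2\<close>. Bessel's inequality for the modified packets then
    has a weighted norm of \<open>h\<close> on the right.\<close>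
  let ?h = "\<lambda>x. h x * complex_of_real (1 / (W x)\<^sup>2)"
  let ?u = "\<lambda>p x. complex_of_real ((W x)\<^sup>2) * \<phi> (snd p) x"
  have finX: "finite ?X" using finT by simp
  have XT: "(fst p, snd p) \<in> T" "fst (snd p) = I" if "p \<in> ?X" for p using that by auto
  have bh: "bdd_supp ?h"
    by (intro bdd_supp_mult_continuous[OF h] continuous_intros cW) (use W0 in \<open>simp add: less_imp_neq[symmetric]\<close>)
  have hu: "?h x * cnj (?u p x) = h x * cnj (\<phi> (snd p) x)" for p x
    using W0[of x] by (simp add: field_simps power2_eq_square)
  have "(\<Sum>p\<in>?X. (norm (LINT x|lborel. ?h x * cnj (?u p x)))\<^sup>2) \<le> (4 * C0\<^sup>2 / ?l) * (LINT x|lborel. (norm (?h x))\<^sup>2)"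
  proof (rule schur_bessel[OF finX])
    show "4 * C0\<^sup>2 / ?l > 0" using C0 l by simp
    show "integrable lborel (\<lambda>x. (norm (?h x))\<^sup>2)" by (intro bdd_supp_integrable bdd_supp_norm_square bh)
    show "integrable lborel (\<lambda>x. ?h x * cnj (?u p x))" if "p \<in> ?X" for p
      unfolding hu by (rule packet_pairing_integrable[OF XT(1)[OF that] h])
    have nu: "norm (?u p x * cnj (?u q x)) \<le> (C0\<^sup>2 / ?l\<^sup>2) * (1 / wt ?c ?l x ^ 2)" if "p \<in> ?X" "q \<in> ?X" for p q x
    proof -
      let ?w = "wt ?c ?l x"
      have w: "?w \<ge> 1" by (rule wt_ge_1[OF l])
      have nb: "norm (?u p x) \<le> (C0 / ?l) * (1 / ?w ^ 6)" if p: "p \<in> ?X" for p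
      proof -
        have "norm (?u p x) = (W x)\<^sup>2 * norm (\<phi> (snd p) x)" using W0[of x] by (simp add: norm_mult norm_power)
        also have "\<dots> \<le> (?w\<^sup>2)\<^sup>2 * ((C0 / ?l) / ?w ^ 10)"
          using size[OF XT(1)[OF p], of x] XT(2)[OF p] Wle[of x] W0[of x] by (intro mult_mono power_mono) auto
        also have "\<dots> = (C0 / ?l) * (1 / ?w ^ 6)" using w l by (simp add: field_simps eval_nat_numeral)
        finally show ?thesis .
      qed
      have "norm (?u p x * cnj (?u q x)) \<le> ((C0 / ?l) * (1 / ?w ^ 6)) * ((C0 / ?l) * (1 / ?w ^ 6))"
        unfolding norm_mult[of "?u p x"] complex_mod_cnj using nb[OF that(1)] nb[OF that(2)] C0 l w by (intro mult_mono) auto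
      also have "\<dots> = (C0\<^sup>2 / ?l\<^sup>2) * (1 / ?w ^ 12)" by (simp add: power2_eq_square power_add[symmetric])
      also have "\<dots> \<le> (C0\<^sup>2 / ?l\<^sup>2) * (1 / ?w ^ 2)" by (intro mult_left_mono wt_power_antimono l) auto
      finally show ?thesis .
    qed
    have iuu: "integrable lborel (\<lambda>x. ?u p x * cnj (?u q x))" if "p \<in> ?X" "q \<in> ?X" for p q
    proof (rule decay_integrable[OF l])
      have [measurable]: "\<phi> (snd p) \<in> borel_measurable borel" "\<phi> (snd q) \<in> borel_measurable borel"
        using packet_measurable XT(1) that by blast+
      show "(\<lambda>x. ?u p x * cnj (?u q x)) \<in> borel_measurable borel" by measurable
      show "norm (?u p x * cnj (?u q x)) \<le> (C0\<^sup>2 / ?l\<^sup>2) / wt ?c ?l x ^ 2" for x using nu[OF that, of x] by simp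
    qed
    show "integrable lborel (\<lambda>x. ?u p x * cnj (?u q x))" if "p \<in> ?X" "q \<in> ?X" for p q by (rule iuu[OF that])
    fix p assume p: "p \<in> ?X"
    have z: "norm (LINT x|lborel. ?u p x * cnj (?u q x)) = 0" if q: "q \<in> ?X" "q \<noteq> p" for q
    proof -
      note pT = XT[OF p] and qT = XT[OF q(1)]
      have d: "snd (snd p) \<inter> snd (snd q) = {}"
      proof (rule ccontr)
        assume "snd (snd p) \<inter> snd (snd q) \<noteq> {}"
        from sep[OF pT(1) qT(1) this] have "p = q" using pT(2) qT(2) by (auto simp: prod_eq_iff)
        thus False using q by simp
      qed
      let ?F = "\<lambda>x. \<phi> (snd p) x * cnj (\<phi> (snd q) x)"
      let ?m = "\<lambda>j x. complex_of_real (((x - ?c) / ?l) ^ j) * ?F x"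
      have m: "integrable lborel (?m j) \<and> (LINT x|lborel. ?m j x) = 0" if "j \<le> 8" for j
        by (rule packet_moments[OF l cont[OF pT(1)] cont[OF qT(1)] size[OF pT(1), unfolded pT(2)] size[OF qT(1), unfolded qT(2)]
            supp[OF pT(1)] supp[OF qT(1)] freq[OF pT(1)] freq[OF qT(1)] d that])
      \<comment> \<open>The product carries \<open>W x ^ 4\<close>, that is
        \<open>(1 + y\<^sup>2) ^ 4\<close> with \<open>y = (x - ?c) / ?l\<close>: a combination of
        moments of order at most 8, each of which vanishes.\<close>
      have "?u p x * cnj (?u q x) = ?m 0 x + 4 * ?m 2 x + 6 * ?m 4 x + 4 * ?m 6 x + ?m 8 x" for x
      proof -
        let ?y = "complex_of_real ((x - ?c) / ?l)"
        have "?u p x * cnj (?u q x) = ((1 + ?y ^ 2) ^ 2 * (1 + ?y ^ 2) ^ 2) * ?F x" by (simp add: W_def mult_ac)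
        also have "(1 + ?y ^ 2) ^ 2 * (1 + ?y ^ 2) ^ 2 = ?y ^ 0 + 4 * ?y ^ 2 + 6 * ?y ^ 4 + 4 * ?y ^ 6 + ?y ^ 8"
          by algebra
        finally show ?thesis by (simp only: of_real_power distrib_right mult.assoc)
      qed
      hence "(LINT x|lborel. ?u p x * cnj (?u q x)) = (LINT x|lborel. ?m 0 x + 4 * ?m 2 x + 6 * ?m 4 x + 4 * ?m 6 x + ?m 8 x)"
        by simp
      also have "\<dots> = (LINT x|lborel. ?m 0 x) + 4 * (LINT x|lborel. ?m 2 x) + 6 * (LINT x|lborel. ?m 4 x) + 4 * (LINT x|lborel. ?m 6 x) + (LINT x|lborel. ?m 8 x)"
        using m[of 0] m[of 2] m[of 4] m[of 6] m[of 8]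
        by (simp only: Bochner_Integration.integral_add Bochner_Integration.integrable_add integrable_mult_right integral_mult_right_zero)
      also have "\<dots> = 0" using m[of 0] m[of 2] m[of 4] m[of 6] m[of 8] by simp
      finally show ?thesis by simp
    qed
    have "(\<Sum>q\<in>?X. norm (LINT x|lborel. ?u p x * cnj (?u q x))) = (\<Sum>q\<in>{p}. norm (LINT x|lborel. ?u p x * cnj (?u q x)))"
      by (rule sum.mono_neutral_right[OF finX]) (use p z in auto)
    also have "\<dots> = norm (LINT x|lborel. ?u p x * cnj (?u p x))" by simp
    also have "\<dots> \<le> (LINT x|lborel. (C0\<^sup>2 / ?l\<^sup>2) * (1 / wt ?c ?l x ^ 2))"
      by (intro Bochner_Integration.integral_norm_bound_integral iuu p integrable_mult_right wt_integrable(1)[OF l] nu) auto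
    also have "\<dots> = (C0\<^sup>2 / ?l\<^sup>2) * (LINT x|lborel. 1 / wt ?c ?l x ^ 2)" by (rule integral_mult_right_zero)
    also have "\<dots> \<le> (C0\<^sup>2 / ?l\<^sup>2) * (4 * ?l)"
      using wt_integrable(2)[OF l, of 2 ?c] by (intro mult_left_mono) auto
    also have "\<dots> = 4 * C0\<^sup>2 / ?l" using l by (simp add: power2_eq_square)
    finally show "(\<Sum>q\<in>?X. norm (LINT x|lborel. ?u p x * cnj (?u q x))) \<le> 4 * C0\<^sup>2 / ?l" .
  qed
  note B1 = this
  have "(LINT x|lborel. (norm (?h x))\<^sup>2) \<le> (LINT x|lborel. 16 * ((norm (h x))\<^sup>2 * (1 / wt ?c ?l x ^ 8)))"
  proof (rule integral_mono)
    show "integrable lborel (\<lambda>x. (norm (?h x))\<^sup>2)" by (intro bdd_supp_integrable bdd_supp_norm_square bh)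
    show "integrable lborel (\<lambda>x. 16 * ((norm (h x))\<^sup>2 * (1 / wt ?c ?l x ^ 8)))"
      by (intro integrable_mult_right weighted_integrable bdd_supp_norm_square h l) auto
    fix x
    have w: "wt ?c ?l x > 0" by (rule wt_pos[OF l])
    have "((wt ?c ?l x)\<^sup>2) ^ 4 \<le> (2 * W x) ^ 4" by (intro power_mono Wge) auto
    hence "wt ?c ?l x ^ 8 \<le> 16 * W x ^ 4" by (simp add: power_mult[symmetric] power_mult_distrib)
    hence "1 / W x ^ 4 \<le> 16 * (1 / wt ?c ?l x ^ 8)" using w W0[of x] by (simp add: field_simps)
    hence "(norm (h x))\<^sup>2 * (1 / W x ^ 4) \<le> (norm (h x))\<^sup>2 * (16 * (1 / wt ?c ?l x ^ 8))" by (rule mult_left_mono) simp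
    moreover have "(norm (?h x))\<^sup>2 = (norm (h x))\<^sup>2 * (1 / W x ^ 4)"
      by (simp add: norm_mult norm_divide norm_power power_mult_distrib power_divide power_mult[symmetric])
    ultimately show "(norm (?h x))\<^sup>2 \<le> 16 * ((norm (h x))\<^sup>2 * (1 / wt ?c ?l x ^ 8))" by (simp only: mult.left_commute)
  qed
  also have "\<dots> = 16 * (LINT x|lborel. (norm (h x))\<^sup>2 * (1 / wt ?c ?l x ^ 8))" by (rule integral_mult_right_zero)
  finally have "(\<Sum>p\<in>?X. (norm (LINT x|lborel. ?h x * cnj (?u p x)))\<^sup>2)
     \<le> (4 * C0\<^sup>2 / ?l) * (16 * (LINT x|lborel. (norm (h x))\<^sup>2 * (1 / wt ?c ?l x ^ 8)))"
    using l by (intro order_trans[OF B1] mult_left_mono) auto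
  thus ?thesis unfolding hu by (simp add: L2_inner_def split_beta')
qed

text \<open>Cauchy-Schwarz over the tiles at \<open>I\<close>. The coefficients of \<open>f\<close>
  are controlled by \<open>local_bessel\<close> and \<open>Phi_weighted\<close> (128 = 64 * 2), the
  majorants \<open>d\<close> by Minkowski's inequality over \<open>k\<close>, with a factor
  \<open>n\<close> because several tiles may share an index. Since \<open>\<theta>\<close> is common
  to all tiles at \<open>I\<close>, the length of the vector \<open>g\<close> appears on the
  right.\<close>

lemma fixed_interval_estimate:
  assumes f: "bdd_supp f" and g: "\<And>k. k \<in> {1..N} \<Longrightarrow> bdd_supp (g k)" and I: "ivl I" and X: "X \<subseteq> T"
    and \<theta>: "\<theta> \<in> borel_measurable borel" "\<And>x. \<theta> x \<ge> 0" "\<And>x. \<theta> x \<le> D"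
    and d: "\<And>k P. (k, P) \<in> X \<Longrightarrow> fst P = I \<Longrightarrow> 0 \<le> d k P \<and> d k P \<le> (LINT x|lborel. norm (g k x) * \<theta> x)"
  shows "(\<Sum>(k, P)\<in>{p \<in> X. fst (snd p) = I}. norm (L2_inner f (\<phi> P)) * d k P)
    \<le> sqrt (128 * C0\<^sup>2 * real n * Phi (\<lambda>x. (norm (f x))\<^sup>2) I) * (LINT x|lborel. l2_norm_fun N g x * \<theta> x)"
proof -
  let ?X = "{p \<in> X. fst (snd p) = I}" and ?l = "len I"
  let ?F = "\<lambda>p. norm (L2_inner f (\<phi> (snd p)))" and ?d = "\<lambda>p. d (fst p) (snd p)"
  have l: "?l > 0" by (rule ivlD(1)[OF I])
  have finX: "finite ?X" using finT X finite_subset by fastforce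
  let ?G = "\<lambda>k x. norm (g k x)"
  let ?L = "l2_norm_fun N g"
  have L: "?L x = L2_set (\<lambda>k. ?G k x) {1..N}" for x by (simp add: l2_norm_fun_def L2_set_def)
  have bG: "bdd_supp (?G k)" if "k \<in> {1..N}" for k using g[OF that] by (rule bdd_supp_norm)
  have iG: "integrable lborel (\<lambda>x. ?G k x * \<theta> x)" if "k \<in> {1..N}" for k
    by (intro bdd_supp_integrable bdd_supp_mult_bounded[OF bG[OF that] \<theta>(1), of D]) (use \<theta> in auto)
  have [measurable]: "\<theta> \<in> borel_measurable borel" by (rule \<theta>(1))
  have gm[measurable]: "g k \<in> borel_measurable borel" if "k \<in> {1..N}" for k using g[OF that] by (rule bdd_supp_measurable)
  have iL: "integrable lborel (\<lambda>x. L2_set (\<lambda>k. ?G k x) {1..N} * \<theta> x)"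
  proof (rule Bochner_Integration.integrable_bound)
    show "integrable lborel (\<lambda>x. \<Sum>k\<in>{1..N}. ?G k x * \<theta> x)"
      by (intro Bochner_Integration.integrable_sum iG)
    have "(\<lambda>x. \<Sum>k=1..N. (?G k x)\<^sup>2) \<in> borel_measurable borel"
      by (intro borel_measurable_sum borel_measurable_power bdd_supp_measurable[OF bG])
    from measurable_compose[OF this borel_measurable_continuous_onI[OF continuous_on_real_sqrt[OF continuous_on_id]]]
    have [measurable]: "(\<lambda>x. L2_set (\<lambda>k. ?G k x) {1..N}) \<in> borel_measurable borel"
      unfolding L2_set_def by simp
    thus "(\<lambda>x. L2_set (\<lambda>k. ?G k x) {1..N} * \<theta> x) \<in> borel_measurable lborel" by simp
    show "AE x in lborel. norm (L2_set (\<lambda>k. ?G k x) {1..N} * \<theta> x) \<le> norm (\<Sum>k\<in>{1..N}. ?G k x * \<theta> x)"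
    proof (rule AE_I2)
      fix x
      have "L2_set (\<lambda>k. ?G k x) {1..N} * \<theta> x \<le> (\<Sum>k\<in>{1..N}. ?G k x) * \<theta> x"
        by (intro mult_right_mono L2_set_le_sum \<theta>) auto
      thus "norm (L2_set (\<lambda>k. ?G k x) {1..N} * \<theta> x) \<le> norm (\<Sum>k\<in>{1..N}. ?G k x * \<theta> x)"
        using \<theta>(2)[of x] L2_set_nonneg[of "\<lambda>k. ?G k x" "{1..N}"] by (simp add: sum_distrib_right)
    qed
  qed
  let ?Y = "LINT x|lborel. ?L x * \<theta> x"
  have Y0: "?Y \<ge> 0" by (intro integral_nonneg_AE AE_I2) (use \<theta> L in \<open>simp add: L2_set_nonneg\<close>)
  define D' where "D' k = (LINT x|lborel. ?G k x * \<theta> x)" for k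
  have "(\<Sum>p\<in>?X. (?d p)\<^sup>2) \<le> (\<Sum>p\<in>?X. (D' (fst p))\<^sup>2)"
    unfolding D'_def using d by (intro sum_mono power_mono) auto
  also have "\<dots> = (\<Sum>k\<in>{1..N}. \<Sum>p\<in>{p\<in>?X. fst p = k}. (D' (fst p))\<^sup>2)"
    by (rule sum.group[symmetric, OF finX]) (use index X in auto)
  also have "\<dots> \<le> (\<Sum>k\<in>{1..N}. real n * (D' k)\<^sup>2)"
  proof (rule sum_mono)
    fix k
    have "card {p\<in>?X. fst p = k} \<le> card {P. (k, P) \<in> T \<and> fst P = I}"
    proof (rule card_inj_on_le[where f=snd])
      show "finite {P. (k, P) \<in> T \<and> fst P = I}"
        by (rule finite_subset[of _ "snd ` T"]) (use finT in force)+
    qed (use X in \<open>auto simp: inj_on_def\<close>)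
    hence c: "card {p\<in>?X. fst p = k} \<le> n" using mult[of k I] by simp
    have "(\<Sum>p\<in>{p\<in>?X. fst p = k}. (D' (fst p))\<^sup>2) = real (card {p\<in>?X. fst p = k}) * (D' k)\<^sup>2" by simp
    also have "\<dots> \<le> real n * (D' k)\<^sup>2" using c by (intro mult_right_mono) auto
    finally show "(\<Sum>p\<in>{p\<in>?X. fst p = k}. (D' (fst p))\<^sup>2) \<le> real n * (D' k)\<^sup>2" .
  qed
  also have "\<dots> = real n * (\<Sum>k\<in>{1..N}. (D' k)\<^sup>2)" by (simp add: sum_distrib_left)
  also have "\<dots> \<le> real n * ?Y\<^sup>2"
    unfolding D'_def L by (intro mult_left_mono minkowski_l2 iG iL \<theta>) auto
  finally have "(\<Sum>p\<in>?X. (?d p)\<^sup>2) \<le> real n * ?Y\<^sup>2" .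
  hence 1: "L2_set ?d ?X \<le> sqrt (real n) * ?Y"
  proof -
    have "sqrt (\<Sum>p\<in>?X. (?d p)\<^sup>2) \<le> sqrt (real n * ?Y\<^sup>2)"
      using \<open>(\<Sum>p\<in>?X. (?d p)\<^sup>2) \<le> real n * ?Y\<^sup>2\<close> by (rule real_sqrt_le_mono)
    thus ?thesis unfolding L2_set_def real_sqrt_mult using Y0 by simp
  qed
  have bf: "bdd_supp (\<lambda>x. (norm (f x))\<^sup>2)" by (rule bdd_supp_norm_square[OF f])
  have "(\<Sum>p\<in>?X. (?F p)\<^sup>2) \<le> (\<Sum>(k, P)\<in>{p \<in> T. fst (snd p) = I}. (norm (L2_inner f (\<phi> P)))\<^sup>2)"
    unfolding split_beta' using finT X by (intro sum_mono2) auto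
  also have "\<dots> \<le> (64 * C0\<^sup>2 / ?l) * (LINT x|lborel. (norm (f x))\<^sup>2 * (1 / wt (center I) ?l x ^ 8))"
    by (rule local_bessel[OF f I])
  also have "\<dots> \<le> (64 * C0\<^sup>2 / ?l) * (2 * ?l * Phi (\<lambda>x. (norm (f x))\<^sup>2) I)"
    using l by (intro mult_left_mono Phi_weighted[OF bf]) auto
  also have "\<dots> = 128 * C0\<^sup>2 * Phi (\<lambda>x. (norm (f x))\<^sup>2) I" using l by simp
  finally have 2: "L2_set ?F ?X \<le> sqrt (128 * C0\<^sup>2 * Phi (\<lambda>x. (norm (f x))\<^sup>2) I)"
    unfolding L2_set_def by (rule real_sqrt_le_mono)
  have "(\<Sum>(k, P)\<in>?X. norm (L2_inner f (\<phi> P)) * d k P) = (\<Sum>p\<in>?X. \<bar>?F p\<bar> * \<bar>?d p\<bar>)"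
    using d by (intro sum.cong) auto
  also have "\<dots> \<le> L2_set ?F ?X * L2_set ?d ?X" by (rule L2_set_mult_ineq)
  also have "\<dots> \<le> sqrt (128 * C0\<^sup>2 * Phi (\<lambda>x. (norm (f x))\<^sup>2) I) * (sqrt (real n) * ?Y)"
    by (intro mult_mono 1 2 L2_set_nonneg) (use Phi_nonneg[OF bf _ l] in simp)
  finally show ?thesis by (simp add: real_sqrt_mult mult_ac)
qed

end

section \<open>The estimate below a stopping interval\<close>

text \<open>Decay from \<open>I\<close> to the two endpoints of \<open>J\<close>: the gain available
  when a piece of a function and the centre of \<open>I\<close> lie on different sides of the
  boundary of \<open>J\<close>. Multiplied by \<open>len I\<close> it is summable over the short
  intervals of a grid.\<close>

definition edge :: "real set \<Rightarrow> real set \<Rightarrow> real"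
  where "edge I J = 1 / (wt (center I) (len I) (center J - len J / 2))\<^sup>2
    + 1 / (wt (center I) (len I) (center J + len J / 2))\<^sup>2"

text \<open>One endpoint of \<open>J\<close> is at most as far from \<open>center I\<close> as
  \<open>x\<close>, because the boundary is crossed on the way.\<close>

lemma edge_separates:
  assumes I: "ivl I" and J: "ivl J"
    and sep: "center I \<notin> J \<and> x \<in> J \<or> center I \<in> J \<and> x \<notin> J"
  shows "1 / (wt (center I) (len I) x)\<^sup>2 \<le> edge I J"
proof -
  let ?c = "center I" and ?l = "len I" and ?\<alpha> = "center J - len J / 2" and ?\<beta> = "center J + len J / 2"
  have l: "?l > 0" by (rule ivlD(1)[OF I])
  have mem: "y \<in> J \<longleftrightarrow> ?\<alpha> \<le> y \<and> y < ?\<beta>" for y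
    by (subst ivlD(7)[OF J]) simp
  have "\<bar>?\<alpha> - ?c\<bar> \<le> \<bar>x - ?c\<bar> \<or> \<bar>?\<beta> - ?c\<bar> \<le> \<bar>x - ?c\<bar>"
    using sep unfolding mem by linarith
  hence "wt ?c ?l ?\<alpha> \<le> wt ?c ?l x \<or> wt ?c ?l ?\<beta> \<le> wt ?c ?l x"
    using l by (auto simp: wt_def divide_right_mono)
  moreover have le: "1 / (wt ?c ?l x)\<^sup>2 \<le> 1 / (wt ?c ?l y)\<^sup>2" if "wt ?c ?l y \<le> wt ?c ?l x" for y
    using that wt_pos[OF l, of ?c y] wt_pos[OF l, of ?c x] by (intro divide_left_mono power_mono) auto
  moreover have "0 \<le> 1 / (wt ?c ?l y)\<^sup>2" for y by simp
  ultimately show ?thesis unfolding edge_def by (smt (verit, best))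
qed

lemma edge_nonneg: "edge I J \<ge> 0"
  by (simp add: edge_def)

lemma edge_sum_le:
  assumes F: "finite F" "F \<subseteq> shifted_dyadic s" and le: "\<And>I. I \<in> F \<Longrightarrow> len I \<le> len J" and J: "J \<in> shifted_dyadic s"
  shows "(\<Sum>I\<in>F. len I * edge I J) \<le> 16 * len J"
proof -
  obtain k where k: "len J = 2 powi k" using grid_ivl[OF J] by blast
  have "(\<Sum>I\<in>F. len I * edge I J) =
     (\<Sum>I\<in>F. len I * (1 / (wt (center I) (len I) (center J - len J / 2))\<^sup>2)) +
     (\<Sum>I\<in>F. len I * (1 / (wt (center I) (len I) (center J + len J / 2))\<^sup>2))"
    by (simp add: edge_def distrib_left sum.distrib)
  also have "\<dots> \<le> 8 * 2 powi k + 8 * 2 powi k"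
    by (intro add_mono grid_sum_small_le[OF F]) (use le k in auto)
  finally show ?thesis by (simp add: k)
qed

text \<open>Two powers of the weight pay for \<open>E\<close>; the others, at least 5, are what
  \<open>Phi_weighted\<close> requires.\<close>

lemma separated_weighted:
  assumes h: "bdd_supp h" "\<And>x. h x \<ge> 0" and I: "ivl I" and S: "S \<in> sets borel" and n: "n \<ge> 7"
    and sep: "\<And>x. x \<in> S \<Longrightarrow> 1 / (wt (center I) (len I) x)\<^sup>2 \<le> E" and E: "E \<ge> 0"
  shows "(LINT x|lborel. (indicator S x * h x) * (1 / wt (center I) (len I) x ^ n)) \<le> E * (2 * len I * Phi h I)"
proof -
  let ?w = "wt (center I) (len I)"
  have l: "len I > 0" by (rule ivlD(1)[OF I])
  have "(LINT x|lborel. (indicator S x * h x) * (1 / ?w x ^ n)) \<le> (LINT x|lborel. E * (h x * (1 / ?w x ^ 5)))"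
  proof (rule integral_mono)
    show "integrable lborel (\<lambda>x. (indicator S x * h x) * (1 / ?w x ^ n))"
      using weighted_integrable[OF bdd_supp_indicator[OF h(1) S] _ l, of n] h(2) by (auto simp: indicator_def)
    show "integrable lborel (\<lambda>x. E * (h x * (1 / ?w x ^ 5)))"
      by (intro integrable_mult_right weighted_integrable[OF h l])
    fix x
    show "(indicator S x * h x) * (1 / ?w x ^ n) \<le> E * (h x * (1 / ?w x ^ 5))"
    proof (cases "x \<in> S")
      case True
      have "1 / ?w x ^ n \<le> 1 / ?w x ^ 7" by (rule wt_power_antimono[OF l n])
      also have "\<dots> = (1 / (?w x)\<^sup>2) * (1 / ?w x ^ 5)" by (simp add: power_add[symmetric])
      also have "\<dots> \<le> E * (1 / ?w x ^ 5)"
        using sep[OF True] wt_pos[OF l, of "center I" x] by (intro mult_right_mono) auto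
      finally have "h x * (1 / ?w x ^ n) \<le> h x * (E * (1 / ?w x ^ 5))" by (rule mult_left_mono) (rule h(2))
      thus ?thesis using True by (simp add: mult_ac)
    next
      case False
      thus ?thesis using E h(2)[of x] wt_pos[OF l, of "center I" x] by simp
    qed
  qed
  also have "\<dots> = E * (LINT x|lborel. h x * (1 / ?w x ^ 5))" by (rule integral_mult_right_zero)
  also have "\<dots> \<le> E * (2 * len I * Phi h I)" by (intro mult_left_mono Phi_weighted[OF h l] E) simp
  finally show ?thesis .
qed

lemma separated_kernel:
  assumes I: "ivl I" and S: "S \<in> sets borel"
    and sep: "\<And>x. x \<in> S \<Longrightarrow> 1 / (wt (center I) (len I) x)\<^sup>2 \<le> E" and E: "E \<ge> 0"
  shows "(LINT x|lborel. indicator S x * (1 / wt (center I) (len I) x ^ 10)) \<le> E * (4 * len I)"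
proof -
  let ?w = "wt (center I) (len I)"
  have l: "len I > 0" by (rule ivlD(1)[OF I])
  have i: "integrable lborel (\<lambda>x. 1 / ?w x ^ n)" if "n \<ge> 2" for n by (rule wt_integrable(1)[OF l that])
  have "(LINT x|lborel. indicator S x * (1 / ?w x ^ 10)) \<le> (LINT x|lborel. E * (1 / ?w x ^ 8))"
  proof (rule integral_mono)
    show "integrable lborel (\<lambda>x. indicator S x * (1 / ?w x ^ 10))"
      using integrable_real_mult_indicator[of S lborel "\<lambda>x. 1 / ?w x ^ 10"] S i[of 10] by (simp add: mult.commute)
    show "integrable lborel (\<lambda>x. E * (1 / ?w x ^ 8))" using i[of 8] by (intro integrable_mult_right) auto
    fix x
    have w: "?w x > 0" by (rule wt_pos[OF l])
    show "indicator S x * (1 / ?w x ^ 10) \<le> E * (1 / ?w x ^ 8)"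
    proof (cases "x \<in> S")
      case True
      have "1 / ?w x ^ 10 = (1 / (?w x)\<^sup>2) * (1 / ?w x ^ 8)" by (simp add: power_add[symmetric])
      also have "\<dots> \<le> E * (1 / ?w x ^ 8)" using sep[OF True] w by (intro mult_right_mono) auto
      finally show ?thesis using True by simp
    qed (use E w in simp)
  qed
  also have "\<dots> = E * (LINT x|lborel. 1 / ?w x ^ 8)" by (rule integral_mult_right_zero)
  also have "\<dots> \<le> E * (4 * len I)" by (intro mult_left_mono wt_integrable(2)[OF l] E) simp
  finally show ?thesis .
qed

lemma bdd_supp_l2_norm:
  assumes g: "\<And>k. k \<in> {1..N} \<Longrightarrow> bdd_supp (g k)"
  shows "bdd_supp (l2_norm_fun N g)"
proof (rule bdd_supp_dominated[where C=1])
  show "bdd_supp (\<lambda>x. \<Sum>k=1..N. norm (g k x))" by (intro bdd_supp_sum bdd_supp_norm g)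
  have "(\<lambda>x. \<Sum>k=1..N. (norm (g k x))\<^sup>2) \<in> borel_measurable borel"
    by (intro borel_measurable_sum bdd_supp_measurable[OF bdd_supp_norm_square[OF g]])
  from measurable_compose[OF this borel_measurable_continuous_onI[OF continuous_on_real_sqrt[OF continuous_on_id]]]
  show "l2_norm_fun N g \<in> borel_measurable borel" by (simp add: l2_norm_fun_def[abs_def])
  fix x
  have "L2_set (\<lambda>k. norm (g k x)) {1..N} \<le> (\<Sum>k=1..N. norm (g k x))" by (rule L2_set_le_sum) auto
  thus "norm (l2_norm_fun N g x) \<le> 1 * norm (\<Sum>k=1..N. norm (g k x))"
    by (simp add: l2_norm_fun_def L2_set_def sum_nonneg)
qed

text \<open>\<open>X\<close> consists of the tiles assigned to the stopping interval
  \<open>R\<close>. The scale \<open>\<kappa>\<close> bounds the tile intervals from below and keeps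
  the decomposition of \<open>R\<close> finite. In \<open>nonstop\<close> all grid intervals between
  a tile and \<open>R\<close> are tested, because the stopping intervals inside \<open>R\<close> are
  chosen among all grid intervals.\<close>

locale stopped_packets = packet_family +
  fixes f :: "real \<Rightarrow> complex" and g :: "nat \<Rightarrow> real \<Rightarrow> complex" and R :: "real set" and X :: "(nat \<times> tile) set"
    and \<kappa> :: int
  assumes f: "bdd_supp f" and g: "k \<in> {1..N} \<Longrightarrow> bdd_supp (g k)"
    and R: "R \<in> shifted_dyadic 0" and R\<kappa>: "2 powi \<kappa> \<le> len R" and X: "X \<subseteq> T"
    and below: "(k, P) \<in> X \<Longrightarrow> fst P \<subseteq> R \<and> 2 powi \<kappa> \<le> len (fst P)"
    and nonstop: "(k, P) \<in> X \<Longrightarrow> J \<in> shifted_dyadic 0 \<Longrightarrow> fst P \<subseteq> J \<Longrightarrow> J \<subseteq> R \<Longrightarrow>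
      Phi (\<lambda>x. (norm (f x))\<^sup>2) J \<le> 320 * Phi (\<lambda>x. (norm (f x))\<^sup>2) R
      \<and> Phi (l2_norm_fun N g) J \<le> 320 * Phi (l2_norm_fun N g) R"
begin

abbreviation "f2 \<equiv> \<lambda>x. (norm (f x))\<^sup>2"
abbreviation "L \<equiv> l2_norm_fun N g"
abbreviation "\<Gamma> \<equiv> Phi L R"
abbreviation "\<Psi> \<equiv> Phi f2 R"

text \<open>The factor of \<open>fixed_interval_estimate\<close>, made uniform over the intervals
  assigned to \<open>R\<close>: 40960 = 128 * 320, since \<open>Phi f2\<close> grows at most 320
  times below \<open>R\<close>.\<close>

definition "\<F> = sqrt (40960 * C0\<^sup>2 * real n * \<Psi>)"
definition "\<I> = (fst \<circ> snd) ` X"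

lemma ivR: "ivl R" by (rule grid_is_ivl[OF R])
lemma lR: "len R > 0" by (rule ivlD(1)[OF ivR])
lemma bf2: "bdd_supp f2" by (rule bdd_supp_norm_square[OF f])
lemma bL: "bdd_supp L" by (rule bdd_supp_l2_norm[OF g])
lemma L0: "L x \<ge> 0" by (simp add: l2_norm_fun_def sum_nonneg)
lemma \<Gamma>0: "\<Gamma> \<ge> 0" by (rule Phi_nonneg[OF bL L0 lR])
lemma \<Psi>0: "\<Psi> \<ge> 0" by (rule Phi_nonneg[OF bf2 _ lR]) simp
lemma finX: "finite X" using X finT finite_subset by blast
lemma fin\<I>: "finite \<I>" by (simp add: \<I>_def finX)
lemma \<F>0: "\<F> \<ge> 0" using \<Psi>0 by (simp add: \<F>_def)

lemma \<I>D:
  assumes "I \<in> \<I>"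
  shows "I \<in> shifted_dyadic 0" "ivl I" "I \<subseteq> R" "2 powi \<kappa> \<le> len I" "Phi f2 I \<le> 320 * \<Psi>" "Phi L I \<le> 320 * \<Gamma>" "len I > 0"
    "len I \<le> len R"
proof -
  obtain k P where p: "(k, P) \<in> X" "I = fst P" using assms by (auto simp: \<I>_def)
  show 1: "I \<in> shifted_dyadic 0" using dyadic p X by blast
  thus 2: "ivl I" by (rule grid_is_ivl)
  show 3: "I \<subseteq> R" "2 powi \<kappa> \<le> len I" using below p by auto
  show "Phi f2 I \<le> 320 * \<Psi>" "Phi L I \<le> 320 * \<Gamma>" using nonstop[OF p(1), of I] 1 3 p by auto
  show "len I > 0" by (rule ivlD(1)[OF 2])
  show "len I \<le> len R" using ivlD(4)[OF 2] ivlD(5)[OF ivR] 3 by (intro measure_mono_fmeasurable) auto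
qed

text \<open>The contribution of \<open>f\<close> at each interval is at most \<open>\<F>\<close>, so
  every estimate with pairings of \<open>g\<close> majorized in this way reduces to a sum over
  intervals alone.\<close>

lemma tiles_sum_le:
  assumes \<theta>: "\<And>I. I \<in> \<I> \<Longrightarrow> \<theta> I \<in> borel_measurable borel" "\<And>I x. I \<in> \<I> \<Longrightarrow> \<theta> I x \<ge> 0"
      "\<And>I. I \<in> \<I> \<Longrightarrow> \<exists>D. \<forall>x. \<theta> I x \<le> D"
    and d: "\<And>k P. (k, P) \<in> X \<Longrightarrow> 0 \<le> d k P \<and> d k P \<le> (LINT x|lborel. norm (g k x) * \<theta> (fst P) x)"
  shows "(\<Sum>(k, P)\<in>X. len (fst P) * norm (L2_inner f (\<phi> P)) * d k P)
    \<le> \<F> * (\<Sum>I\<in>\<I>. len I * (LINT x|lborel. L x * \<theta> I x))"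
proof -
  have "(\<Sum>(k, P)\<in>X. len (fst P) * norm (L2_inner f (\<phi> P)) * d k P) =
     (\<Sum>I\<in>\<I>. \<Sum>(k, P)\<in>{p \<in> X. (fst \<circ> snd) p = I}. len (fst P) * norm (L2_inner f (\<phi> P)) * d k P)"
    unfolding \<I>_def by (rule sum.image_gen[OF finX])
  also have "\<dots> = (\<Sum>I\<in>\<I>. len I * (\<Sum>(k, P)\<in>{p \<in> X. fst (snd p) = I}. norm (L2_inner f (\<phi> P)) * d k P))"
    unfolding sum_distrib_left by (intro sum.cong refl) (auto simp: mult.assoc)
  also have "\<dots> \<le> (\<Sum>I\<in>\<I>. len I * (\<F> * (LINT x|lborel. L x * \<theta> I x)))"
  proof (rule sum_mono)
    fix I assume I: "I \<in> \<I>"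
    obtain D where D: "\<And>x. \<theta> I x \<le> D" using \<theta>(3)[OF I] by blast
    have "(\<Sum>(k, P)\<in>{p \<in> X. fst (snd p) = I}. norm (L2_inner f (\<phi> P)) * d k P)
      \<le> sqrt (128 * C0\<^sup>2 * real n * Phi f2 I) * (LINT x|lborel. L x * \<theta> I x)"
      by (rule fixed_interval_estimate[OF f g \<I>D(2)[OF I] X \<theta>(1,2)[OF I] D]) (use d in auto)
    also have "\<dots> \<le> \<F> * (LINT x|lborel. L x * \<theta> I x)"
    proof (rule mult_right_mono)
      have "128 * C0\<^sup>2 * real n * Phi f2 I \<le> 128 * C0\<^sup>2 * real n * (320 * \<Psi>)"
        by (intro mult_left_mono \<I>D(5)[OF I]) auto
      thus "sqrt (128 * C0\<^sup>2 * real n * Phi f2 I) \<le> \<F>" unfolding \<F>_def by (intro real_sqrt_le_mono) simp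
      show "0 \<le> (LINT x|lborel. L x * \<theta> I x)"
        by (intro integral_nonneg_AE AE_I2) (simp add: L0 \<theta>(2)[OF I])
    qed
    finally show "len I * (\<Sum>(k, P)\<in>{p \<in> X. fst (snd p) = I}. norm (L2_inner f (\<phi> P)) * d k P)
       \<le> len I * (\<F> * (LINT x|lborel. L x * \<theta> I x))"
      using \<I>D(7)[OF I] by (intro mult_left_mono) auto
  qed
  also have "\<dots> = \<F> * (\<Sum>I\<in>\<I>. len I * (LINT x|lborel. L x * \<theta> I x))"
    by (simp add: sum_distrib_left mult_ac)
  finally show ?thesis .
qed

definition "ker I x = (C0 / len I) * (1 / wt (center I) (len I) x ^ 10)"

lemma ker_nonneg: "I \<in> \<I> \<Longrightarrow> ker I x \<ge> 0"
  using \<I>D(7)[of I] C0 wt_pos[of "len I" "center I" x] by (simp add: ker_def)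

lemma ker_measurable [measurable]: "ker I \<in> borel_measurable borel"
  unfolding ker_def by measurable

lemma ker_le: "I \<in> \<I> \<Longrightarrow> ker I x \<le> C0 / len I"
proof -
  assume I: "I \<in> \<I>"
  have "1 / wt (center I) (len I) x ^ 10 \<le> 1 / wt (center I) (len I) x ^ 0"
    by (rule wt_power_antimono[OF \<I>D(7)[OF I]]) simp
  hence "ker I x \<le> (C0 / len I) * 1"
    unfolding ker_def using \<I>D(7)[OF I] C0 by (intro mult_left_mono) auto
  thus ?thesis by simp
qed

lemma ker_integrable: "I \<in> \<I> \<Longrightarrow> integrable lborel (ker I)"
  unfolding ker_def by (intro integrable_mult_right wt_integrable(1) \<I>D(7)) auto

lemma packet_le_ker: "(k, P) \<in> X \<Longrightarrow> norm (\<phi> P x) \<le> ker (fst P) x"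
proof -
  assume "(k, P) \<in> X"
  hence "(k, P) \<in> T" using X by blast
  from size[OF this, of x] show ?thesis by (simp add: ker_def)
qed

lemma L_ker_separated:
  assumes I: "I \<in> \<I>" and S: "S \<in> sets borel"
    and sep: "\<And>x. x \<in> S \<Longrightarrow> 1 / (wt (center I) (len I) x)\<^sup>2 \<le> E" and E: "E \<ge> 0"
  shows "(LINT x|lborel. L x * (indicator S x * ker I x)) \<le> 640 * C0 * \<Gamma> * E"
proof -
  have "(LINT x|lborel. L x * (indicator S x * ker I x)) = (C0 / len I) * (LINT x|lborel. (indicator S x * L x) * (1 / wt (center I) (len I) x ^ 10))"
    unfolding ker_def integral_mult_right_zero[symmetric] by (simp add: mult_ac)
  also have "\<dots> \<le> (C0 / len I) * (E * (2 * len I * Phi L I))"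
    using \<I>D(7)[OF I] C0 by (intro mult_left_mono separated_weighted[OF bL L0 \<I>D(2)[OF I] S _ sep E]) auto
  also have "\<dots> = 2 * C0 * E * Phi L I" using \<I>D(7)[OF I] by simp
  also have "\<dots> \<le> 2 * C0 * E * (320 * \<Gamma>)" using C0 E by (intro mult_left_mono \<I>D(6)[OF I]) auto
  finally show ?thesis by (simp add: mult_ac)
qed

lemma outside_edge:
  assumes I: "I \<in> \<I>" and x: "x \<notin> R"
  shows "1 / (wt (center I) (len I) x)\<^sup>2 \<le> edge I R"
  using edge_separates[OF \<I>D(2)[OF I] ivR] ivlD(2)[OF \<I>D(2)[OF I]] \<I>D(3)[OF I] x by blast

lemma compl_R: "- R \<in> sets borel"
  using ivlD(4)[OF ivR] by simp

text \<open>The intervals lie in \<open>R\<close> and the functions outside, so every term gains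
  \<open>edge I R\<close>, and by \<open>edge_sum_le\<close> the weighted gains add up to
  \<open>16 * len R\<close>; 10240 = 640 * 16.\<close>

lemma outside_estimate:
  "(\<Sum>(k, P)\<in>X. len (fst P) * norm (L2_inner f (\<phi> P)) * norm (L2_inner (\<lambda>x. indicator (- R) x * g k x) (\<phi> P)))
    \<le> 10240 * C0 * \<F> * \<Gamma> * len R"
proof -
  have [measurable]: "- R \<in> sets borel" by (rule compl_R)
  let ?\<theta> = "\<lambda>I x. indicator (- R) x * ker I x"
  have "(\<Sum>(k, P)\<in>X. len (fst P) * norm (L2_inner f (\<phi> P)) * norm (L2_inner (\<lambda>x. indicator (- R) x * g k x) (\<phi> P)))
    \<le> \<F> * (\<Sum>I\<in>\<I>. len I * (LINT x|lborel. L x * ?\<theta> I x))"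
  proof (rule tiles_sum_le)
    fix I assume I: "I \<in> \<I>"
    show "?\<theta> I \<in> borel_measurable borel" by measurable
    show "?\<theta> I x \<ge> 0" for x using ker_nonneg[OF I] by simp
    show "\<exists>D. \<forall>x. ?\<theta> I x \<le> D"
      using ker_le[OF I] C0 \<I>D(7)[OF I] by (intro exI[of _ "C0 / len I"]) (auto simp: indicator_def)
  next
    fix k P assume p: "(k, P) \<in> X"
    have pI: "fst P \<in> \<I>" using p by (force simp: \<I>_def)
    have k: "k \<in> {1..N}" using p X index by blast
    have pT: "(k, P) \<in> T" using p X by blast
    have bg: "bdd_supp (\<lambda>x. indicator (- R) x * g k x)" by (rule bdd_supp_indicator[OF g[OF k] compl_R])
    have "norm (L2_inner (\<lambda>x. indicator (- R) x * g k x) (\<phi> P)) \<le> (LINT x|lborel. norm (g k x) * ?\<theta> (fst P) x)"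
      unfolding L2_inner_def
    proof (rule Bochner_Integration.integral_norm_bound_integral[OF packet_pairing_integrable[OF pT bg]])
      show "integrable lborel (\<lambda>x. norm (g k x) * ?\<theta> (fst P) x)"
        using ker_le[OF pI] ker_nonneg[OF pI] C0 \<I>D(7)[OF pI]
        by (intro bdd_supp_integrable bdd_supp_mult_bounded[OF bdd_supp_norm[OF g[OF k]], of _ "C0 / len (fst P)"]) (measurable, auto simp: indicator_def)
      show "norm (indicator (- R) x * g k x * cnj (\<phi> P x)) \<le> norm (g k x) * ?\<theta> (fst P) x" for x
        using packet_le_ker[OF p, of x] by (auto simp: norm_mult indicator_def intro!: mult_left_mono)
    qed
    thus "0 \<le> norm (L2_inner (\<lambda>x. indicator (- R) x * g k x) (\<phi> P)) \<and>
      norm (L2_inner (\<lambda>x. indicator (- R) x * g k x) (\<phi> P)) \<le> (LINT x|lborel. norm (g k x) * ?\<theta> (fst P) x)" by simp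
  qed
  also have "\<dots> \<le> \<F> * (\<Sum>I\<in>\<I>. len I * (640 * C0 * \<Gamma> * edge I R))"
    by (intro mult_left_mono sum_mono L_ker_separated compl_R edge_nonneg \<F>0)
      (use \<I>D(7) outside_edge in \<open>auto simp: less_imp_le\<close>)
  also have "\<dots> = \<F> * (640 * C0 * \<Gamma> * (\<Sum>I\<in>\<I>. len I * edge I R))"
    unfolding sum_distrib_left by (intro sum.cong refl) (simp only: mult_ac)
  also have "\<dots> \<le> \<F> * (640 * C0 * \<Gamma> * (16 * len R))"
    by (intro mult_left_mono edge_sum_le[OF fin\<I> _ _ R] mult_nonneg_nonneg) (use \<F>0 \<Gamma>0 C0 \<I>D in auto)
  finally show ?thesis by (simp add: mult_ac)
qed

text \<open>The part of \<open>f\<close> inside \<open>R\<close> is paired by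
  \<open>global_bessel\<close>, the part outside by \<open>local_bessel\<close> at each interval,
  where the gain \<open>edge I R\<close> makes the sum over intervals converge. 1310752 = 2 * 16 + 2
  * 64 * 640 * 16, the factors 2 coming from the square of a sum of two terms.\<close>

lemma f_square_sum:
  "(\<Sum>(k, P)\<in>X. len (fst P) * (norm (L2_inner f (\<phi> P)))\<^sup>2) \<le> 1310752 * C0\<^sup>2 * \<Psi> * len R"
proof -
  let ?f1 = "\<lambda>x. indicator R x * f x" and ?f2 = "\<lambda>x. indicator (- R) x * f x"
  have [measurable]: "R \<in> sets borel" by (rule ivlD(4)[OF ivR])
  have b1: "bdd_supp ?f1" and b2: "bdd_supp ?f2" by (rule bdd_supp_indicator[OF f], simp)+
  have split: "L2_inner f (\<phi> P) = L2_inner ?f1 (\<phi> P) + L2_inner ?f2 (\<phi> P)" if "(k, P) \<in> X" for k P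
  proof -
    have pT: "(k, P) \<in> T" using that X by blast
    have "f x * cnj (\<phi> P x) = ?f1 x * cnj (\<phi> P x) + ?f2 x * cnj (\<phi> P x)" for x by (auto simp: indicator_def)
    thus ?thesis unfolding L2_inner_def
      by (simp only: Bochner_Integration.integral_add[OF packet_pairing_integrable[OF pT b1] packet_pairing_integrable[OF pT b2]])
  qed
  have "(\<Sum>(k, P)\<in>X. len (fst P) * (norm (L2_inner f (\<phi> P)))\<^sup>2) \<le>
    (\<Sum>(k, P)\<in>X. 2 * (len (fst P) * (norm (L2_inner ?f1 (\<phi> P)))\<^sup>2) + 2 * (len (fst P) * (norm (L2_inner ?f2 (\<phi> P)))\<^sup>2))"
  proof (rule sum_mono, clarsimp)
    fix k A W assume p: "(k, A, W) \<in> X"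
    let ?u = "L2_inner ?f1 (\<phi> (A, W))" and ?v = "L2_inner ?f2 (\<phi> (A, W))"
    have "(norm (?u + ?v))\<^sup>2 \<le> (norm ?u + norm ?v)\<^sup>2" by (intro power_mono norm_triangle_ineq) auto
    also have "\<dots> \<le> 2 * (norm ?u)\<^sup>2 + 2 * (norm ?v)\<^sup>2"
      using zero_le_power2[of "norm ?u - norm ?v"] by (simp add: power2_eq_square algebra_simps)
    finally have "len A * (norm (?u + ?v))\<^sup>2 \<le> len A * (2 * (norm ?u)\<^sup>2 + 2 * (norm ?v)\<^sup>2)"
      by (rule mult_left_mono) simp
    thus "len A * (norm (L2_inner f (\<phi> (A, W))))\<^sup>2 \<le> 2 * (len A * (norm ?u)\<^sup>2) + 2 * (len A * (norm ?v)\<^sup>2)"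
      using split[OF p] by (simp add: distrib_left)
  qed
  also have "\<dots> = 2 * (\<Sum>(k, P)\<in>X. len (fst P) * (norm (L2_inner ?f1 (\<phi> P)))\<^sup>2) +
      2 * (\<Sum>(k, P)\<in>X. len (fst P) * (norm (L2_inner ?f2 (\<phi> P)))\<^sup>2)"
    by (simp add: sum.distrib sum_distrib_left split_beta')
  finally have A: "(\<Sum>(k, P)\<in>X. len (fst P) * (norm (L2_inner f (\<phi> P)))\<^sup>2) \<le>
      2 * (\<Sum>(k, P)\<in>X. len (fst P) * (norm (L2_inner ?f1 (\<phi> P)))\<^sup>2) +
      2 * (\<Sum>(k, P)\<in>X. len (fst P) * (norm (L2_inner ?f2 (\<phi> P)))\<^sup>2)" .
  have A1: "(\<Sum>(k, P)\<in>X. len (fst P) * (norm (L2_inner ?f1 (\<phi> P)))\<^sup>2) \<le> 16 * C0\<^sup>2 * (len R * \<Psi>)"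
  proof -
    have "(\<Sum>(k, P)\<in>X. len (fst P) * (norm (L2_inner ?f1 (\<phi> P)))\<^sup>2) \<le> 16 * C0\<^sup>2 * (LINT x|lborel. (norm (?f1 x))\<^sup>2)"
      by (rule global_bessel[OF b1 X])
    also have "(LINT x|lborel. (norm (?f1 x))\<^sup>2) = (LINT x|lborel. indicator R x * f2 x)"
      by (intro Bochner_Integration.integral_cong) (auto simp: indicator_def)
    also have "\<dots> \<le> ball_int f2 (center R) (real 1 * len R)"
    proof (rule indicator_integral_le_ball_int[OF bf2])
      show "R \<subseteq> {center R - real 1 * len R..center R + real 1 * len R}"
      proof
        fix x assume "x \<in> R"
        from ivlD(3)[OF ivR this] have "center R - len R \<le> x \<and> x \<le> center R + len R" using lR by linarith
        thus "x \<in> {center R - real 1 * len R..center R + real 1 * len R}" by simp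
      qed
    qed auto
    also have "\<dots> \<le> real 1 ^ 3 * len R * \<Psi>" by (intro Phi_upper bf2 lR) auto
    finally show ?thesis using C0 by (simp add: mult_left_mono)
  qed
  have A2: "(\<Sum>(k, P)\<in>X. len (fst P) * (norm (L2_inner ?f2 (\<phi> P)))\<^sup>2) \<le> 64 * C0\<^sup>2 * (640 * \<Psi>) * (16 * len R)"
  proof -
    have "(\<Sum>(k, P)\<in>X. len (fst P) * (norm (L2_inner ?f2 (\<phi> P)))\<^sup>2) =
      (\<Sum>I\<in>\<I>. \<Sum>(k, P)\<in>{p \<in> X. (fst \<circ> snd) p = I}. len (fst P) * (norm (L2_inner ?f2 (\<phi> P)))\<^sup>2)"
      unfolding \<I>_def by (rule sum.image_gen[OF finX])
    also have "\<dots> \<le> (\<Sum>I\<in>\<I>. len I * (64 * C0\<^sup>2 * (640 * \<Psi>) * edge I R))"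
    proof (rule sum_mono)
      fix I assume I: "I \<in> \<I>"
      note l = \<I>D(7)[OF I]
      have "(\<Sum>(k, P)\<in>{p \<in> X. (fst \<circ> snd) p = I}. len (fst P) * (norm (L2_inner ?f2 (\<phi> P)))\<^sup>2) =
        len I * (\<Sum>(k, P)\<in>{p \<in> X. fst (snd p) = I}. (norm (L2_inner ?f2 (\<phi> P)))\<^sup>2)"
        unfolding sum_distrib_left by (intro sum.cong) auto
      also have "\<dots> \<le> len I * (\<Sum>(k, P)\<in>{p \<in> T. fst (snd p) = I}. (norm (L2_inner ?f2 (\<phi> P)))\<^sup>2)"
        using l X finT by (intro mult_left_mono sum_mono2) auto
      also have "\<dots> \<le> len I * ((64 * C0\<^sup>2 / len I) * (LINT x|lborel. (norm (?f2 x))\<^sup>2 * (1 / wt (center I) (len I) x ^ 8)))"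
        using l by (intro mult_left_mono local_bessel[OF b2 \<I>D(2)[OF I]]) auto
      also have "(LINT x|lborel. (norm (?f2 x))\<^sup>2 * (1 / wt (center I) (len I) x ^ 8)) =
         (LINT x|lborel. (indicator (- R) x * f2 x) * (1 / wt (center I) (len I) x ^ 8))"
        by (intro Bochner_Integration.integral_cong) (auto simp: indicator_def)
      also have "len I * ((64 * C0\<^sup>2 / len I) * \<dots>) \<le> len I * ((64 * C0\<^sup>2 / len I) * (edge I R * (2 * len I * Phi f2 I)))"
        using l by (intro mult_left_mono separated_weighted[OF bf2 _ \<I>D(2)[OF I] compl_R _ outside_edge[OF I] edge_nonneg]) auto
      also have "\<dots> \<le> len I * ((64 * C0\<^sup>2 / len I) * (edge I R * (2 * len I * (320 * \<Psi>))))"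
        using l edge_nonneg by (intro mult_left_mono \<I>D(5)[OF I]) auto
      also have "\<dots> = len I * (64 * C0\<^sup>2 * (640 * \<Psi>) * edge I R)" using l by simp
      finally show "(\<Sum>(k, P)\<in>{p \<in> X. (fst \<circ> snd) p = I}. len (fst P) * (norm (L2_inner ?f2 (\<phi> P)))\<^sup>2) \<le>
        len I * (64 * C0\<^sup>2 * (640 * \<Psi>) * edge I R)" .
    qed
    also have "\<dots> = 64 * C0\<^sup>2 * (640 * \<Psi>) * (\<Sum>I\<in>\<I>. len I * edge I R)"
      unfolding sum_distrib_left by (intro sum.cong refl) (simp only: mult_ac)
    also have "\<dots> \<le> 64 * C0\<^sup>2 * (640 * \<Psi>) * (16 * len R)"
      by (intro mult_left_mono edge_sum_le[OF fin\<I> _ _ R] mult_nonneg_nonneg) (use \<Psi>0 \<I>D in auto)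
    finally show ?thesis .
  qed
  have "2 * (16 * C0\<^sup>2 * (len R * \<Psi>)) + 2 * (64 * C0\<^sup>2 * (640 * \<Psi>) * (16 * len R)) = 1310752 * C0\<^sup>2 * \<Psi> * len R"
    by algebra
  thus ?thesis using A A1 A2 by linarith
qed

end

section \<open>Good and bad parts of \<open>g\<close> on the stopping intervals inside
  \<open>R\<close>\<close>

lemma grid_laminar: "3 * s \<in> \<int> \<Longrightarrow> laminar (shifted_dyadic s)"
  unfolding laminar_def using grid_nested[of s] by (metis Int_commute linear)

lemma sum_indicator_disjoint:
  fixes c :: "'b set \<Rightarrow> 'a::{comm_semiring_1}"
  assumes "finite \<J>" "disjoint \<J>" "J0 \<in> \<J>" "x \<in> J0"
  shows "(\<Sum>J\<in>\<J>. indicator J x * c J) = c J0"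
proof -
  have "indicator J x * c J = (if J = J0 then c J else 0)" if "J \<in> \<J>" for J
    using assms that by (auto simp: disjoint_def pairwise_def indicator_def disjnt_def)
  hence "(\<Sum>J\<in>\<J>. indicator J x * c J) = (\<Sum>J\<in>\<J>. if J = J0 then c J else 0)" by (rule sum.cong[OF refl])
  thus ?thesis using assms by simp
qed

lemma sum_pairs_distrib:
  fixes u w :: "'a \<Rightarrow> 'b \<Rightarrow> real"
  shows "(\<Sum>(k, P)\<in>X. u k P + (\<Sum>J\<in>A. v J k P) + w k P) =
    (\<Sum>(k, P)\<in>X. u k P) + (\<Sum>J\<in>A. \<Sum>(k, P)\<in>X. v J k P) + (\<Sum>(k, P)\<in>X. w k P)"
  by (simp add: split_beta' sum.distrib sum.swap[of _ A X])

lemma norm_set_average_le: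
  fixes h :: "real \<Rightarrow> complex"
  assumes J: "J \<in> fmeasurable lborel" and h: "integrable lborel (\<lambda>y. indicator J y * h y)"
    and b: "\<And>y. y \<in> J \<Longrightarrow> norm (h y) \<le> b"
  shows "norm (LINT y|lborel. indicator J y * h y) \<le> b * len J"
proof -
  have i: "integrable lborel (\<lambda>y. b * indicator J y :: real)"
    using J by (intro integrable_mult_right integrable_real_indicator) (auto simp: fmeasurable_def)
  have "norm (LINT y|lborel. indicator J y * h y) \<le> (LINT y|lborel. b * indicator J y)"
    by (rule Bochner_Integration.integral_norm_bound_integral[OF h i]) (use b in \<open>auto simp: indicator_def\<close>)
  also have "\<dots> = b * len J"
    by (subst integral_mult_right_zero) simp
  finally show ?thesis .
qed

context stopped_packets
begin

text \<open>All intervals of the smallest length \<open>2 powi \<kappa>\<close> are included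
  artificially, so that the maximal elements partition \<open>R\<close>; they cannot strictly
  contain a tile interval, since none is shorter.\<close>

definition "Bad = {J \<in> shifted_dyadic 0. J \<subseteq> R \<and> 2 powi \<kappa> \<le> len J \<and>
  (len J = 2 powi \<kappa> \<or> 320 * \<Psi> < Phi f2 J \<or> 320 * \<Gamma> < Phi L J)}"

definition "\<J> = maximals Bad"

lemma shift0: "3 * (0::real) \<in> \<int>" by simp

lemma finBad: "finite Bad"
proof -
  define \<rho> where "\<rho> = \<bar>center R\<bar> + len R"
  have "R \<subseteq> {-\<rho>..\<rho>}"
  proof
    fix x assume "x \<in> R"
    from ivlD(3)[OF ivR this] have "- \<rho> \<le> x \<and> x \<le> \<rho>" using lR unfolding \<rho>_def by linarith
    thus "x \<in> {-\<rho>..\<rho>}" by simp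
  qed
  hence "Bad \<subseteq> {X \<in> shifted_dyadic 0. X \<subseteq> {-\<rho>..\<rho>} \<and> 2 powi \<kappa> \<le> len X}" by (auto simp: Bad_def)
  thus ?thesis by (rule finite_subset) (rule finite_grid_bounded, simp)
qed

lemma \<J>D:
  assumes "J \<in> \<J>"
  shows "J \<in> shifted_dyadic 0" "ivl J" "J \<subseteq> R" "2 powi \<kappa> \<le> len J" "len J > 0" "J \<in> sets borel" "J \<in> Bad"
proof -
  show "J \<in> Bad" using assms maximals_subset by (auto simp: \<J>_def)
  thus 1: "J \<in> shifted_dyadic 0" "J \<subseteq> R" "2 powi \<kappa> \<le> len J" by (auto simp: Bad_def)
  show 2: "ivl J" by (rule grid_is_ivl[OF 1(1)])
  show "len J > 0" "J \<in> sets borel" using ivlD[OF 2] by auto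
qed

lemma fin\<J>: "finite \<J>"
  unfolding \<J>_def by (rule finite_subset[OF maximals_subset finBad])

lemma disj\<J>: "disjoint \<J>"
  unfolding \<J>_def by (rule disjoint_maximals[OF grid_laminar[OF shift0]]) (auto simp: Bad_def)

lemma Union\<J>: "\<Union>\<J> = R"
proof
  show "R \<subseteq> \<Union>\<J>"
  proof
    fix x assume x: "x \<in> R"
    obtain J where J: "J \<in> shifted_dyadic 0" "x \<in> J" "len J = 2 powi \<kappa>" by (rule grid_cover)
    have "J \<subseteq> R" by (rule grid_nested[OF shift0 J(1) R]) (use J x R\<kappa> in auto)
    hence "J \<in> Bad" using J by (simp add: Bad_def)
    thus "x \<in> \<Union>\<J>" unfolding \<J>_def Union_maximals[OF finBad] using J by blast
  qed
qed (use \<J>D in blast)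

text \<open>A shorter tile interval meeting \<open>J\<close> would lie in \<open>J\<close>. Then
  \<open>nonstop\<close> forbids a jump at \<open>J\<close>, and \<open>J\<close> could only have
  the smallest length, which no tile interval undercuts.\<close>

lemma \<I>_\<J>_disjoint:
  assumes I: "I \<in> \<I>" and J: "J \<in> \<J>" and less: "len I < len J"
  shows "I \<inter> J = {}"
proof (rule ccontr)
  assume ne: "I \<inter> J \<noteq> {}"
  obtain k P where p: "(k, P) \<in> X" "I = fst P" using I by (auto simp: \<I>_def)
  have sub: "I \<subseteq> J" by (rule grid_nested[OF shift0 \<I>D(1)[OF I] \<J>D(1)[OF J] _ ne]) (use less in simp)
  have "Phi f2 J \<le> 320 * \<Psi> \<and> Phi L J \<le> 320 * \<Gamma>"
    using nonstop[OF p(1) \<J>D(1)[OF J]] sub p \<J>D(3)[OF J] by simp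
  moreover have "len J \<noteq> 2 powi \<kappa>" using \<I>D(4)[OF I] less by simp
  ultimately show False using \<J>D(7)[OF J] by (auto simp: Bad_def)
qed

lemma indicator_L_le:
  assumes I: "I \<in> shifted_dyadic 0" and S: "S \<subseteq> I" "S \<in> sets borel"
  shows "(LINT x|lborel. indicator S x * L x) \<le> len I * Phi L I"
proof -
  note iv = grid_is_ivl[OF I]
  have l: "len I > 0" by (rule ivlD(1)[OF iv])
  have "(LINT x|lborel. indicator S x * L x) \<le> ball_int L (center I) (real 1 * len I)"
  proof (rule indicator_integral_le_ball_int[OF bL L0 _ S(2)])
    show "S \<subseteq> {center I - real 1 * len I..center I + real 1 * len I}"
    proof
      fix x assume "x \<in> S"
      hence "x \<in> I" using S by blast
      from ivlD(3)[OF iv this] have "center I - len I \<le> x \<and> x \<le> center I + len I" using l by linarith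
      thus "x \<in> {center I - real 1 * len I..center I + real 1 * len I}" by simp
    qed
  qed
  also have "\<dots> \<le> real 1 ^ 3 * len I * Phi L I" by (rule Phi_upper[OF bL L0 l]) simp
  finally show ?thesis by simp
qed

text \<open>For \<open>J\<close> different from \<open>R\<close>, the grid parent lies in
  \<open>R\<close> and is not in \<open>Bad\<close> by maximality of \<open>J\<close>, so
  \<open>Phi L\<close> there is at most \<open>320 * \<Gamma>\<close>; the parent is twice as long,
  hence 640.\<close>

lemma \<J>_average:
  assumes J: "J \<in> \<J>"
  shows "(LINT x|lborel. indicator J x * L x) \<le> 640 * \<Gamma> * len J"
proof (cases "J = R")
  case True
  have "(LINT x|lborel. indicator J x * L x) \<le> len R * \<Gamma>"
    by (rule indicator_L_le[OF R]) (use \<J>D[OF J] in auto)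
  also have "\<dots> \<le> 640 * \<Gamma> * len R" using \<Gamma>0 lR by simp
  finally show ?thesis using True by simp
next
  case False
  obtain A where A: "A \<in> shifted_dyadic 0" "J \<subseteq> A" "len A = 2 * len J"
    by (rule grid_parent[OF shift0 \<J>D(1)[OF J]])
  have neR: "J \<inter> R \<noteq> {}" "R \<inter> J \<noteq> {}" using \<J>D(3)[OF J] ivlD(6)[OF \<J>D(2)[OF J]] by auto
  have lt: "len J < len R"
  proof (rule ccontr)
    assume "\<not> len J < len R"
    hence "R \<subseteq> J" by (intro grid_nested[OF shift0 R \<J>D(1)[OF J] _ neR(2)]) simp
    thus False using False \<J>D(3)[OF J] by blast
  qed
  have "len A \<le> len R"
  proof -
    obtain i where i: "len J = 2 powi i" using grid_ivl[OF \<J>D(1)[OF J]] by blast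
    obtain j where j: "len R = 2 powi j" using grid_ivl[OF R] by blast
    have "i < j" using lt two_powi_le_iff[of j i] unfolding i j by linarith
    hence "(2::real) powi (i + 1) \<le> 2 powi j" by (simp add: two_powi_le_iff)
    thus ?thesis unfolding A(3) i j by (simp add: power_int_add)
  qed
  hence AR: "A \<subseteq> R"
    by (intro grid_nested[OF shift0 A(1) R]) (use A neR in auto)
  have "A \<noteq> J"
  proof
    assume "A = J"
    thus False using A(3) \<J>D(5)[OF J] by simp
  qed
  hence "A \<notin> Bad" using J A(2) unfolding \<J>_def maximals_def by blast
  hence PA: "Phi L A \<le> 320 * \<Gamma>" using A AR \<J>D(4,5)[OF J] by (auto simp: Bad_def)
  have "(LINT x|lborel. indicator J x * L x) \<le> len A * Phi L A"
    by (rule indicator_L_le[OF A(1,2) \<J>D(6)[OF J]])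
  also have "\<dots> \<le> len A * (320 * \<Gamma>)" using PA by (intro mult_left_mono) auto
  also have "\<dots> = 640 * \<Gamma> * len J" by (simp add: A(3))
  finally show ?thesis .
qed

lemma sum_len_\<J>: "(\<Sum>J\<in>\<J>. len J) = len R"
proof -
  have "measure lborel (\<Union>\<J>) = (\<Sum>J\<in>\<J>. len J)"
    by (rule measure_Union'[OF fin\<J> _ disj\<J>]) (use \<J>D(2) ivlD(5) in blast)
  thus ?thesis by (simp add: Union\<J>)
qed

lemma sum_\<J>_L: "(\<Sum>J\<in>\<J>. (LINT x|lborel. indicator J x * L x)) \<le> \<Gamma> * len R"
proof -
  have "(\<Sum>J\<in>\<J>. (LINT x|lborel. indicator J x * L x)) \<le> (LINT x|lborel. indicator R x * L x)"
  proof (rule sum_disjoint_integral_le[OF fin\<J>])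
    show "disjoint_family_on (\<lambda>J. J) \<J>"
      using disj\<J> by (auto simp: disjoint_family_on_def disjoint_def pairwise_def disjnt_def)
  qed (use \<J>D(3,6) ivlD(4)[OF ivR] bdd_supp_integrable[OF bL] L0 in auto)
  also have "\<dots> \<le> len R * \<Gamma>" by (rule indicator_L_le[OF R]) (use ivlD(4)[OF ivR] in auto)
  finally show ?thesis by (simp add: mult.commute)
qed

definition "modul k x = cis (2 * pi * a k * x)"

lemma modul_continuous: "continuous_on UNIV (modul k)"
  unfolding modul_def by (intro continuous_intros)

lemma modul_measurable [measurable]: "modul k \<in> borel_measurable borel"
  by (rule borel_measurable_continuous_onI[OF modul_continuous])

lemma modul_cnj: "modul k x * cnj (modul k x) = 1" "cnj (modul k x) * modul k x = 1" "norm (modul k x) = 1"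
  by (simp_all add: modul_def cis_cnj cis_mult)

text \<open>The averages are taken after removing the frequency \<open>a k\<close>, with respect to which the packets
  of index \<open>k\<close> are smooth at the scale of their intervals.\<close>

definition "coef k J = (1 / len J) * (LINT y|lborel. indicator J y * (cnj (modul k y) * g k y))"
definition "good k x = (\<Sum>J\<in>\<J>. indicator J x * (modul k x * coef k J))"
definition "bad k J x = indicator J x * (g k x - modul k x * coef k J)"

lemma bdd_supp_demod: "k \<in> {1..N} \<Longrightarrow> bdd_supp (\<lambda>y. cnj (modul k y) * g k y)"
  using bdd_supp_mult_continuous[OF g continuous_on_cnj[OF modul_continuous[of k]]] by (simp add: mult.commute)

lemma bdd_supp_indicator_modul: "J \<in> \<J> \<Longrightarrow> bdd_supp (\<lambda>x. indicator J x * modul k x)"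
proof -
  assume J: "J \<in> \<J>"
  have b: "bdd_supp (\<lambda>x. indicator J x :: complex)"
  proof (rule bdd_suppI[where A=1 and B="\<bar>center J\<bar> + len J"])
    show "indicator J x = (0::complex)" if "\<bar>center J\<bar> + len J < \<bar>x\<bar>" for x
    proof -
      have "x \<notin> J"
      proof
        assume "x \<in> J"
        from ivlD(3)[OF \<J>D(2)[OF J] this] show False using \<J>D(5)[OF J] that by linarith
      qed
      thus ?thesis by simp
    qed
  qed (use \<J>D(6)[OF J] in \<open>auto simp: indicator_def\<close>)
  show ?thesis by (rule bdd_supp_mult_continuous[OF b modul_continuous])
qed

lemma bdd_supp_good: "bdd_supp (good k)"
  unfolding good_def
proof (rule bdd_supp_sum)
  fix J assume J: "J \<in> \<J>"
  show "bdd_supp (\<lambda>x. indicator J x * (modul k x * coef k J))"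
    using bdd_supp_mult_continuous[OF bdd_supp_indicator_modul[OF J, of k] continuous_on_const[of _ "coef k J"]] by (simp add: mult.assoc)
qed

lemma bdd_supp_bad: "k \<in> {1..N} \<Longrightarrow> J \<in> \<J> \<Longrightarrow> bdd_supp (bad k J)"
proof -
  assume k: "k \<in> {1..N}" and J: "J \<in> \<J>"
  have "bdd_supp (\<lambda>x. indicator J x * g k x + indicator J x * modul k x * (- coef k J))"
    by (intro bdd_supp_add bdd_supp_indicator g k \<J>D(6)[OF J] bdd_supp_mult_continuous[OF bdd_supp_indicator_modul[OF J]] continuous_on_const)
  thus ?thesis by (simp add: bad_def[abs_def] algebra_simps)
qed

text \<open>By Minkowski the vector of averages is no longer than the average of the vector length;
  demodulation does not change absolute values.\<close>

lemma coef_sum: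
  assumes J: "J \<in> \<J>"
  shows "(\<Sum>k=1..N. (norm (coef k J))\<^sup>2) \<le> (640 * \<Gamma>)\<^sup>2"
proof -
  note l = \<J>D(5)[OF J]
  have iG: "integrable lborel (\<lambda>x. norm (g k x) * indicator J x)" if "k \<in> {1..N}" for k
    using bdd_supp_integrable[OF bdd_supp_indicator[OF bdd_supp_norm[OF g[OF that]] \<J>D(6)[OF J]]] by (simp add: mult.commute)
  have Leq: "L x = L2_set (\<lambda>k. norm (g k x)) {1..N}" for x by (simp add: l2_norm_fun_def L2_set_def)
  have iL: "integrable lborel (\<lambda>x. L2_set (\<lambda>k. norm (g k x)) {1..N} * indicator J x)"
    using bdd_supp_integrable[OF bdd_supp_indicator[OF bL \<J>D(6)[OF J]]] by (simp add: Leq mult.commute)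
  have c: "norm (coef k J) \<le> (1 / len J) * (LINT x|lborel. norm (g k x) * indicator J x)" if k: "k \<in> {1..N}" for k
  proof -
    have "norm (LINT y|lborel. indicator J y * (cnj (modul k y) * g k y)) \<le> (LINT x|lborel. norm (g k x) * indicator J x)"
      by (rule Bochner_Integration.integral_norm_bound_integral[OF bdd_supp_integrable[OF bdd_supp_indicator[OF bdd_supp_demod[OF k] \<J>D(6)[OF J]]] iG[OF k]])
        (auto simp: norm_mult modul_cnj indicator_def)
    thus ?thesis unfolding coef_def norm_mult using l by (simp add: norm_divide divide_right_mono)
  qed
  have "(\<Sum>k=1..N. (norm (coef k J))\<^sup>2) \<le> (\<Sum>k=1..N. ((1 / len J) * (LINT x|lborel. norm (g k x) * indicator J x))\<^sup>2)"
    using c by (intro sum_mono power_mono) auto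
  also have "\<dots> = (1 / len J)\<^sup>2 * (\<Sum>k\<in>{1..N}. (LINT x|lborel. norm (g k x) * indicator J x)\<^sup>2)"
    unfolding sum_distrib_left by (simp only: power_mult_distrib)
  also have "\<dots> \<le> (1 / len J)\<^sup>2 * (LINT x|lborel. L2_set (\<lambda>k. norm (g k x)) {1..N} * indicator J x)\<^sup>2"
    by (intro mult_left_mono minkowski_l2 iG iL) auto
  also have "\<dots> = ((1 / len J) * (LINT x|lborel. indicator J x * L x))\<^sup>2"
    by (simp only: power_mult_distrib Leq mult.commute[of "indicator J _"])
  also have "\<dots> \<le> (640 * \<Gamma>)\<^sup>2"
  proof (rule power_mono)
    show "1 / len J * (LINT x|lborel. indicator J x * L x) \<le> 640 * \<Gamma>"
      using \<J>_average[OF J] l by (simp add: divide_le_eq)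
    show "0 \<le> 1 / len J * (LINT x|lborel. indicator J x * L x)"
      using l L0 by (intro mult_nonneg_nonneg integral_nonneg_AE AE_I2) auto
  qed
  finally show ?thesis .
qed

text \<open>On each \<open>J\<close> the good part has constant modulus
  \<open>norm (coef k J)\<close>, so the sum over \<open>k\<close> can be taken first and
  \<open>coef_sum\<close> applies.\<close>

lemma good_square: "(\<Sum>k=1..N. (LINT x|lborel. (norm (good k x))\<^sup>2)) \<le> (640 * \<Gamma>)\<^sup>2 * len R"
proof -
  have e: "(norm (good k x))\<^sup>2 = (\<Sum>J\<in>\<J>. indicator J x * (norm (coef k J))\<^sup>2)" for k x
  proof (cases "x \<in> R")
    case True
    then obtain J0 where J0: "J0 \<in> \<J>" "x \<in> J0" using Union\<J> by blast
    show ?thesis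
      unfolding good_def sum_indicator_disjoint[OF fin\<J> disj\<J> J0] by (simp add: norm_mult modul_cnj)
  next
    case False
    hence "indicator J x = (0::complex)" "indicator J x = (0::real)" if "J \<in> \<J>" for J
      using \<J>D(3)[OF that] by (auto simp: indicator_def)
    thus ?thesis by (simp add: good_def)
  qed
  have "(LINT x|lborel. (norm (good k x))\<^sup>2) = (\<Sum>J\<in>\<J>. len J * (norm (coef k J))\<^sup>2)" for k
  proof -
    have i: "integrable lborel (indicator J :: real \<Rightarrow> real)" if "J \<in> \<J>" for J
      using ivlD(5)[OF \<J>D(2)[OF that]] by (intro integrable_real_indicator) (auto simp: fmeasurable_def)
    have "(LINT x|lborel. (norm (good k x))\<^sup>2) = (\<Sum>J\<in>\<J>. (LINT x|lborel. indicator J x * (norm (coef k J))\<^sup>2))"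
      unfolding e by (rule Bochner_Integration.integral_sum) (intro integrable_mult_left i)
    also have "\<dots> = (\<Sum>J\<in>\<J>. len J * (norm (coef k J))\<^sup>2)"
      by (intro sum.cong refl) (subst integral_mult_left_zero, simp)
    finally show ?thesis .
  qed
  hence "(\<Sum>k=1..N. (LINT x|lborel. (norm (good k x))\<^sup>2)) = (\<Sum>k=1..N. \<Sum>J\<in>\<J>. len J * (norm (coef k J))\<^sup>2)" by simp
  also have "\<dots> = (\<Sum>J\<in>\<J>. \<Sum>k=1..N. len J * (norm (coef k J))\<^sup>2)" by (rule sum.swap)
  also have "\<dots> = (\<Sum>J\<in>\<J>. len J * (\<Sum>k=1..N. (norm (coef k J))\<^sup>2))" by (simp add: sum_distrib_left)
  also have "\<dots> \<le> (\<Sum>J\<in>\<J>. len J * (640 * \<Gamma>)\<^sup>2)"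
    by (intro sum_mono mult_left_mono coef_sum) auto
  also have "\<dots> = (640 * \<Gamma>)\<^sup>2 * len R" by (simp add: sum_distrib_right[symmetric] sum_len_\<J>)
  finally show ?thesis .
qed

text \<open>Cauchy-Schwarz over all tiles at once. For \<open>good k\<close> the inequality of
  Bessel is used one index at a time, against the tiles of that index only.\<close>

lemma good_estimate:
  "(\<Sum>(k, P)\<in>X. len (fst P) * norm (L2_inner f (\<phi> P)) * norm (L2_inner (good k) (\<phi> P)))
    \<le> sqrt (1310752 * C0\<^sup>2 * \<Psi> * len R) * sqrt (16 * C0\<^sup>2 * ((640 * \<Gamma>)\<^sup>2 * len R))"
proof -
  let ?u = "\<lambda>p. sqrt (len (fst (snd p))) * norm (L2_inner f (\<phi> (snd p)))"
  let ?v = "\<lambda>p. sqrt (len (fst (snd p))) * norm (L2_inner (good (fst p)) (\<phi> (snd p)))"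
  have "(\<Sum>p\<in>X. (?v p)\<^sup>2) = (\<Sum>k\<in>{1..N}. \<Sum>p\<in>{p \<in> X. fst p = k}. (?v p)\<^sup>2)"
    by (rule sum.group[symmetric, OF finX]) (use index X in auto)
  also have "\<dots> \<le> (\<Sum>k\<in>{1..N}. 16 * C0\<^sup>2 * (LINT x|lborel. (norm (good k x))\<^sup>2))"
  proof (rule sum_mono)
    fix k
    have "(\<Sum>p\<in>{p \<in> X. fst p = k}. (?v p)\<^sup>2) = (\<Sum>(k', P)\<in>{p \<in> X. fst p = k}. len (fst P) * (norm (L2_inner (good k) (\<phi> P)))\<^sup>2)"
      by (intro sum.cong) (auto simp: power_mult_distrib)
    also have "\<dots> \<le> 16 * C0\<^sup>2 * (LINT x|lborel. (norm (good k x))\<^sup>2)"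
      by (rule global_bessel[OF bdd_supp_good]) (use X in auto)
    finally show "(\<Sum>p\<in>{p \<in> X. fst p = k}. (?v p)\<^sup>2) \<le> 16 * C0\<^sup>2 * (LINT x|lborel. (norm (good k x))\<^sup>2)" .
  qed
  also have "\<dots> = 16 * C0\<^sup>2 * (\<Sum>k=1..N. (LINT x|lborel. (norm (good k x))\<^sup>2))" by (simp add: sum_distrib_left)
  also have "\<dots> \<le> 16 * C0\<^sup>2 * ((640 * \<Gamma>)\<^sup>2 * len R)" by (intro mult_left_mono good_square) auto
  finally have v: "L2_set ?v X \<le> sqrt (16 * C0\<^sup>2 * ((640 * \<Gamma>)\<^sup>2 * len R))"
    unfolding L2_set_def by (rule real_sqrt_le_mono)
  have "(\<Sum>p\<in>X. (?u p)\<^sup>2) = (\<Sum>(k, P)\<in>X. len (fst P) * (norm (L2_inner f (\<phi> P)))\<^sup>2)"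
    by (intro sum.cong) (auto simp: power_mult_distrib)
  hence u: "L2_set ?u X \<le> sqrt (1310752 * C0\<^sup>2 * \<Psi> * len R)"
    unfolding L2_set_def using f_square_sum by (intro real_sqrt_le_mono) simp
  have "(\<Sum>(k, P)\<in>X. len (fst P) * norm (L2_inner f (\<phi> P)) * norm (L2_inner (good k) (\<phi> P))) = (\<Sum>p\<in>X. \<bar>?u p\<bar> * \<bar>?v p\<bar>)"
  proof (intro sum.cong refl)
    fix p assume "p \<in> X"
    have "sqrt (len (fst (snd p))) * sqrt (len (fst (snd p))) = len (fst (snd p))" by simp
    thus "(case p of (k, P) \<Rightarrow> len (fst P) * norm (L2_inner f (\<phi> P)) * norm (L2_inner (good k) (\<phi> P))) = \<bar>?u p\<bar> * \<bar>?v p\<bar>"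
      by (simp add: split_beta' abs_mult mult_ac)
  qed
  also have "\<dots> \<le> L2_set ?u X * L2_set ?v X" by (rule L2_set_mult_ineq)
  also have "\<dots> \<le> sqrt (1310752 * C0\<^sup>2 * \<Psi> * len R) * sqrt (16 * C0\<^sup>2 * ((640 * \<Gamma>)\<^sup>2 * len R))"
    by (intro mult_mono u v L2_set_nonneg) (use \<Psi>0 in simp)
  finally show ?thesis .
qed

text \<open>Bounds on \<open>J\<close> the deviation of a demodulated packet over \<open>I\<close>
  from its mean. If \<open>J\<close> is not longer than \<open>I\<close>, the Lipschitz condition
  gains \<open>len J / len I\<close>. If \<open>J\<close> is longer there is no cancellation to
  exploit, but size suffices, because \<open>I\<close> is then disjoint from
  \<open>J\<close>.\<close>

definition "osc I J x = (if len J \<le> len I then C1 * len J / (len I)\<^sup>2 / wt (center I) (len I) (center J) ^ 10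
  else ker I x + (1 / len J) * (LINT y|lborel. indicator J y * ker I y))"

lemma indicator_ker_integrable: "I \<in> \<I> \<Longrightarrow> J \<in> \<J> \<Longrightarrow> integrable lborel (\<lambda>y. indicator J y * ker I y)"
  using integrable_real_mult_indicator[of J lborel "ker I"] ker_integrable \<J>D(6) by (simp add: mult.commute)

lemma indicator_ker_nonneg: "I \<in> \<I> \<Longrightarrow> 0 \<le> (LINT y|lborel. indicator J y * ker I y)"
  by (intro integral_nonneg_AE AE_I2) (simp add: ker_nonneg)

lemma osc_nonneg: "I \<in> \<I> \<Longrightarrow> J \<in> \<J> \<Longrightarrow> osc I J x \<ge> 0"
  using ker_nonneg[of I x] indicator_ker_nonneg[of I J] \<J>D(5)[of J] \<I>D(7)[of I] C1 wt_pos[of "len I" "center I" "center J"]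
  by (auto simp: osc_def)

lemma osc_measurable: "osc I J \<in> borel_measurable borel"
  unfolding osc_def by measurable

lemma osc_bounded:
  assumes I: "I \<in> \<I>" and J: "J \<in> \<J>"
  shows "\<exists>D. \<forall>x. osc I J x \<le> D"
proof (cases "len J \<le> len I")
  case True
  thus ?thesis by (auto simp: osc_def)
next
  case False
  thus ?thesis using ker_le[OF I]
    by (intro exI[of _ "C0 / len I + (1 / len J) * (LINT y|lborel. indicator J y * ker I y)"]) (simp add: osc_def)
qed

lemma packet_oscillation:
  assumes p: "(k, P) \<in> X" and J: "J \<in> \<J>" and x: "x \<in> J"
  shows "norm (cnj (modul k x) * \<phi> P x - (1 / len J) * (LINT y|lborel. indicator J y * (cnj (modul k y) * \<phi> P y)))
    \<le> osc (fst P) J x"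
proof -
  let ?I = "fst P" and ?\<psi> = "\<lambda>y. cnj (modul k y) * \<phi> P y"
  have pT: "(k, P) \<in> T" using p X by blast
  have I: "?I \<in> \<I>" using p by (force simp: \<I>_def)
  note l = \<J>D(5)[OF J] and fm = ivlD(5)[OF \<J>D(2)[OF J]]
  \<comment> \<open>The integrand is built as \<open>indicator J * modul k\<close> times two factors
    \<open>cnj (modul k)\<close> and the packet; one of these factors cancels
    \<open>modul k\<close>, and every step preserves bounded support.\<close>
  have i: "integrable lborel (\<lambda>y. indicator J y * ?\<psi> y)"
    using bdd_supp_integrable[OF bdd_supp_mult_continuous[OF bdd_supp_indicator_modul[OF J, of k, THEN bdd_supp_mult_continuous[OF _ continuous_on_cnj[OF modul_continuous[of k]]], THEN bdd_supp_mult_continuous[OF _ continuous_on_cnj[OF modul_continuous[of k]]]] cont[OF pT]]]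
    by (simp add: mult.assoc modul_cnj)
  show ?thesis
  proof (cases "len J \<le> len ?I")
    case True
    have ii: "integrable lborel (\<lambda>y. indicator J y :: complex)"
    proof -
      have "integrable lborel (\<lambda>y. complex_of_real (indicator J y))"
        using fm by (intro integrable_of_real integrable_real_indicator) (auto simp: fmeasurable_def)
      thus ?thesis by (simp add: of_real_indicator)
    qed
    have ic: "integrable lborel (\<lambda>y. indicator J y * ?\<psi> x)"
      using ii by (rule integrable_mult_left)
    have ij: "(LINT y|lborel. indicator J y * ?\<psi> x) = len J * ?\<psi> x"
    proof -
      have "(LINT y|lborel. indicator J y :: complex) = len J"
        using integral_complex_of_real[of lborel "indicator J"] by (simp add: of_real_indicator)
      thus ?thesis unfolding integral_mult_left_zero by simp
    qed
    let ?b = "C1 * len J / (len ?I)\<^sup>2 / wt (center ?I) (len ?I) (center J) ^ 10"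
    have "(LINT y|lborel. indicator J y * (?\<psi> x - ?\<psi> y)) = len J * ?\<psi> x - (LINT y|lborel. indicator J y * ?\<psi> y)"
      unfolding right_diff_distrib by (subst Bochner_Integration.integral_diff[OF ic i]) (simp only: ij)
    hence e: "?\<psi> x - (1 / len J) * (LINT y|lborel. indicator J y * ?\<psi> y) = (1 / len J) * (LINT y|lborel. indicator J y * (?\<psi> x - ?\<psi> y))"
      using l by (simp add: field_simps)
    have b: "norm (LINT y|lborel. indicator J y * (?\<psi> x - ?\<psi> y)) \<le> ?b * len J"
    proof (rule norm_set_average_le[OF fm])
      show "integrable lborel (\<lambda>y. indicator J y * (?\<psi> x - ?\<psi> y))"
        unfolding right_diff_distrib by (rule Bochner_Integration.integrable_diff[OF ic i])
      fix y assume y: "y \<in> J"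
      have d: "\<bar>x - center J\<bar> \<le> len J / 2" "\<bar>y - center J\<bar> \<le> len J / 2"
        using ivlD(3)[OF \<J>D(2)[OF J]] x y by auto
      have em: "cnj (modul k z) = cis (- 2 * pi * a k * z)" for z by (simp add: modul_def cis_cnj)
      have "norm (?\<psi> x - ?\<psi> y) \<le> C1 * \<bar>x - y\<bar> / (len ?I)\<^sup>2 / wt (center ?I) (len ?I) (center J) ^ 10"
        unfolding em by (rule lip[OF pT]) (use d True in auto)
      also have "\<dots> \<le> ?b"
      proof -
        have "\<bar>x - y\<bar> \<le> len J" using d by linarith
        hence "C1 * \<bar>x - y\<bar> \<le> C1 * len J" using C1 by (rule mult_left_mono)
        thus ?thesis
          using wt_pos[OF \<I>D(7)[OF I], of "center ?I" "center J"] by (intro divide_right_mono) auto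
      qed
      finally show "norm (?\<psi> x - ?\<psi> y) \<le> ?b" .
    qed
    have nm: "norm (complex_of_real (1 / len J) * z) = (1 / len J) * norm z" for z
      using l by (simp add: norm_mult norm_divide)
    have "norm (?\<psi> x - (1 / len J) * (LINT y|lborel. indicator J y * ?\<psi> y)) \<le> (1 / len J) * (?b * len J)"
      unfolding e nm by (rule mult_left_mono[OF b]) simp
    also have "\<dots> = ?b" using l by simp
    finally show ?thesis using True by (simp add: osc_def)
  next
    case False
    have n\<psi>: "norm (?\<psi> y) \<le> ker ?I y" for y
      using packet_le_ker[OF p, of y] by (simp add: norm_mult modul_cnj)
    have "norm (LINT y|lborel. indicator J y * ?\<psi> y) \<le> (LINT y|lborel. indicator J y * ker ?I y)"
      by (rule Bochner_Integration.integral_norm_bound_integral[OF i indicator_ker_integrable[OF I J]])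
        (use n\<psi> in \<open>auto simp: indicator_def\<close>)
    hence "norm ((1 / len J) * (LINT y|lborel. indicator J y * ?\<psi> y)) \<le> (1 / len J) * (LINT y|lborel. indicator J y * ker ?I y)"
      using l by (simp add: norm_mult norm_divide divide_right_mono)
    hence "norm (?\<psi> x - (1 / len J) * (LINT y|lborel. indicator J y * ?\<psi> y)) \<le> ker ?I x + (1 / len J) * (LINT y|lborel. indicator J y * ker ?I y)"
      using n\<psi>[of x] by (intro order_trans[OF norm_triangle_ineq4] add_mono)
    thus ?thesis using False by (simp add: osc_def)
  qed
qed

text \<open>Demodulated, \<open>bad k J\<close> has mean zero on \<open>J\<close>, so the mean
  \<open>q\<close> of the demodulated packet may be subtracted from it. The fact \<open>cq\<close>
  expresses this cancellation: removing the mean of \<open>g\<close> or the mean of the packet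
  leaves the same integral.\<close>

lemma bad_pairing_le:
  assumes p: "(k, P) \<in> X" and J: "J \<in> \<J>"
  shows "norm (L2_inner (bad k J) (\<phi> P)) \<le> (LINT x|lborel. norm (g k x) * (indicator J x * osc (fst P) J x))"
proof -
  let ?I = "fst P" and ?\<psi> = "\<lambda>y. cnj (modul k y) * \<phi> P y"
  let ?G = "\<lambda>y. cnj (modul k y) * g k y"
  have pT: "(k, P) \<in> T" using p X by blast
  have k: "k \<in> {1..N}" using pT index by blast
  have I: "?I \<in> \<I>" using p by (force simp: \<I>_def)
  note l = \<J>D(5)[OF J]
  define q where "q = (1 / len J) * (LINT y|lborel. indicator J y * ?\<psi> y)"
  have bG: "bdd_supp (\<lambda>y. indicator J y * ?G y)" by (rule bdd_supp_indicator[OF bdd_supp_demod[OF k] \<J>D(6)[OF J]])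
  have c\<psi>: "continuous_on UNIV ?\<psi>" by (intro continuous_intros modul_continuous cont[OF pT])
  have i1: "integrable lborel (\<lambda>y. indicator J y * ?G y * cnj (?\<psi> y))"
    by (intro bdd_supp_integrable bdd_supp_mult_continuous[OF bG] continuous_on_cnj c\<psi>)
  have i2: "integrable lborel (\<lambda>y. indicator J y * ?G y * cnj q)"
    by (intro integrable_mult_left bdd_supp_integrable bG)
  have i3: "integrable lborel (\<lambda>y. indicator J y * modul k y * cnj (\<phi> P y))"
    by (intro bdd_supp_integrable bdd_supp_mult_continuous[OF bdd_supp_indicator_modul[OF J]] continuous_on_cnj cont[OF pT])
  have g\<psi>: "?G y * cnj (?\<psi> y) = g k y * cnj (\<phi> P y)" for y
  proof -
    have "?G y * cnj (?\<psi> y) = (cnj (modul k y) * modul k y) * (g k y * cnj (\<phi> P y))" by (simp add: mult_ac)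
    thus ?thesis by (simp add: modul_cnj)
  qed
  have cq: "coef k J * (LINT y|lborel. indicator J y * modul k y * cnj (\<phi> P y)) = (LINT y|lborel. indicator J y * ?G y * cnj q)"
  proof -
    have "(LINT y|lborel. indicator J y * modul k y * cnj (\<phi> P y)) = cnj (LINT y|lborel. indicator J y * ?\<psi> y)"
      unfolding Bochner_Integration.integral_cnj[symmetric]
      by (intro Bochner_Integration.integral_cong refl) (auto simp: indicator_def)
    also have "\<dots> = len J * cnj q" using l by (simp add: q_def)
    finally show ?thesis
      unfolding integral_mult_left_zero coef_def using l by simp
  qed
  have "L2_inner (bad k J) (\<phi> P) = (LINT y|lborel. indicator J y * ?G y * cnj (?\<psi> y) - coef k J * (indicator J y * modul k y * cnj (\<phi> P y)))"
    unfolding L2_inner_def bad_def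
    by (intro Bochner_Integration.integral_cong refl) (simp only: mult.assoc g\<psi>, simp add: algebra_simps modul_cnj)
  also have "\<dots> = (LINT y|lborel. indicator J y * ?G y * cnj (?\<psi> y)) - coef k J * (LINT y|lborel. indicator J y * modul k y * cnj (\<phi> P y))"
    by (subst Bochner_Integration.integral_diff[OF i1 integrable_mult_right[OF i3]]) simp
  also have "\<dots> = (LINT y|lborel. indicator J y * ?G y * cnj (?\<psi> y) - indicator J y * ?G y * cnj q)"
    unfolding cq by (rule Bochner_Integration.integral_diff[OF i1 i2, symmetric])
  finally have e: "L2_inner (bad k J) (\<phi> P) = (LINT y|lborel. indicator J y * ?G y * cnj (?\<psi> y) - indicator J y * ?G y * cnj q)" .
  obtain D where D: "\<And>x. osc ?I J x \<le> D" using osc_bounded[OF I J] by blast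
  show ?thesis
    unfolding e
  proof (rule Bochner_Integration.integral_norm_bound_integral[OF Bochner_Integration.integrable_diff[OF i1 i2]])
    have [measurable]: "osc ?I J \<in> borel_measurable borel" "J \<in> sets borel" by (rule osc_measurable, rule \<J>D(6)[OF J])
    have D0: "D \<ge> 0" using D[of 0] osc_nonneg[OF I J, of 0] by linarith
    show "integrable lborel (\<lambda>x. norm (g k x) * (indicator J x * osc ?I J x))"
      using D D0 osc_nonneg[OF I J]
      by (intro bdd_supp_integrable bdd_supp_mult_bounded[OF bdd_supp_norm[OF g[OF k]], of _ D]) (measurable, auto simp: indicator_def)
    fix x
    show "norm (indicator J x * ?G x * cnj (?\<psi> x) - indicator J x * ?G x * cnj q) \<le> norm (g k x) * (indicator J x * osc ?I J x)"
    proof (cases "x \<in> J")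
      case True
      have "norm (?G x * cnj (?\<psi> x) - ?G x * cnj q) = norm (g k x) * norm (?\<psi> x - q)"
        unfolding right_diff_distrib[symmetric] complex_cnj_diff[symmetric] norm_mult complex_mod_cnj modul_cnj by simp
      also have "\<dots> \<le> norm (g k x) * osc ?I J x"
        using packet_oscillation[OF p J True] unfolding q_def by (intro mult_left_mono) auto
      finally show ?thesis using True by simp
    qed simp
  qed
qed

text \<open>Both terms of \<open>osc\<close> gain \<open>edge I J\<close>: the kernel because
  \<open>center I\<close> is outside \<open>J\<close>, its mean through
  \<open>separated_kernel\<close> together with \<open>\<J>_average\<close>. 3200 = 640 + 4 *
  640.\<close>

lemma L_osc_integral:
  assumes I: "I \<in> \<I>" and J: "J \<in> \<J>" and less: "len I < len J"
  shows "(LINT x|lborel. L x * (indicator J x * osc I J x)) \<le> 3200 * C0 * \<Gamma> * edge I J"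
proof -
  have disj: "center I \<notin> J" using \<I>_\<J>_disjoint[OF I J less] ivlD(2)[OF \<I>D(2)[OF I]] by blast
  have sep: "1 / (wt (center I) (len I) x)\<^sup>2 \<le> edge I J" if "x \<in> J" for x
    using edge_separates[OF \<I>D(2)[OF I] \<J>D(2)[OF J]] disj that by blast
  let ?c = "(1 / len J) * (LINT y|lborel. indicator J y * ker I y)"
  note l = \<J>D(5)[OF J]
  have c0: "?c \<ge> 0" using indicator_ker_nonneg[OF I, of J] l by simp
  have bJL: "bdd_supp (\<lambda>x. indicator J x * L x)" by (rule bdd_supp_indicator[OF bL \<J>D(6)[OF J]])
  have i1: "integrable lborel (\<lambda>x. L x * (indicator J x * ker I x))"
    using bdd_supp_integrable[OF bdd_supp_mult_bounded[OF bJL ker_measurable[of I], of "C0 / len I"]] ker_le[OF I] ker_nonneg[OF I] by (simp add: mult_ac)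
  have i2: "integrable lborel (\<lambda>x. ?c * (indicator J x * L x))" by (intro integrable_mult_right bdd_supp_integrable bJL)
  have "(LINT x|lborel. L x * (indicator J x * osc I J x)) = (LINT x|lborel. L x * (indicator J x * ker I x) + ?c * (indicator J x * L x))"
    using less by (intro Bochner_Integration.integral_cong refl) (simp add: osc_def algebra_simps)
  also have "\<dots> = (LINT x|lborel. L x * (indicator J x * ker I x)) + ?c * (LINT x|lborel. indicator J x * L x)"
    by (subst Bochner_Integration.integral_add[OF i1 i2]) (simp only: integral_mult_right_zero)
  also have "\<dots> \<le> 640 * C0 * \<Gamma> * edge I J + 4 * C0 * edge I J * (640 * \<Gamma>)"
  proof (rule add_mono)
    show "(LINT x|lborel. L x * (indicator J x * ker I x)) \<le> 640 * C0 * \<Gamma> * edge I J"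
      by (rule L_ker_separated[OF I \<J>D(6)[OF J] sep edge_nonneg])
    have "?c * (LINT x|lborel. indicator J x * L x) \<le> ?c * (640 * \<Gamma> * len J)"
      by (rule mult_left_mono[OF \<J>_average[OF J] c0])
    also have "\<dots> = (LINT y|lborel. indicator J y * ker I y) * (640 * \<Gamma>)" using l by simp
    also have "\<dots> \<le> (4 * C0 * edge I J) * (640 * \<Gamma>)"
    proof (rule mult_right_mono)
      have "(LINT y|lborel. indicator J y * ker I y) = (C0 / len I) * (LINT y|lborel. indicator J y * (1 / wt (center I) (len I) y ^ 10))"
        unfolding ker_def integral_mult_right_zero[symmetric] by (simp add: mult_ac)
      also have "\<dots> \<le> (C0 / len I) * (edge I J * (4 * len I))"
        using C0 \<I>D(7)[OF I] by (intro mult_left_mono separated_kernel \<I>D(2)[OF I] \<J>D(6)[OF J] sep edge_nonneg) auto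
      also have "\<dots> = 4 * C0 * edge I J" using \<I>D(7)[OF I] by simp
      finally show "(LINT y|lborel. indicator J y * ker I y) \<le> 4 * C0 * edge I J" .
    qed (use \<Gamma>0 in simp)
    finally show "?c * (LINT x|lborel. indicator J x * L x) \<le> 4 * C0 * edge I J * (640 * \<Gamma>)" .
  qed
  finally show ?thesis by (simp add: mult_ac)
qed

text \<open>Tile intervals not shorter than \<open>J\<close> are summed by
  \<open>grid_sum_large_le\<close> with the gain \<open>len J / len I\<close>, the shorter ones by
  \<open>edge_sum_le\<close>; 51200 = 3200 * 16.\<close>

lemma bad_estimate_single:
  assumes J: "J \<in> \<J>"
  shows "(\<Sum>(k, P)\<in>X. len (fst P) * norm (L2_inner f (\<phi> P)) * norm (L2_inner (bad k J) (\<phi> P)))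
    \<le> \<F> * (8 * C1 * (LINT x|lborel. indicator J x * L x) + 51200 * C0 * \<Gamma> * len J)"
proof -
  let ?\<theta> = "\<lambda>I x. indicator J x * osc I J x"
  have [measurable]: "J \<in> sets borel" by (rule \<J>D(6)[OF J])
  have "(\<Sum>(k, P)\<in>X. len (fst P) * norm (L2_inner f (\<phi> P)) * norm (L2_inner (bad k J) (\<phi> P)))
    \<le> \<F> * (\<Sum>I\<in>\<I>. len I * (LINT x|lborel. L x * ?\<theta> I x))"
  proof (rule tiles_sum_le)
    fix I assume I: "I \<in> \<I>"
    have [measurable]: "osc I J \<in> borel_measurable borel" by (rule osc_measurable)
    show "?\<theta> I \<in> borel_measurable borel" by measurable
    show "?\<theta> I x \<ge> 0" for x using osc_nonneg[OF I J] by simp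
    obtain D where D: "\<And>x. osc I J x \<le> D" using osc_bounded[OF I J] by blast
    have "?\<theta> I x \<le> D" for x using D[of x] osc_nonneg[OF I J, of x] by (auto simp: indicator_def)
    thus "\<exists>D. \<forall>x. ?\<theta> I x \<le> D" by blast
  qed (use bad_pairing_le J in auto)
  also have "(\<Sum>I\<in>\<I>. len I * (LINT x|lborel. L x * ?\<theta> I x)) =
     (\<Sum>I\<in>{I\<in>\<I>. len J \<le> len I}. len I * (LINT x|lborel. L x * ?\<theta> I x)) +
     (\<Sum>I\<in>{I\<in>\<I>. \<not> len J \<le> len I}. len I * (LINT x|lborel. L x * ?\<theta> I x))"
    using fin\<I> by (subst sum.union_disjoint[symmetric]) (auto intro!: sum.cong)
  finally have A: "(\<Sum>(k, P)\<in>X. len (fst P) * norm (L2_inner f (\<phi> P)) * norm (L2_inner (bad k J) (\<phi> P)))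
    \<le> \<F> * ((\<Sum>I\<in>{I\<in>\<I>. len J \<le> len I}. len I * (LINT x|lborel. L x * ?\<theta> I x)) +
     (\<Sum>I\<in>{I\<in>\<I>. \<not> len J \<le> len I}. len I * (LINT x|lborel. L x * ?\<theta> I x)))" .
  let ?Y = "LINT x|lborel. indicator J x * L x"
  have Y0: "?Y \<ge> 0" by (intro integral_nonneg_AE AE_I2) (simp add: L0)
  obtain i where i: "len J = 2 powi i" using grid_ivl[OF \<J>D(1)[OF J]] by blast
  have B1: "(\<Sum>I\<in>{I\<in>\<I>. len J \<le> len I}. len I * (LINT x|lborel. L x * ?\<theta> I x)) \<le> 8 * C1 * ?Y"
  proof -
    have "(\<Sum>I\<in>{I\<in>\<I>. len J \<le> len I}. len I * (LINT x|lborel. L x * ?\<theta> I x)) \<le>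
       (\<Sum>I\<in>{I\<in>\<I>. len J \<le> len I}. (C1 * ?Y) * ((2 powi i / len I) * (1 / (wt (center I) (len I) (center J))\<^sup>2)))"
    proof (rule sum_mono)
      fix I assume "I \<in> {I\<in>\<I>. len J \<le> len I}"
      hence I: "I \<in> \<I>" "len J \<le> len I" by auto
      note lI = \<I>D(7)[OF I(1)]
      let ?w = "wt (center I) (len I) (center J)"
      let ?b = "C1 * len J / (len I)\<^sup>2 / ?w ^ 10"
      have "(LINT x|lborel. L x * ?\<theta> I x) = (LINT x|lborel. ?b * (indicator J x * L x))"
        using I(2) by (intro Bochner_Integration.integral_cong refl) (simp add: osc_def)
      also have "\<dots> = ?b * ?Y" by (rule integral_mult_right_zero)
      finally have "len I * (LINT x|lborel. L x * ?\<theta> I x) = (C1 * ?Y) * ((len J / len I) * (1 / ?w ^ 10))"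
        using lI by (simp add: power2_eq_square)
      also have "\<dots> \<le> (C1 * ?Y) * ((len J / len I) * (1 / ?w\<^sup>2))"
        using C1 Y0 lI by (intro mult_left_mono wt_power_antimono mult_nonneg_nonneg) auto
      finally show "len I * (LINT x|lborel. L x * ?\<theta> I x) \<le> (C1 * ?Y) * ((2 powi i / len I) * (1 / ?w\<^sup>2))"
        unfolding i .
    qed
    also have "\<dots> = (C1 * ?Y) * (\<Sum>I\<in>{I\<in>\<I>. len J \<le> len I}. (2 powi i / len I) * (1 / (wt (center I) (len I) (center J))\<^sup>2))"
      by (rule sum_distrib_left[symmetric])
    also have "\<dots> \<le> (C1 * ?Y) * 8"
      by (intro mult_left_mono grid_sum_large_le[where s=0]) (use fin\<I> \<I>D(1) C1 Y0 i in auto)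
    finally show ?thesis by simp
  qed
  have B2: "(\<Sum>I\<in>{I\<in>\<I>. \<not> len J \<le> len I}. len I * (LINT x|lborel. L x * ?\<theta> I x)) \<le> 51200 * C0 * \<Gamma> * len J"
  proof -
    have "(\<Sum>I\<in>{I\<in>\<I>. \<not> len J \<le> len I}. len I * (LINT x|lborel. L x * ?\<theta> I x)) \<le>
       (\<Sum>I\<in>{I\<in>\<I>. \<not> len J \<le> len I}. (3200 * C0 * \<Gamma>) * (len I * edge I J))"
    proof (rule sum_mono)
      fix I assume "I \<in> {I\<in>\<I>. \<not> len J \<le> len I}"
      hence I: "I \<in> \<I>" "len I < len J" by auto
      have "len I * (LINT x|lborel. L x * ?\<theta> I x) \<le> len I * (3200 * C0 * \<Gamma> * edge I J)"
        by (rule mult_left_mono[OF L_osc_integral[OF I(1) J I(2)]]) simp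
      thus "len I * (LINT x|lborel. L x * ?\<theta> I x) \<le> (3200 * C0 * \<Gamma>) * (len I * edge I J)" by (simp only: mult_ac)
    qed
    also have "\<dots> = (3200 * C0 * \<Gamma>) * (\<Sum>I\<in>{I\<in>\<I>. \<not> len J \<le> len I}. len I * edge I J)"
      by (rule sum_distrib_left[symmetric])
    also have "\<dots> \<le> (3200 * C0 * \<Gamma>) * (16 * len J)"
      by (intro mult_left_mono edge_sum_le[OF _ _ _ \<J>D(1)[OF J]]) (use fin\<I> \<I>D(1) C0 \<Gamma>0 in auto)
    finally show ?thesis by simp
  qed
  show ?thesis by (rule order_trans[OF A mult_left_mono[OF add_mono[OF B1 B2] \<F>0]])
qed

lemma pairing_split:
  assumes p: "(k, P) \<in> X"
  shows "norm (L2_inner (g k) (\<phi> P)) \<le> norm (L2_inner (good k) (\<phi> P)) + (\<Sum>J\<in>\<J>. norm (L2_inner (bad k J) (\<phi> P)))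
    + norm (L2_inner (\<lambda>x. indicator (- R) x * g k x) (\<phi> P))"
proof -
  have pT: "(k, P) \<in> T" using p X by blast
  have k: "k \<in> {1..N}" using pT index by blast
  have s: "g k x = good k x + (\<Sum>J\<in>\<J>. bad k J x) + indicator (- R) x * g k x" for x
  proof (cases "x \<in> R")
    case True
    then obtain J0 where J0: "J0 \<in> \<J>" "x \<in> J0" using Union\<J> by blast
    show ?thesis
      unfolding good_def bad_def sum_indicator_disjoint[OF fin\<J> disj\<J> J0] using True by simp
  next
    case False
    hence "indicator J x = (0::complex)" if "J \<in> \<J>" for J
      using \<J>D(3)[OF that] by (auto simp: indicator_def)
    thus ?thesis using False by (simp add: good_def bad_def)
  qed
  note i1 = packet_pairing_integrable[OF pT bdd_supp_good[of k]]
  note i2 = packet_pairing_integrable[OF pT bdd_supp_bad[OF k]]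
  note i3 = packet_pairing_integrable[OF pT bdd_supp_indicator[OF g[OF k] compl_R]]
  have "g k x * cnj (\<phi> P x) = good k x * cnj (\<phi> P x) + (\<Sum>J\<in>\<J>. bad k J x * cnj (\<phi> P x)) + indicator (- R) x * g k x * cnj (\<phi> P x)" for x
    by (subst s) (simp add: distrib_right sum_distrib_right)
  hence "L2_inner (g k) (\<phi> P) = (LINT x|lborel. good k x * cnj (\<phi> P x) + (\<Sum>J\<in>\<J>. bad k J x * cnj (\<phi> P x)) + indicator (- R) x * g k x * cnj (\<phi> P x))"
    unfolding L2_inner_def by (simp only:)
  also have "\<dots> = L2_inner (good k) (\<phi> P) + (\<Sum>J\<in>\<J>. L2_inner (bad k J) (\<phi> P)) + L2_inner (\<lambda>x. indicator (- R) x * g k x) (\<phi> P)"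
    unfolding L2_inner_def
    by (subst Bochner_Integration.integral_add[OF Bochner_Integration.integrable_add[OF i1 Bochner_Integration.integrable_sum[OF i2]] i3], assumption,
        subst Bochner_Integration.integral_add[OF i1 Bochner_Integration.integrable_sum[OF i2]], assumption,
        subst Bochner_Integration.integral_sum[OF i2], assumption, rule refl)
  finally have e: "L2_inner (g k) (\<phi> P) = \<dots>" .
  have "norm (\<Sum>J\<in>\<J>. L2_inner (bad k J) (\<phi> P)) \<le> (\<Sum>J\<in>\<J>. norm (L2_inner (bad k J) (\<phi> P)))" by (rule norm_sum)
  thus ?thesis
    unfolding e by (intro order_trans[OF norm_triangle_ineq] add_mono order_trans[OF norm_triangle_ineq]) auto
qed

text \<open>The good part, the bad parts summed over \<open>\<J>\<close> and the part outside
  \<open>R\<close> all scale like \<open>len R * (sqrt \<Psi> * \<Gamma>)\<close>; 2560 = 4 * 640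
  and 61440 = 51200 + 10240.\<close>

lemma stopped_estimate:
  "(\<Sum>(k, P)\<in>X. len (fst P) * norm (L2_inner f (\<phi> P)) * norm (L2_inner (g k) (\<phi> P)))
    \<le> (2560 * C0 * sqrt (1310752 * C0\<^sup>2) + sqrt (40960 * C0\<^sup>2 * real n) * (8 * C1 + 61440 * C0)) * (len R * (sqrt \<Psi> * \<Gamma>))"
proof -
  let ?c = "\<lambda>k P. len (fst P) * norm (L2_inner f (\<phi> P))"
  let ?o = "\<lambda>k P. norm (L2_inner (\<lambda>x. indicator (- R) x * g k x) (\<phi> P))"
  have "(\<Sum>(k, P)\<in>X. ?c k P * norm (L2_inner (g k) (\<phi> P))) \<le>
    (\<Sum>(k, P)\<in>X. ?c k P * norm (L2_inner (good k) (\<phi> P)) + (\<Sum>J\<in>\<J>. ?c k P * norm (L2_inner (bad k J) (\<phi> P))) + ?c k P * ?o k P)"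
  proof (rule sum_mono, clarify)
    fix k A W assume p: "(k, A, W) \<in> X"
    have "?c k (A, W) * norm (L2_inner (g k) (\<phi> (A, W))) \<le> ?c k (A, W) * (norm (L2_inner (good k) (\<phi> (A, W))) +
      (\<Sum>J\<in>\<J>. norm (L2_inner (bad k J) (\<phi> (A, W)))) + ?o k (A, W))"
      by (rule mult_left_mono[OF pairing_split[OF p]]) simp
    thus "?c k (A, W) * norm (L2_inner (g k) (\<phi> (A, W))) \<le> ?c k (A, W) * norm (L2_inner (good k) (\<phi> (A, W))) +
      (\<Sum>J\<in>\<J>. ?c k (A, W) * norm (L2_inner (bad k J) (\<phi> (A, W)))) + ?c k (A, W) * ?o k (A, W)"
      by (simp only: distrib_left sum_distrib_left)
  qed
  also have "\<dots> = (\<Sum>(k, P)\<in>X. ?c k P * norm (L2_inner (good k) (\<phi> P))) +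
     (\<Sum>J\<in>\<J>. \<Sum>(k, P)\<in>X. ?c k P * norm (L2_inner (bad k J) (\<phi> P))) + (\<Sum>(k, P)\<in>X. ?c k P * ?o k P)"
    by (rule sum_pairs_distrib)
  also have "\<dots> \<le> sqrt (1310752 * C0\<^sup>2 * \<Psi> * len R) * sqrt (16 * C0\<^sup>2 * ((640 * \<Gamma>)\<^sup>2 * len R)) +
     (\<Sum>J\<in>\<J>. \<F> * (8 * C1 * (LINT x|lborel. indicator J x * L x) + 51200 * C0 * \<Gamma> * len J)) + 10240 * C0 * \<F> * \<Gamma> * len R"
    by (intro add_mono good_estimate sum_mono bad_estimate_single outside_estimate)
  finally have A: "(\<Sum>(k, P)\<in>X. ?c k P * norm (L2_inner (g k) (\<phi> P))) \<le> sqrt (1310752 * C0\<^sup>2 * \<Psi> * len R) * sqrt (16 * C0\<^sup>2 * ((640 * \<Gamma>)\<^sup>2 * len R)) +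
     (\<Sum>J\<in>\<J>. \<F> * (8 * C1 * (LINT x|lborel. indicator J x * L x) + 51200 * C0 * \<Gamma> * len J)) + 10240 * C0 * \<F> * \<Gamma> * len R" .
  have "(\<Sum>J\<in>\<J>. \<F> * (8 * C1 * (LINT x|lborel. indicator J x * L x) + 51200 * C0 * \<Gamma> * len J)) =
     \<F> * (8 * C1 * (\<Sum>J\<in>\<J>. (LINT x|lborel. indicator J x * L x)) + 51200 * C0 * \<Gamma> * (\<Sum>J\<in>\<J>. len J))"
    by (simp only: sum_distrib_left sum.distrib distrib_left)
  also have "\<dots> \<le> \<F> * (8 * C1 * (\<Gamma> * len R) + 51200 * C0 * \<Gamma> * len R)"
    unfolding sum_len_\<J> using C1 \<F>0 sum_\<J>_L by (intro mult_left_mono add_right_mono) auto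
  finally have B: "(\<Sum>J\<in>\<J>. \<F> * (8 * C1 * (LINT x|lborel. indicator J x * L x) + 51200 * C0 * \<Gamma> * len J)) \<le> \<dots>" .
  have Fs: "\<F> = sqrt (40960 * C0\<^sup>2 * real n) * sqrt \<Psi>" by (simp add: \<F>_def real_sqrt_mult)
  have sl: "sqrt (len R) * sqrt (len R) = len R" using lR by simp
  have G: "sqrt (1310752 * C0\<^sup>2 * \<Psi> * len R) * sqrt (16 * C0\<^sup>2 * ((640 * \<Gamma>)\<^sup>2 * len R)) =
     2560 * C0 * sqrt (1310752 * C0\<^sup>2) * (len R * (sqrt \<Psi> * \<Gamma>))"
  proof -
    have "sqrt (16 * C0\<^sup>2 * ((640 * \<Gamma>)\<^sup>2 * len R)) = 2560 * C0 * \<Gamma> * sqrt (len R)"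
      using C0 \<Gamma>0 by (simp add: real_sqrt_mult)
    moreover have "sqrt (1310752 * C0\<^sup>2 * \<Psi> * len R) = sqrt (1310752 * C0\<^sup>2) * sqrt \<Psi> * sqrt (len R)"
      by (simp only: real_sqrt_mult)
    ultimately have "sqrt (1310752 * C0\<^sup>2 * \<Psi> * len R) * sqrt (16 * C0\<^sup>2 * ((640 * \<Gamma>)\<^sup>2 * len R)) =
      2560 * C0 * sqrt (1310752 * C0\<^sup>2) * ((sqrt (len R) * sqrt (len R)) * (sqrt \<Psi> * \<Gamma>))" by (simp only: mult_ac)
    thus ?thesis unfolding sl .
  qed
  have "\<F> * (8 * C1 * (\<Gamma> * len R) + 51200 * C0 * \<Gamma> * len R) + 10240 * C0 * \<F> * \<Gamma> * len R =
     sqrt (40960 * C0\<^sup>2 * real n) * (8 * C1 + 61440 * C0) * (len R * (sqrt \<Psi> * \<Gamma>))"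
    unfolding Fs by algebra
  thus ?thesis using A B unfolding G by (simp only: distrib_right)
qed

end

section \<open>Selection of the sparse family\<close>

lemma avg_two_eq:
  fixes f :: "real \<Rightarrow> complex"
  shows "avg 2 I f = sqrt ((LINT x|lborel. indicator I x * (norm (f x))\<^sup>2) / len I)"
proof -
  have "(LINT x:I|lborel. norm (f x) powr 2) = (LINT x|lborel. indicator I x * (norm (f x))\<^sup>2)"
    by (simp add: set_lebesgue_integral_def powr_numeral)
  moreover have "0 \<le> (LINT x|lborel. indicator I x * (norm (f x))\<^sup>2) / len I"
    by (intro divide_nonneg_nonneg integral_nonneg_AE AE_I2) auto
  ultimately show ?thesis unfolding avg_def by (simp add: powr_half_sqrt)
qed

lemma avg_one_eq:
  fixes h :: "real \<Rightarrow> real"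
  assumes "\<And>x. h x \<ge> 0"
  shows "avg 1 I h = (LINT x|lborel. indicator I x * h x) / len I"
proof -
  have "(LINT x:I|lborel. norm (h x) powr 1) = (LINT x|lborel. indicator I x * h x)"
    using assms by (simp add: set_lebesgue_integral_def)
  moreover have "0 \<le> (LINT x|lborel. indicator I x * h x)"
    by (intro integral_nonneg_AE AE_I2) (auto simp: assms)
  ultimately show ?thesis unfolding avg_def by (simp add: abs_mult)
qed

text \<open>Plain averages require no covering argument: the integrals over the disjoint
  \<open>J\<close> add up to at most the integral over \<open>I\<close>.\<close>

lemma mean_packing:
  assumes h: "bdd_supp h" "\<And>x. h x \<ge> (0::real)" and I: "ivl I" and fin: "finite \<J>" and disj: "disjoint \<J>"
    and J: "\<And>J. J \<in> \<J> \<Longrightarrow> ivl J \<and> J \<subseteq> I" and c: "c > 0"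
    and big: "\<And>J. J \<in> \<J> \<Longrightarrow> c * ((LINT x|lborel. indicator I x * h x) / len I) < (LINT x|lborel. indicator J x * h x) / len J"
  shows "(\<Sum>J\<in>\<J>. len J) \<le> len I / c"
proof (cases "\<J> = {}")
  case False
  let ?M = "\<lambda>A. LINT x|lborel. indicator A x * h x"
  have l: "len I > 0" by (rule ivlD(1)[OF I])
  have lJ: "len J > 0" if "J \<in> \<J>" for J using J[OF that] ivlD(1) by blast
  have s: "(\<Sum>J\<in>\<J>. ?M J) \<le> ?M I"
  proof (rule sum_disjoint_integral_le[OF fin])
    show "disjoint_family_on (\<lambda>J. J) \<J>"
      using disj by (auto simp: disjoint_family_on_def disjoint_def pairwise_def disjnt_def)
  qed (use J ivlD(4) ivlD(4)[OF I] bdd_supp_integrable[OF h(1)] h(2) in auto)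
  have M0: "?M A \<ge> 0" for A by (intro integral_nonneg_AE AE_I2) (simp add: h)
  have b: "c * ?M I / len I * len J < ?M J" if "J \<in> \<J>" for J
    using big[OF that] lJ[OF that] by (simp add: less_divide_eq)
  have pos: "?M I > 0"
  proof (rule ccontr)
    assume "\<not> ?M I > 0"
    hence z: "?M I = 0" using M0[of I] by simp
    obtain J0 where J0: "J0 \<in> \<J>" using False by blast
    have "?M J0 \<le> (\<Sum>J\<in>\<J>. ?M J)" by (rule member_le_sum[OF J0 M0 fin])
    thus False using b[OF J0] s z by simp
  qed
  have "c * ?M I / len I * (\<Sum>J\<in>\<J>. len J) = (\<Sum>J\<in>\<J>. c * ?M I / len I * len J)" by (rule sum_distrib_left)
  also have "\<dots> \<le> (\<Sum>J\<in>\<J>. ?M J)" using b by (intro sum_mono less_imp_le)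
  also have "\<dots> \<le> ?M I" by (rule s)
  finally have "?M I * (c / len I * (\<Sum>J\<in>\<J>. len J)) \<le> ?M I * 1" by (simp add: mult_ac)
  hence "c / len I * (\<Sum>J\<in>\<J>. len J) \<le> 1" using pos by (rule mult_left_le_imp_le)
  thus ?thesis using l c by (simp add: field_simps)
qed (use ivlD(1)[OF I] c in simp)

text \<open>The grids with shifts 0 and 1/3 have no two endpoints closer than a third of the common length.\<close>

lemma two_grids_cover:
  assumes t: "t > 0"
  shows "\<exists>H s. s \<in> {0, 1/3} \<and> H \<in> shifted_dyadic s \<and> {x..x + t} \<subseteq> H \<and> len H \<le> 6 * t"
proof -
  \<comment> \<open>The cell length exceeds \<open>3 * t\<close>, so that an interval of length
    \<open>t\<close> cannot contain endpoints from both grids, and it is at most the claimed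
    \<open>6 * t\<close>.\<close>
  obtain i where i: "3 * t < 2 powi i" "2 powi i \<le> 2 * (3 * t)" using power_two_between[of "3 * t"] t by auto
  define k where "k = - i"
  define \<epsilon> where "\<epsilon> = (-1::real) powi k"
  have \<epsilon>: "\<epsilon> = 1 \<or> \<epsilon> = -1" by (auto simp: \<epsilon>_def power_int_def minus_one_power_iff)
  let ?l = "(2::real) powi i"
  obtain m where m: "x \<in> cell 0 k m" using cell_containing by blast
  obtain j where j: "x \<in> cell (1/3) k j" using cell_containing by blast
  have g0: "gridpt 0 k m' = ?l * of_int m'" for m' by (simp add: gridpt_def k_def)
  have g1: "gridpt (1/3) k m' = ?l * (of_int m' + \<epsilon> / 3)" for m' by (simp add: gridpt_def k_def \<epsilon>_def)
  have m': "?l * of_int m \<le> x" "x < ?l * of_int (m + 1)" using m unfolding cell_def g0 by auto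
  have j': "?l * (of_int j + \<epsilon> / 3) \<le> x" "x < ?l * (of_int (j + 1) + \<epsilon> / 3)" using j unfolding cell_def g1 by auto
  \<comment> \<open>Otherwise the right endpoints of both cells are within \<open>t\<close> of each
    other, and \<open>3 * (m - j) - \<epsilon>\<close> is an integer of absolute value below 1; it
    is not 0 because \<open>\<epsilon>\<close> is 1 or -1.\<close>
  have "x + t < ?l * of_int (m + 1) \<or> x + t < ?l * (of_int (j + 1) + \<epsilon> / 3)"
  proof (rule ccontr)
    assume "\<not> ?thesis"
    hence a: "?l * of_int (m + 1) \<le> x + t" "?l * (of_int (j + 1) + \<epsilon> / 3) \<le> x + t" by auto
    have "?l * \<bar>of_int (m + 1) - (of_int (j + 1) + \<epsilon> / 3)\<bar> = \<bar>?l * of_int (m + 1) - ?l * (of_int (j + 1) + \<epsilon> / 3)\<bar>"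
      by (simp add: abs_mult right_diff_distrib[symmetric] del: of_int_add)
    also have "\<dots> \<le> t" using a m' j' by linarith
    also have "\<dots> < ?l * (1 / 3)" using i by simp
    finally have "\<bar>of_int (m + 1) - (of_int (j + 1) + \<epsilon> / 3)\<bar> < 1 / 3" by (rule mult_left_less_imp_less) simp
    moreover have "of_int (m + 1) - (of_int (j + 1) + \<epsilon> / 3) = of_int (m - j) - \<epsilon> / 3" by simp
    ultimately have "\<bar>of_int (m - j) - \<epsilon> / 3\<bar> < 1 / 3" by (simp only:)
    moreover have "\<bar>3 * z - \<epsilon>\<bar> < 1" if "\<bar>z - \<epsilon> / 3\<bar> < 1 / 3" for z
      using that by linarith
    ultimately have "\<bar>3 * real_of_int (m - j) - \<epsilon>\<bar> < 1" by blast
    moreover obtain e :: int where e: "\<epsilon> = of_int e" "e = 1 \<or> e = -1" using \<epsilon> by (metis of_int_1 of_int_minus)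
    ultimately have "\<bar>real_of_int (3 * (m - j) - e)\<bar> < 1" by simp
    hence "\<bar>3 * (m - j) - e\<bar> < 1" by linarith
    thus False using e(2) by presburger
  qed
  thus ?thesis
  proof
    assume "x + t < ?l * of_int (m + 1)"
    hence "{x..x + t} \<subseteq> cell 0 k m" using m' unfolding cell_def g0 by auto
    moreover have "len (cell 0 k m) \<le> 6 * t" using i by (simp add: len_cell k_def)
    ultimately show ?thesis by (intro exI[of _ "cell 0 k m"] exI[of _ 0]) (auto simp: shifted_dyadic_cell)
  next
    assume "x + t < ?l * (of_int (j + 1) + \<epsilon> / 3)"
    hence "{x..x + t} \<subseteq> cell (1/3) k j" using j' unfolding cell_def g1 by auto
    moreover have "len (cell (1/3) k j) \<le> 6 * t" using i by (simp add: len_cell k_def)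
    ultimately show ?thesis by (intro exI[of _ "cell (1/3) k j"] exI[of _ "1/3"]) (auto simp: shifted_dyadic_cell)
  qed
qed

lemma sparse_witness_sparse_family:
  assumes "sparse_witness S E" "\<And>I. I \<in> S \<Longrightarrow> ivl I"
  shows "sparse_family (1/6) S"
  unfolding sparse_family_def
proof (intro conjI exI[of _ E] ballI)
  fix I assume I: "I \<in> S"
  obtain \<alpha> \<beta> where J: "\<alpha> < \<beta>" "I = {\<alpha>..<\<beta>}" using assms(2)[OF I] by (auto simp: ivl_def)
  show "is_interval I" "bounded I" unfolding J(2) by (auto simp: is_interval_co)
  show "len I > 0" using J by simp
  show "E I \<in> sets lborel" "E I \<subseteq> I" using assms(1) I by (auto simp: sparse_witness_def)
  have "len I / 2 \<le> len (E I)" using assms(1) I by (simp add: sparse_witness_def)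
  moreover have "len I \<ge> 0" by simp
  ultimately show "1 / 6 * len I \<le> len (E I)" by linarith
qed (use assms(1) in \<open>simp add: sparse_witness_def\<close>)

definition pair_avg :: "(real \<Rightarrow> complex) \<Rightarrow> (real \<Rightarrow> real) \<Rightarrow> real set \<Rightarrow> real"
  where "pair_avg f h I = avg 2 I f * avg 1 I h"

context
  fixes f :: "real \<Rightarrow> complex" and h :: "real \<Rightarrow> real"
  assumes f: "bdd_supp f" and h: "bdd_supp h" "\<And>x. h x \<ge> 0"
begin

abbreviation "fsq \<equiv> \<lambda>x. (norm (f x))\<^sup>2"

lemma fsq: "bdd_supp fsq" "\<And>x. fsq x \<ge> 0"
  by (rule bdd_supp_norm_square[OF f]) simp

lemma pair_avg_nonneg: "pair_avg f h I \<ge> 0"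
  unfolding pair_avg_def avg_def by simp

text \<open>If the product grows more than 16 times, one factor grows more than 4 times. For
  \<open>f\<close> this means 16 times for the average of the square, so the two kinds of intervals
  fill at most 1/16 and 1/4 of \<open>I\<close>.\<close>

lemma pair_avg_packing:
  assumes I: "ivl I" and fin: "finite \<J>" and disj: "disjoint \<J>"
    and J: "\<And>J. J \<in> \<J> \<Longrightarrow> ivl J \<and> J \<subseteq> I \<and> 16 * pair_avg f h I < pair_avg f h J"
  shows "(\<Sum>J\<in>\<J>. len J) \<le> len I / 2"
proof -
  let ?A = "{J \<in> \<J>. 4 * avg 2 I f < avg 2 J f}"
  have a0: "avg 2 J f \<ge> 0" "avg 1 J h \<ge> 0" for J by (simp_all add: avg_def)
  have sub: "disjoint ?A" "disjoint (\<J> - ?A)" using disj by (auto simp: disjoint_def pairwise_def)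
  have 1: "(\<Sum>J\<in>?A. len J) \<le> len I / 16"
  proof (rule mean_packing[OF fsq I _ sub(1)])
    fix J assume "J \<in> ?A"
    hence "4 * avg 2 I f < avg 2 J f" by simp
    hence "(4 * avg 2 I f)\<^sup>2 < (avg 2 J f)\<^sup>2" using a0 by (intro power_strict_mono) auto
    moreover have "(avg 2 K f)\<^sup>2 = (LINT x|lborel. indicator K x * fsq x) / len K" for K
      unfolding avg_two_eq by (rule real_sqrt_pow2) (intro divide_nonneg_nonneg integral_nonneg_AE AE_I2, auto)
    ultimately show "16 * ((LINT x|lborel. indicator I x * fsq x) / len I) < (LINT x|lborel. indicator J x * fsq x) / len J"
      by (simp add: power_mult_distrib)
  qed (use fin J in auto)
  have 2: "(\<Sum>J\<in>\<J> - ?A. len J) \<le> len I / 4"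
  proof (rule mean_packing[OF h I _ sub(2)])
    fix J assume "J \<in> \<J> - ?A"
    hence J': "16 * pair_avg f h I < pair_avg f h J" "avg 2 J f \<le> 4 * avg 2 I f" using J by auto
    have "4 * avg 1 I h < avg 1 J h"
    proof (rule ccontr)
      assume "\<not> 4 * avg 1 I h < avg 1 J h"
      hence "avg 2 J f * avg 1 J h \<le> (4 * avg 2 I f) * (4 * avg 1 I h)"
        using J'(2) a0 by (intro mult_mono) auto
      thus False using J'(1) by (simp add: pair_avg_def)
    qed
    thus "4 * ((LINT x|lborel. indicator I x * h x) / len I) < (LINT x|lborel. indicator J x * h x) / len J"
      by (simp add: avg_one_eq[OF h(2)])
  qed (use fin J in auto)
  have "(\<Sum>J\<in>\<J>. len J) = (\<Sum>J\<in>?A. len J) + (\<Sum>J\<in>\<J> - ?A. len J)"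
    using fin by (subst sum.subset_diff[of ?A \<J>]) auto
  moreover have "len I \<ge> 0" by simp
  ultimately show ?thesis using 1 2 by linarith
qed

text \<open>The dilates \<open>r\<close> and \<open>q\<close> that nearly attain the two suprema may
  differ, and averaging both functions over a cover \<open>H\<close> of the larger one loses powers
  of their ratio. The normalization by cubes in \<open>Phi\<close> absorbs the loss, in the form
  \<open>real m ^ 3 \<le> real r ^ 3 * real q ^ 6\<close>. The constant:
  \<open>8 * 12 ^ 3 = 13824 \<le> 118\<^sup>2\<close>.\<close>

lemma Phi_to_average:
  assumes R: "ivl R"
  shows "\<exists>H s. s \<in> {0, 1/3} \<and> H \<in> shifted_dyadic s \<and> R \<subseteq> H \<and> sqrt (Phi fsq R) * Phi h R \<le> 118 * pair_avg f h H"
proof -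
  let ?l = "len R" and ?c = "center R"
  have l: "?l > 0" by (rule ivlD(1)[OF R])
  have P0: "Phi fsq R \<ge> 0" "Phi h R \<ge> 0" by (rule Phi_nonneg[OF fsq l], rule Phi_nonneg[OF h l])
  have Rsub: "R \<subseteq> {?c - real m * ?l..?c - real m * ?l + 2 * (real m * ?l)}" if m: "m \<ge> 1" for m
  proof
    fix x assume "x \<in> R"
    from ivlD(3)[OF R this] have "\<bar>x - ?c\<bar> \<le> ?l" using l by linarith
    also have "?l \<le> real m * ?l" using m l by simp
    finally show "x \<in> {?c - real m * ?l..?c - real m * ?l + 2 * (real m * ?l)}" by (auto simp: abs_le_iff)
  qed
  show ?thesis
  \<comment> \<open>Half of a supremum lies strictly below it only if it is positive, and
    \<open>Phi_witness\<close> requires a value strictly below.\<close>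
  proof (cases "Phi fsq R = 0 \<or> Phi h R = 0")
    case True
    obtain H s where H: "s \<in> {0, 1/3}" "H \<in> shifted_dyadic s" "{?c - real 1 * ?l..?c - real 1 * ?l + 2 * (real 1 * ?l)} \<subseteq> H"
      using two_grids_cover[of "2 * (real 1 * ?l)" "?c - real 1 * ?l"] l by auto
    have "R \<subseteq> H" using Rsub[of 1] H(3) by (meson order_refl order_trans)
    moreover have "sqrt (Phi fsq R) * Phi h R \<le> 118 * pair_avg f h H"
      using True pair_avg_nonneg[of H] by auto
    ultimately show ?thesis using H by blast
  next
    case False
    hence pos: "Phi fsq R > 0" "Phi h R > 0" using P0 by auto
    obtain r where r: "r \<ge> 1" "Phi fsq R / 2 * (real r ^ 3 * ?l) < ball_int fsq ?c (real r * ?l)"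
      using Phi_witness[OF fsq l, of "Phi fsq R / 2"] pos by auto
    obtain q where q: "q \<ge> 1" "Phi h R / 2 * (real q ^ 3 * ?l) < ball_int h ?c (real q * ?l)"
      using Phi_witness[OF h l, of "Phi h R / 2"] pos by auto
    define m where "m = max r q"
    have m: "m \<ge> 1" "real r \<le> real m" "real q \<le> real m" using r q by (auto simp: m_def)
    define t where "t = 2 * (real m * ?l)"
    have t: "t > 0" using m l by (simp add: t_def)
    obtain H s where H: "s \<in> {0, 1/3}" "H \<in> shifted_dyadic s" "{?c - real m * ?l..?c - real m * ?l + t} \<subseteq> H" "len H \<le> 6 * t"
      using two_grids_cover[OF t, of "?c - real m * ?l"] by blast
    have ivH: "ivl H" by (rule grid_is_ivl[OF H(2)])
    have lH: "len H > 0" by (rule ivlD(1)[OF ivH])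
    have RH: "R \<subseteq> H" using Rsub[OF m(1)] H(3) unfolding t_def by (rule order_trans)
    let ?F = "LINT x|lborel. indicator H x * fsq x" and ?G = "LINT x|lborel. indicator H x * h x"
    have ball: "ball_int w ?c (real i * ?l) \<le> (LINT x|lborel. indicator H x * w x)"
      if "bdd_supp w" "\<And>x. w x \<ge> 0" "real i \<le> real m" for w i
      unfolding ball_int_def
    proof (intro integral_mono nonneg_bdd_supp_indicator_integrable that(1,2))
      show "H \<in> sets borel" by (rule ivlD(4)[OF ivH])
      fix x
      have "real i * ?l \<le> real m * ?l" using that(3) l by (intro mult_right_mono) auto
      hence "{?c - real i * ?l..?c + real i * ?l} \<subseteq> {?c - real m * ?l..?c - real m * ?l + t}"
        unfolding t_def by auto
      hence "{?c - real i * ?l..?c + real i * ?l} \<subseteq> H" using H(3) by (rule order_trans)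
      thus "indicator {?c - real i * ?l..?c + real i * ?l} x * w x \<le> indicator H x * w x"
        using that(2)[of x] by (auto simp: indicator_def)
    qed auto
    have bF: "Phi fsq R * (real r ^ 3 * ?l) \<le> 2 * ?F" using r(2) ball[OF fsq m(2)] by linarith
    have bG: "Phi h R * (real q ^ 3 * ?l) \<le> 2 * ?G" using q(2) ball[OF h m(3)] by linarith
    have F0: "?F \<ge> 0" "?G \<ge> 0" by (intro integral_nonneg_AE AE_I2, simp add: h)+
    have r0: "real r > 0" "real q > 0" "real m > 0" using r q m by auto
    \<comment> \<open>The comparison is made for the square of the claim, which removes the root:
      \<open>fsq\<close> enters to the first power and \<open>h\<close> to the second.\<close>
    have "Phi fsq R * (Phi h R)\<^sup>2 * (real r ^ 3 * real q ^ 6 * ?l ^ 3) =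
        (Phi fsq R * (real r ^ 3 * ?l)) * (Phi h R * (real q ^ 3 * ?l))\<^sup>2" by algebra
    also have "\<dots> \<le> (2 * ?F) * (2 * ?G)\<^sup>2"
      by (rule mult_mono[OF bF power_mono[OF bG]]) (use P0 l F0 in auto)
    also have "\<dots> = 8 * (?F * ?G\<^sup>2)" by algebra
    also have "\<dots> = 8 * ((pair_avg f h H)\<^sup>2 * len H ^ 3)"
    proof -
      have "(pair_avg f h H)\<^sup>2 = (?F / len H) * (?G / len H)\<^sup>2"
        unfolding pair_avg_def avg_two_eq avg_one_eq[OF h(2)] power_mult_distrib using F0 lH by simp
      thus ?thesis using lH by (simp add: field_simps eval_nat_numeral)
    qed
    also have "\<dots> \<le> 8 * ((pair_avg f h H)\<^sup>2 * (12 * (real m * ?l)) ^ 3)"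
      using H(4) lH unfolding t_def by (intro mult_left_mono power_mono) auto
    also have "\<dots> = 13824 * (pair_avg f h H)\<^sup>2 * (real m ^ 3 * ?l ^ 3)" by algebra
    also have "\<dots> \<le> 13824 * (pair_avg f h H)\<^sup>2 * ((real r ^ 3 * real q ^ 6) * ?l ^ 3)"
    proof (intro mult_left_mono mult_right_mono)
      show "real m ^ 3 \<le> real r ^ 3 * real q ^ 6"
      proof (cases "r \<le> q")
        case True
        have "1 * real q ^ 3 \<le> real r ^ 3 * real q ^ 6"
          using r(1) q(1) by (intro mult_mono one_le_power power_increasing) auto
        thus ?thesis using True by (simp add: m_def)
      next
        case False
        have "real r ^ 3 * 1 \<le> real r ^ 3 * real q ^ 6"
          using r(1) q(1) by (intro mult_mono one_le_power) auto
        thus ?thesis using False by (simp add: m_def)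
      qed
    qed (use l in auto)
    finally have "(real r ^ 3 * real q ^ 6 * ?l ^ 3) * (Phi fsq R * (Phi h R)\<^sup>2) \<le> (real r ^ 3 * real q ^ 6 * ?l ^ 3) * (13824 * (pair_avg f h H)\<^sup>2)"
      by (simp only: mult_ac)
    hence "Phi fsq R * (Phi h R)\<^sup>2 \<le> 13824 * (pair_avg f h H)\<^sup>2"
      by (rule mult_left_le_imp_le) (use r0 l in simp)
    also have "\<dots> \<le> (118 * pair_avg f h H)\<^sup>2" by (simp add: power_mult_distrib)
    finally have "(sqrt (Phi fsq R) * Phi h R)\<^sup>2 \<le> (118 * pair_avg f h H)\<^sup>2"
      using P0 by (simp add: power_mult_distrib)
    hence "sqrt (Phi fsq R) * Phi h R \<le> 118 * pair_avg f h H"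
      by (rule power2_le_imp_le) (use pair_avg_nonneg[of H] in simp)
    thus ?thesis using H RH by blast
  qed
qed

text \<open>The intervals \<open>H R\<close> need not be sparse, and many \<open>R\<close> may share
  one of them. Principal intervals are selected among them; each \<open>R\<close> is charged to a
  principal \<open>Q\<close> containing it, and by \<open>sparse_carleson\<close> for the old family
  the lengths charged to \<open>Q\<close> add up to at most \<open>2 * len Q\<close>. Hence 32 = 16
  * 2.\<close>

lemma sparse_selection:
  assumes S: "finite S" "\<And>R. R \<in> S \<Longrightarrow> ivl R" and E: "sparse_witness S E"
    and A: "A \<subseteq> S" and s: "3 * s \<in> \<int>" and H: "\<And>R. R \<in> A \<Longrightarrow> H R \<in> shifted_dyadic s \<and> R \<subseteq> H R"
  shows "\<exists>S'. finite S' \<and> sparse_family (1/6) S' \<and>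
    (\<Sum>R\<in>A. len R * pair_avg f h (H R)) \<le> 32 * (\<Sum>Q\<in>S'. len Q * pair_avg f h Q)"
proof -
  let ?\<I> = "H ` A"
  have finA: "finite A" using S(1) A finite_subset by blast
  have iv: "ivl I" if "I \<in> ?\<I>" for I using that H grid_is_ivl by blast
  have lam: "laminar ?\<I>" using grid_laminar[OF s] H unfolding laminar_def by blast
  have "\<exists>S E. S \<subseteq> ?\<I> \<and> sparse_witness S E \<and>
    (\<forall>I\<in>?\<I>. \<exists>R\<in>S. I \<subseteq> R \<and> (\<forall>I'\<in>?\<I>. I \<subseteq> I' \<longrightarrow> I' \<subseteq> R \<longrightarrow> \<not> 16 * pair_avg f h R < pair_avg f h I'))"
  proof (rule principal_family[OF _ lam iv])
    show "finite ?\<I>" using finA by simp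
    fix R \<J> assume a: "R \<in> ?\<I>" "\<J> \<subseteq> ?\<I>" "disjoint \<J>" "\<And>J. J \<in> \<J> \<Longrightarrow> J \<subseteq> R \<and> 16 * pair_avg f h R < pair_avg f h J"
    show "(\<Sum>J\<in>\<J>. len J) \<le> len R / 2"
    proof (rule pair_avg_packing[OF iv[OF a(1)] _ a(3)])
      show "finite \<J>" using a(2) finA finite_subset[of \<J> ?\<I>] by simp
      show "ivl J \<and> J \<subseteq> R \<and> 16 * pair_avg f h R < pair_avg f h J" if "J \<in> \<J>" for J
        using a(4)[OF that] iv[of J] a(2) that by auto
    qed
  qed auto
  then obtain S' E' where S': "S' \<subseteq> ?\<I>" and E': "sparse_witness S' E'"
    and cov: "\<forall>I\<in>?\<I>. \<exists>R\<in>S'. I \<subseteq> R \<and> (\<forall>I'\<in>?\<I>. I \<subseteq> I' \<longrightarrow> I' \<subseteq> R \<longrightarrow> \<not> 16 * pair_avg f h R < pair_avg f h I')"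
    by (elim exE conjE) (rule that)
  have finS': "finite S'" using S' finA finite_subset by blast
  have "\<forall>R\<in>A. \<exists>Q\<in>S'. R \<subseteq> Q \<and> pair_avg f h (H R) \<le> 16 * pair_avg f h Q"
  proof
    fix R assume R: "R \<in> A"
    have "\<exists>Q\<in>S'. H R \<subseteq> Q \<and> (\<forall>I'\<in>?\<I>. H R \<subseteq> I' \<longrightarrow> I' \<subseteq> Q \<longrightarrow> \<not> 16 * pair_avg f h Q < pair_avg f h I')"
      using cov R by simp
    then obtain Q where Q: "Q \<in> S'" "H R \<subseteq> Q" "\<forall>I'\<in>?\<I>. H R \<subseteq> I' \<longrightarrow> I' \<subseteq> Q \<longrightarrow> \<not> 16 * pair_avg f h Q < pair_avg f h I'"
      by (elim bexE conjE)
    have "\<not> 16 * pair_avg f h Q < pair_avg f h (H R)" using Q(2,3) R by simp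
    thus "\<exists>Q\<in>S'. R \<subseteq> Q \<and> pair_avg f h (H R) \<le> 16 * pair_avg f h Q" using Q(1,2) H[OF R] by (intro bexI[of _ Q]) auto
  qed
  then obtain Q where Q: "\<And>R. R \<in> A \<Longrightarrow> Q R \<in> S' \<and> R \<subseteq> Q R \<and> pair_avg f h (H R) \<le> 16 * pair_avg f h (Q R)"
    by metis
  have "(\<Sum>R\<in>A. len R * pair_avg f h (H R)) \<le> (\<Sum>R\<in>A. len R * (16 * pair_avg f h (Q R)))"
    using Q by (intro sum_mono mult_left_mono) auto
  also have "\<dots> = (\<Sum>Y\<in>S'. \<Sum>R\<in>{R \<in> A. Q R = Y}. len R * (16 * pair_avg f h (Q R)))"
    by (rule sum.group[symmetric, OF finA finS']) (use Q in auto)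
  also have "\<dots> = (\<Sum>Y\<in>S'. 16 * pair_avg f h Y * (\<Sum>R\<in>{R \<in> A. Q R = Y}. len R))"
    unfolding sum_distrib_left by (intro sum.cong refl) auto
  also have "\<dots> \<le> (\<Sum>Y\<in>S'. 16 * pair_avg f h Y * (2 * len Y))"
  proof (intro sum_mono mult_left_mono)
    fix Y assume "Y \<in> S'"
    show "(\<Sum>R\<in>{R \<in> A. Q R = Y}. len R) \<le> 2 * len Y"
      by (rule sparse_carleson[OF E]) (use finA A Q ivlD(5)[OF iv] S' \<open>Y \<in> S'\<close> in auto)
    show "0 \<le> 16 * pair_avg f h Y" using pair_avg_nonneg[of Y] by simp
  qed
  also have "\<dots> = 32 * (\<Sum>Q\<in>S'. len Q * pair_avg f h Q)" by (simp add: sum_distrib_left mult_ac)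
  finally have "(\<Sum>R\<in>A. len R * pair_avg f h (H R)) \<le> 32 * (\<Sum>Q\<in>S'. len Q * pair_avg f h Q)" .
  moreover have "sparse_family (1/6) S'"
    by (rule sparse_witness_sparse_family[OF E']) (use S' iv in blast)
  ultimately show ?thesis using finS' by blast
qed

lemma le_of_two_parts:
  fixes x p q u v :: real
  assumes "x \<le> 118 * (p + q)" "p \<le> 32 * u" "q \<le> 32 * v" "u \<le> v"
  shows "x \<le> 7552 * v"
proof -
  have "118 * (p + q) \<le> 118 * (64 * v)" using assms by (intro mult_left_mono) linarith+
  thus ?thesis using assms(1) by simp
qed

text \<open>The intervals \<open>H R\<close> come from two grids, which together are not laminar, so
  the selection runs in each grid separately. Only the family with the larger sum is kept, since a
  union need not have disjoint portions; 7552 = 118 * (32 + 32).\<close>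

lemma sparse_domination_of_Phi_sum:
  assumes S: "finite S" "\<And>R. R \<in> S \<Longrightarrow> ivl R" and E: "sparse_witness S E"
  shows "\<exists>S'. finite S' \<and> sparse_family (1/6) S' \<and>
    (\<Sum>R\<in>S. len R * (sqrt (Phi fsq R) * Phi h R)) \<le> 7552 * (\<Sum>Q\<in>S'. len Q * pair_avg f h Q)"
proof -
  have "\<forall>R\<in>S. \<exists>H s. s \<in> {0, 1/3} \<and> H \<in> shifted_dyadic s \<and> R \<subseteq> H \<and> sqrt (Phi fsq R) * Phi h R \<le> 118 * pair_avg f h H"
    using Phi_to_average S(2) by blast
  then obtain H s where H: "\<And>R. R \<in> S \<Longrightarrow> s R \<in> {0, 1/3::real} \<and> H R \<in> shifted_dyadic (s R) \<and> R \<subseteq> H R \<and> sqrt (Phi fsq R) * Phi h R \<le> 118 * pair_avg f h (H R)"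
    by metis
  let ?A = "\<lambda>t. {R \<in> S. s R = t}"
  let ?W = "\<lambda>A. \<Sum>R\<in>A. len R * pair_avg f h (H R)"
  have "(\<Sum>R\<in>S. len R * (sqrt (Phi fsq R) * Phi h R)) \<le> (\<Sum>R\<in>S. len R * (118 * pair_avg f h (H R)))"
    using H by (intro sum_mono mult_left_mono) auto
  also have "\<dots> = 118 * ?W S" by (simp add: sum_distrib_left mult_ac)
  also have "?W S = ?W (?A 0) + ?W (?A (1/3))"
    using S(1) H by (subst sum.union_disjoint[symmetric]) (auto intro!: sum.cong)
  finally have 1: "(\<Sum>R\<in>S. len R * (sqrt (Phi fsq R) * Phi h R)) \<le> 118 * (?W (?A 0) + ?W (?A (1/3)))" .
  have H0: "H R \<in> shifted_dyadic 0 \<and> R \<subseteq> H R" if "R \<in> ?A 0" for R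
    using H[of R] that by auto
  have H1: "H R \<in> shifted_dyadic (1/3) \<and> R \<subseteq> H R" if "R \<in> ?A (1/3)" for R
  proof -
    have "s R = 1/3" "H R \<in> shifted_dyadic (s R) \<and> R \<subseteq> H R" using H that by blast+
    thus ?thesis by (simp only:)
  qed
  have "\<exists>S'. finite S' \<and> sparse_family (1/6) S' \<and> ?W (?A 0) \<le> 32 * (\<Sum>Q\<in>S'. len Q * pair_avg f h Q)"
    by (rule sparse_selection[OF S E _ _ H0]) auto
  then obtain S0 where S0: "finite S0" "sparse_family (1/6) S0" "?W (?A 0) \<le> 32 * (\<Sum>Q\<in>S0. len Q * pair_avg f h Q)"
    by blast
  have "\<exists>S'. finite S' \<and> sparse_family (1/6) S' \<and> ?W (?A (1/3)) \<le> 32 * (\<Sum>Q\<in>S'. len Q * pair_avg f h Q)"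
    by (rule sparse_selection[OF S E _ _ H1]) auto
  then obtain S1 where S1: "finite S1" "sparse_family (1/6) S1" "?W (?A (1/3)) \<le> 32 * (\<Sum>Q\<in>S1. len Q * pair_avg f h Q)"
    by blast
  show ?thesis
  proof (cases "(\<Sum>Q\<in>S0. len Q * pair_avg f h Q) \<le> (\<Sum>Q\<in>S1. len Q * pair_avg f h Q)")
    case True
    hence "(\<Sum>R\<in>S. len R * (sqrt (Phi fsq R) * Phi h R)) \<le> 7552 * (\<Sum>Q\<in>S1. len Q * pair_avg f h Q)"
      by (rule le_of_two_parts[OF 1 S0(3) S1(3)])
    thus ?thesis using S1(1,2) by blast
  next
    case False
    hence "(\<Sum>R\<in>S. len R * (sqrt (Phi fsq R) * Phi h R)) \<le> 7552 * (\<Sum>Q\<in>S0. len Q * pair_avg f h Q)"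
      using le_of_two_parts[OF 1[unfolded add.commute[of "?W (?A 0)"]] S1(3) S0(3)] by simp
    thus ?thesis using S0(1,2) by blast
  qed
qed

end

section \<open>The stopping intervals for the tiles of one colour\<close>

context packet_family
begin

text \<open>\<open>\<I>\<close> contains every grid interval that lies in some tile interval and is
  not shorter than the shortest one. So the absence of stopping intervals obtained from
  \<open>principal_family\<close> extends to all grid intervals between a tile and its
  \<open>R\<close>, as \<open>nonstop\<close> demands. Each of the two stopping conditions takes a
  quarter of \<open>len R\<close> by \<open>Phi_packing\<close>.\<close>

lemma stopping_collection:
  assumes f: "bdd_supp f" and gb: "\<forall>k\<in>{1..N}. bdd_supp (g k)"
  shows "\<exists>S E. finite S \<and> (\<forall>R\<in>S. ivl R) \<and> sparse_witness S E \<and>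
    (\<Sum>(k, P)\<in>T. len (fst P) * norm (L2_inner f (\<phi> P)) * norm (L2_inner (g k) (\<phi> P)))
    \<le> (2560 * C0 * sqrt (1310752 * C0\<^sup>2) + sqrt (40960 * C0\<^sup>2 * real n) * (8 * C1 + 61440 * C0)) *
      (\<Sum>R\<in>S. len R * (sqrt (Phi (\<lambda>x. (norm (f x))\<^sup>2) R) * Phi (l2_norm_fun N g) R))"
proof (cases "T = {}")
  case True
  thus ?thesis by (intro exI[of _ "{}"]) (simp add: sparse_witness_def disjoint_family_on_def)
next
  case False
  have g: "bdd_supp (g k)" if "k \<in> {1..N}" for k using gb that by blast
  let ?f2 = "\<lambda>x. (norm (f x))\<^sup>2" and ?L = "l2_norm_fun N g"
  have bL: "bdd_supp ?L" by (rule bdd_supp_l2_norm[OF g])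
  have L0: "?L x \<ge> 0" for x by (simp add: l2_norm_fun_def sum_nonneg)
  have bf: "bdd_supp ?f2" by (rule bdd_supp_norm_square[OF f])
  let ?K = "2560 * C0 * sqrt (1310752 * C0\<^sup>2) + sqrt (40960 * C0\<^sup>2 * real n) * (8 * C1 + 61440 * C0)"
  let ?st = "\<lambda>J R. 320 * Phi ?f2 R < Phi ?f2 J \<or> 320 * Phi ?L R < Phi ?L J"
  let ?D = "shifted_dyadic 0"
  have TD: "fst (snd p) \<in> ?D" if "p \<in> T" for p using dyadic[of "fst p" "snd p"] that by simp
  define \<delta> where "\<delta> = Min ((\<lambda>p. len (fst (snd p))) ` T)"
  have "\<delta> \<in> (\<lambda>p. len (fst (snd p))) ` T" unfolding \<delta>_def using finT False by (intro Min_in) auto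
  then obtain p0 where p0: "p0 \<in> T" "\<delta> = len (fst (snd p0))" by blast
  obtain \<kappa> where \<kappa>: "\<delta> = 2 powi \<kappa>" using grid_ivl[OF TD[OF p0(1)]] p0(2) by metis
  have \<delta>le: "2 powi \<kappa> \<le> len (fst (snd p))" if "p \<in> T" for p
    unfolding \<kappa>[symmetric] \<delta>_def using finT that by (intro Min_le) auto
  define \<I> where "\<I> = {Y \<in> ?D. 2 powi \<kappa> \<le> len Y \<and> (\<exists>p\<in>T. Y \<subseteq> fst (snd p))}"
  have "bounded (\<Union>p\<in>T. fst (snd p))"
  proof (intro bounded_UN finT ballI)
    fix p assume "p \<in> T"
    hence "ivl (fst (snd p))" using TD grid_is_ivl by blast
    thus "bounded (fst (snd p))" by (auto simp: ivl_def)
  qed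
  then obtain \<rho> where \<rho>: "\<And>x. x \<in> (\<Union>p\<in>T. fst (snd p)) \<Longrightarrow> \<bar>x\<bar> \<le> \<rho>" unfolding bounded_iff by auto
  have fin\<I>: "finite \<I>"
  proof (rule finite_subset[OF _ finite_grid_bounded[of "2 powi \<kappa>" 0 \<rho>]])
    show "\<I> \<subseteq> {X \<in> ?D. X \<subseteq> {-\<rho>..\<rho>} \<and> 2 powi \<kappa> \<le> len X}"
    proof
      fix Y assume Y: "Y \<in> \<I>"
      have "Y \<subseteq> {-\<rho>..\<rho>}"
      proof
        fix x assume "x \<in> Y"
        hence "\<bar>x\<bar> \<le> \<rho>" using \<rho>[of x] Y by (auto simp: \<I>_def)
        thus "x \<in> {-\<rho>..\<rho>}" by (auto simp: abs_le_iff)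
      qed
      thus "Y \<in> {X \<in> ?D. X \<subseteq> {-\<rho>..\<rho>} \<and> 2 powi \<kappa> \<le> len X}" using Y by (simp add: \<I>_def)
    qed
  qed simp
  have iv: "ivl I" if "I \<in> \<I>" for I using that grid_is_ivl by (auto simp: \<I>_def)
  have lam: "laminar \<I>" using grid_laminar[of 0] unfolding laminar_def \<I>_def by auto
  have "\<exists>S E. S \<subseteq> \<I> \<and> sparse_witness S E \<and>
    (\<forall>I\<in>\<I>. \<exists>R\<in>S. I \<subseteq> R \<and> (\<forall>I'\<in>\<I>. I \<subseteq> I' \<longrightarrow> I' \<subseteq> R \<longrightarrow> \<not> ?st I' R))"
  proof (rule principal_family[OF fin\<I> lam iv])
    fix R \<J> assume a: "R \<in> \<I>" "\<J> \<subseteq> \<I>" "disjoint \<J>" "\<And>J. J \<in> \<J> \<Longrightarrow> J \<subseteq> R \<and> ?st J R"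
    let ?A = "{J \<in> \<J>. 320 * Phi ?f2 R < Phi ?f2 J}"
    have fin: "finite \<J>" using a(2) fin\<I> finite_subset by blast
    have sub: "disjoint ?A" "disjoint (\<J> - ?A)" using a(3) by (auto simp: disjoint_def pairwise_def)
    have ivJ: "ivl J \<and> J \<subseteq> R" if "J \<in> \<J>" for J using that a iv by blast
    have "(\<Sum>J\<in>?A. len J) \<le> len R / 4"
      by (rule Phi_packing[OF bf _ iv[OF a(1)] _ _ sub(1)]) (use fin ivJ in auto)
    moreover have "(\<Sum>J\<in>\<J> - ?A. len J) \<le> len R / 4"
      by (rule Phi_packing[OF bL L0 iv[OF a(1)] _ _ sub(2)]) (use fin ivJ a(4) in auto)
    moreover have "(\<Sum>J\<in>\<J>. len J) = (\<Sum>J\<in>?A. len J) + (\<Sum>J\<in>\<J> - ?A. len J)"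
      using fin by (subst sum.subset_diff[of ?A \<J>]) auto
    ultimately show "(\<Sum>J\<in>\<J>. len J) \<le> len R / 2" by linarith
  qed auto
  then obtain S E where S: "S \<subseteq> \<I>" and E: "sparse_witness S E"
    and cov: "\<forall>I\<in>\<I>. \<exists>R\<in>S. I \<subseteq> R \<and> (\<forall>I'\<in>\<I>. I \<subseteq> I' \<longrightarrow> I' \<subseteq> R \<longrightarrow> \<not> ?st I' R)"
    by (elim exE conjE) (rule that)
  have finS: "finite S" using S fin\<I> finite_subset by blast
  have T\<I>: "fst (snd p) \<in> \<I>" if "p \<in> T" for p using TD \<delta>le that by (auto simp: \<I>_def)
  have "\<forall>p\<in>T. \<exists>R\<in>S. fst (snd p) \<subseteq> R \<and> (\<forall>I'\<in>\<I>. fst (snd p) \<subseteq> I' \<longrightarrow> I' \<subseteq> R \<longrightarrow> \<not> ?st I' R)"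
    using cov T\<I> by blast
  then obtain \<pi> where \<pi>: "\<And>p. p \<in> T \<Longrightarrow> \<pi> p \<in> S \<and> fst (snd p) \<subseteq> \<pi> p \<and> (\<forall>I'\<in>\<I>. fst (snd p) \<subseteq> I' \<longrightarrow> I' \<subseteq> \<pi> p \<longrightarrow> \<not> ?st I' (\<pi> p))"
    by metis
  let ?F = "\<lambda>(k, P). len (fst P) * norm (L2_inner f (\<phi> P)) * norm (L2_inner (g k) (\<phi> P))"
  have local: "(\<Sum>p\<in>{p \<in> T. \<pi> p = R}. ?F p) \<le> ?K * (len R * (sqrt (Phi ?f2 R) * Phi ?L R))" if R: "R \<in> S" for R
  proof -
    have R\<I>: "R \<in> \<I>" using R S by blast
    interpret stopped_packets T \<phi> a C0 C1 n N f g R "{p \<in> T. \<pi> p = R}" \<kappa>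
    proof unfold_locales
      show "bdd_supp f" by (rule f)
      show "bdd_supp (g k)" if "k \<in> {1..N}" for k by (rule g[OF that])
      show "R \<in> ?D" "2 powi \<kappa> \<le> len R" using R\<I> by (auto simp: \<I>_def)
      show "{p \<in> T. \<pi> p = R} \<subseteq> T" by blast
      fix k P assume p: "(k, P) \<in> {p \<in> T. \<pi> p = R}"
      show "fst P \<subseteq> R \<and> 2 powi \<kappa> \<le> len (fst P)" using p \<pi>[of "(k, P)"] \<delta>le[of "(k, P)"] by auto
      fix J assume J: "J \<in> ?D" "fst P \<subseteq> J" "J \<subseteq> R"
      have "len (fst P) \<le> len J"
        using J(2) grid_is_ivl[OF J(1)] grid_is_ivl[OF TD[of "(k, P)"]] p ivlD(4,5) by (intro measure_mono_fmeasurable) auto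
      hence "J \<in> \<I>" using J \<delta>le[of "(k, P)"] p R\<I> by (auto simp: \<I>_def)
      thus "Phi ?f2 J \<le> 320 * Phi ?f2 R \<and> Phi ?L J \<le> 320 * Phi ?L R"
        using \<pi>[of "(k, P)"] p J by fastforce
    qed
    show ?thesis by (rule stopped_estimate)
  qed
  have "(\<Sum>p\<in>T. ?F p) = (\<Sum>R\<in>S. \<Sum>p\<in>{p \<in> T. \<pi> p = R}. ?F p)"
    by (rule sum.group[symmetric, OF finT finS]) (use \<pi> in auto)
  also have "\<dots> \<le> (\<Sum>R\<in>S. ?K * (len R * (sqrt (Phi ?f2 R) * Phi ?L R)))" by (intro sum_mono local)
  also have "\<dots> = ?K * (\<Sum>R\<in>S. len R * (sqrt (Phi ?f2 R) * Phi ?L R))" by (rule sum_distrib_left[symmetric])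
  finally show ?thesis using finS S iv E by blast
qed

lemma packet_family_sparse_bound:
  assumes f: "bdd_supp f" and g: "\<And>k. k \<in> {1..N} \<Longrightarrow> bdd_supp (g k)"
  shows "\<exists>S. finite S \<and> sparse_family (1/6) S \<and>
    (\<Sum>(k, P)\<in>T. len (fst P) * norm (L2_inner f (\<phi> P)) * norm (L2_inner (g k) (\<phi> P)))
    \<le> 7552 * (2560 * C0 * sqrt (1310752 * C0\<^sup>2) + sqrt (40960 * C0\<^sup>2 * real n) * (8 * C1 + 61440 * C0)) *
      (\<Sum>Q\<in>S. len Q * avg 2 Q f * avg 1 Q (l2_norm_fun N g))"
proof -
  let ?K = "2560 * C0 * sqrt (1310752 * C0\<^sup>2) + sqrt (40960 * C0\<^sup>2 * real n) * (8 * C1 + 61440 * C0)"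
  have gb: "\<forall>k\<in>{1..N}. bdd_supp (g k)" using g by blast
  have K0: "?K \<ge> 0" using C0 C1 by (intro add_nonneg_nonneg mult_nonneg_nonneg) auto
  have L0: "l2_norm_fun N g x \<ge> 0" for x by (simp add: l2_norm_fun_def sum_nonneg)
  obtain S E where S: "finite S" "\<forall>R\<in>S. ivl R" "sparse_witness S E"
    and le: "(\<Sum>(k, P)\<in>T. len (fst P) * norm (L2_inner f (\<phi> P)) * norm (L2_inner (g k) (\<phi> P)))
      \<le> ?K * (\<Sum>R\<in>S. len R * (sqrt (Phi (\<lambda>x. (norm (f x))\<^sup>2) R) * Phi (l2_norm_fun N g) R))"
    using stopping_collection[OF f gb] by (elim exE conjE) (rule that)
  obtain S' where S': "finite S'" "sparse_family (1/6) S'"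
    and le': "(\<Sum>R\<in>S. len R * (sqrt (Phi (\<lambda>x. (norm (f x))\<^sup>2) R) * Phi (l2_norm_fun N g) R))
      \<le> 7552 * (\<Sum>Q\<in>S'. len Q * pair_avg f (l2_norm_fun N g) Q)"
    using sparse_domination_of_Phi_sum[OF f bdd_supp_l2_norm[OF g] L0 S(1) _ S(3)] S(2) by auto
  have "(\<Sum>(k, P)\<in>T. len (fst P) * norm (L2_inner f (\<phi> P)) * norm (L2_inner (g k) (\<phi> P)))
    \<le> ?K * (7552 * (\<Sum>Q\<in>S'. len Q * pair_avg f (l2_norm_fun N g) Q))"
    by (rule order_trans[OF le mult_left_mono[OF le' K0]])
  also have "\<dots> = 7552 * ?K * (\<Sum>Q\<in>S'. len Q * avg 2 Q f * avg 1 Q (l2_norm_fun N g))"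
    by (simp only: pair_avg_def mult_ac)
  finally show ?thesis using S' by blast
qed

end

section \<open>Reduction to families with disjoint frequency intervals\<close>

lemma dist_center_le_infdist:
  assumes "ivl I"
  shows "\<bar>x - center I\<bar> - len I / 2 \<le> infdist x I"
proof -
  have "\<bar>x - center I\<bar> - len I / 2 \<le> dist x y" if "y \<in> I" for y
    using ivlD(3)[OF assms that] unfolding dist_real_def by linarith
  thus ?thesis
    unfolding infdist_notempty[OF ivlD(6)[OF assms]] by (intro cINF_greatest ivlD(6)[OF assms])
qed

text \<open>The distance to \<open>I\<close> is at least the distance to its centre minus half the
  length; this costs a factor 2 in the base, hence \<open>2 ^ 10\<close>.\<close>

lemma adapted_weight_le:
  assumes I: "ivl I"
  shows "(1 + infdist x I / len I) powi (- int 10) \<le> 2 ^ 10 / wt (center I) (len I) x ^ 10"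
proof -
  have l: "len I > 0" by (rule ivlD(1)[OF I])
  have "(\<bar>x - center I\<bar> - len I / 2) / len I \<le> infdist x I / len I"
    using dist_center_le_infdist[OF I] l by (intro divide_right_mono) auto
  hence A: "\<bar>x - center I\<bar> / len I - 1 / 2 \<le> infdist x I / len I"
    using l by (simp add: diff_divide_distrib)
  have gen: "(1 + A) / 2 \<le> 1 + B" if "A - 1 / 2 \<le> B" "A \<ge> 0" for A B :: real
    using that by (simp add: field_simps)
  have h: "wt (center I) (len I) x / 2 \<le> 1 + infdist x I / len I"
    unfolding wt_def by (rule gen[OF A]) (use l in simp)
  have w: "wt (center I) (len I) x > 0" by (rule wt_pos[OF l])
  have "1 + infdist x I / len I > 0" using l infdist_nonneg[of x I] by (intro add_pos_nonneg) auto
  have "(1 + infdist x I / len I) powi (- int 10) = 1 / (1 + infdist x I / len I) ^ 10"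
    by (simp add: power_int_def divide_inverse power_inverse)
  also have "\<dots> \<le> 1 / (wt (center I) (len I) x / 2) ^ 10"
    using h w \<open>1 + infdist x I / len I > 0\<close> by (intro divide_left_mono power_mono mult_pos_pos zero_less_power) auto
  finally show ?thesis by (simp add: power_divide)
qed

lemma wave_packet_continuous:
  assumes "smooth \<phi>"
  shows "continuous_on UNIV \<phi>" "\<phi> differentiable at x"
proof -
  have d: "\<phi> differentiable at x" for x
    using assms[unfolded smooth_def, THEN spec, of 0] by (simp add: nth_deriv_def)
  thus "continuous_on UNIV \<phi>" by (simp add: continuous_on_eq_continuous_at differentiable_imp_continuous_within)
  show "\<phi> differentiable at x" by (rule d)
qed

lemma adapted_norm_le:
  assumes A: "L1_adapted 1 10 C P \<phi>" and I: "ivl (fst P)" and n: "n \<le> 1"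
  shows "norm (nth_deriv n (\<lambda>y. cis (- 2 * pi * center (snd P) * y) * \<phi> y) x)
    \<le> (\<bar>C n 10\<bar> * 2 ^ 10 / len (fst P) ^ (n + 1)) / wt (center (fst P)) (len (fst P)) x ^ 10"
proof -
  let ?l = "len (fst P)"
  have l: "?l > 0" by (rule ivlD(1)[OF I])
  have "norm (nth_deriv n (\<lambda>y. cis (- 2 * pi * center (snd P) * y) * \<phi> y) x)
    \<le> C n 10 * (1 / ?l ^ (n + 1)) * (1 + infdist x (fst P) / ?l) powi (- int 10)"
    using A n unfolding L1_adapted_def by blast
  also have "\<dots> \<le> (\<bar>C n 10\<bar> * (1 / ?l ^ (n + 1))) * (2 ^ 10 / wt (center (fst P)) ?l x ^ 10)"
  proof (rule mult_mono[OF _ adapted_weight_le[OF I]])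
    show "C n 10 * (1 / ?l ^ (n + 1)) \<le> \<bar>C n 10\<bar> * (1 / ?l ^ (n + 1))"
      using l by (intro mult_right_mono) auto
    show "0 \<le> (1 + infdist x (fst P) / ?l) powi (- int 10)"
      using l infdist_nonneg[of x "fst P"] by (intro zero_le_power_int) simp
  qed (use l in auto)
  finally show ?thesis by simp
qed

text \<open>Adaptedness controls the derivative after removal of the centre of the frequency
  interval. Replacing that centre by \<open>a\<close> adds a phase of frequency at most
  \<open>D / len (fst P)\<close>, whose derivative is of the same order. One factor
  \<open>2 ^ 10\<close> comes from \<open>adapted_weight_le\<close>, the other from moving the
  weight from a point of the window to \<open>z\<close>.\<close>

lemma wave_packet_lipschitz:
  fixes C :: "nat \<Rightarrow> nat \<Rightarrow> real"
  assumes w: "wave_packet 1 10 C P \<phi>" and I: "ivl (fst P)" and \<omega>: "\<bar>center (snd P) - a\<bar> \<le> D / len (fst P)"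
    and x: "\<bar>x - z\<bar> \<le> len (fst P) / 2" and y: "\<bar>y - z\<bar> \<le> len (fst P) / 2"
  shows "norm (cis (- 2 * pi * a * x) * \<phi> x - cis (- 2 * pi * a * y) * \<phi> y)
    \<le> 2 ^ 20 * (2 * pi * D * \<bar>C 0 10\<bar> + \<bar>C 1 10\<bar>) * \<bar>x - y\<bar> / (len (fst P))\<^sup>2 / wt (center (fst P)) (len (fst P)) z ^ 10"
proof -
  let ?l = "len (fst P)" and ?c = "center (fst P)" and ?e = "center (snd P)"
  have l: "?l > 0" by (rule ivlD(1)[OF I])
  define \<psi> where "\<psi> y = cis (- 2 * pi * ?e * y) * \<phi> y" for y
  define \<psi>' where "\<psi>' y = vector_derivative \<psi> (at y)" for y
  define b where "b = - 2 * pi * (a - ?e)"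
  have A: "L1_adapted 1 10 C P \<phi>" and sm: "smooth \<phi>" using w by (auto simp: wave_packet_def)
  have cd: "((\<lambda>y. cis (r * y)) has_vector_derivative (\<i> * r * cis (r * y))) (at y)" for r y :: real
  proof -
    have "((\<lambda>w. exp (\<i> * r * w)) has_field_derivative (\<i> * r * exp (\<i> * r * y))) (at (complex_of_real y))"
      by (auto intro!: derivative_eq_intros)
    from has_vector_derivative_real_field[OF this]
    show ?thesis by (simp add: cis_conv_exp mult.assoc)
  qed
  have d\<psi>: "(\<psi> has_vector_derivative \<psi>' y) (at y)" for y
  proof -
    have "(\<lambda>y. cis (- 2 * pi * ?e * y)) differentiable at y"
      using cd[of "- 2 * pi * ?e" y] by (auto simp: has_vector_derivative_def differentiable_def)
    hence "\<psi> differentiable at y" unfolding \<psi>_def by (intro differentiable_mult wave_packet_continuous(2)[OF sm])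
    thus ?thesis unfolding \<psi>'_def by (simp add: vector_derivative_works)
  qed
  have n0: "norm (\<psi> u) \<le> (\<bar>C 0 10\<bar> * 2 ^ 10 / ?l) / wt ?c ?l u ^ 10" for u
    using adapted_norm_le[OF A I, of 0 u] by (simp add: nth_deriv_def \<psi>_def)
  have n1: "norm (\<psi>' u) \<le> (\<bar>C 1 10\<bar> * 2 ^ 10 / ?l\<^sup>2) / wt ?c ?l u ^ 10" for u
    using adapted_norm_le[OF A I, of 1 u] unfolding nth_deriv_def \<psi>'_def \<psi>_def[abs_def] by (simp add: power2_eq_square)
  define h where "h u = cis (b * u) * \<psi> u" for u
  have hx: "cis (- 2 * pi * a * u) * \<phi> u = h u" for u
  proof -
    have "- 2 * pi * a * u = b * u + - 2 * pi * ?e * u" by (simp add: b_def algebra_simps)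
    thus ?thesis unfolding h_def \<psi>_def by (metis cis_mult mult.assoc)
  qed
  have dh: "(h has_vector_derivative (cis (b * u) * \<psi>' u + \<i> * b * cis (b * u) * \<psi> u)) (at u)" for u
    unfolding h_def by (rule has_vector_derivative_mult[OF cd d\<psi>])
  let ?K = "2 * pi * D * \<bar>C 0 10\<bar> + \<bar>C 1 10\<bar>"
  have D0: "D \<ge> 0" using \<omega> l abs_ge_zero[of "?e - a"] by (smt (verit) divide_neg_pos)
  have K0: "?K \<ge> 0" using D0 by simp
  let ?B = "2 ^ 20 * ?K / ?l\<^sup>2 / wt ?c ?l z ^ 10"
  have bd: "norm (cis (b * u) * \<psi>' u + \<i> * b * cis (b * u) * \<psi> u) \<le> ?B" if u: "\<bar>u - z\<bar> \<le> ?l / 2" for u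
  proof -
    have wu: "wt ?c ?l u > 0" "wt ?c ?l u \<ge> 1" "wt ?c ?l z > 0" using l by (auto intro: wt_pos wt_ge_1)
    have b: "\<bar>b\<bar> \<le> 2 * pi * (D / ?l)"
    proof -
      have "\<bar>b\<bar> = 2 * pi * \<bar>?e - a\<bar>" by (simp add: b_def abs_mult abs_minus_commute)
      thus ?thesis using mult_left_mono[OF \<omega>, of "2 * pi"] by simp
    qed
    have "norm (cis (b * u) * \<psi>' u + \<i> * b * cis (b * u) * \<psi> u) \<le> norm (\<psi>' u) + \<bar>b\<bar> * norm (\<psi> u)"
      by (rule order_trans[OF norm_triangle_ineq]) (simp add: norm_mult)
    also have "\<dots> \<le> (\<bar>C 1 10\<bar> * 2 ^ 10 / ?l\<^sup>2) / wt ?c ?l u ^ 10 + (2 * pi * (D / ?l)) * ((\<bar>C 0 10\<bar> * 2 ^ 10 / ?l) / wt ?c ?l u ^ 10)"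
      using n0 n1 b D0 l by (intro add_mono mult_mono) auto
    also have "\<dots> = (2 ^ 10 * ?K / ?l\<^sup>2) * (1 / wt ?c ?l u ^ 10)" by (simp add: power2_eq_square add_divide_distrib distrib_right distrib_left mult_ac)
    also have "\<dots> \<le> (2 ^ 10 * ?K / ?l\<^sup>2) * (2 ^ 10 / wt ?c ?l z ^ 10)"
    proof (rule mult_left_mono)
      have "\<bar>z - ?c\<bar> \<le> \<bar>u - ?c\<bar> + ?l / 2" using u by linarith
      hence "\<bar>z - ?c\<bar> / ?l \<le> (\<bar>u - ?c\<bar> + ?l / 2) / ?l" using l by (intro divide_right_mono) auto
      also have "\<dots> = \<bar>u - ?c\<bar> / ?l + 1 / 2" using l by (simp add: add_divide_distrib)
      finally have "wt ?c ?l z \<le> 2 * wt ?c ?l u" using wu(2) unfolding wt_def distrib_left by linarith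
      hence "wt ?c ?l z ^ 10 \<le> (2 * wt ?c ?l u) ^ 10" using wu by (intro power_mono) auto
      hence "wt ?c ?l z ^ 10 \<le> 2 ^ 10 * wt ?c ?l u ^ 10" by (simp only: power_mult_distrib)
      moreover have "wt ?c ?l z ^ 10 > 0" "wt ?c ?l u ^ 10 > 0" using wu by auto
      ultimately show "1 / wt ?c ?l u ^ 10 \<le> 2 ^ 10 / wt ?c ?l z ^ 10" by (simp add: divide_simps mult.commute)
    qed (use K0 l in simp)
    finally show ?thesis by simp
  qed
  have "norm (h x - h y) \<le> ?B * norm (x - y)"
  proof (rule differentiable_bound)
    show "convex {z - ?l / 2..z + ?l / 2}" by simp
    show "(h has_derivative (\<lambda>t. t *\<^sub>R (cis (b * u) * \<psi>' u + \<i> * b * cis (b * u) * \<psi> u))) (at u within {z - ?l / 2..z + ?l / 2})" for u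
      using dh[of u] unfolding has_vector_derivative_def by (rule has_derivative_at_withinI)
    show "onorm (\<lambda>t. t *\<^sub>R (cis (b * u) * \<psi>' u + \<i> * b * cis (b * u) * \<psi> u)) \<le> ?B" if "u \<in> {z - ?l / 2..z + ?l / 2}" for u
    proof (rule onorm_le)
      fix t :: real
      have "z - ?l / 2 \<le> u" "u \<le> z + ?l / 2" using that by auto
      hence "\<bar>u - z\<bar> \<le> ?l / 2" by linarith
      from mult_left_mono[OF bd[OF this] abs_ge_zero[of t]]
      show "norm (t *\<^sub>R (cis (b * u) * \<psi>' u + \<i> * b * cis (b * u) * \<psi> u)) \<le> ?B * norm t"
        by (simp only: norm_scaleR real_norm_def mult.commute)
    qed
    show "x \<in> {z - ?l / 2..z + ?l / 2}" "y \<in> {z - ?l / 2..z + ?l / 2}" using x y unfolding atLeastAtMost_iff by linarith+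
  qed
  thus ?thesis unfolding hx by simp
qed

lemma test_function_bdd_supp:
  assumes "test_function f"
  shows "bdd_supp f"
proof -
  have c: "continuous_on UNIV f" using assms wave_packet_continuous(1) by (auto simp: test_function_def)
  have "bounded {x. f x \<noteq> 0}"
    using assms closure_subset bounded_subset compact_imp_bounded unfolding test_function_def by metis
  then obtain R where R: "\<And>x. f x \<noteq> 0 \<Longrightarrow> \<bar>x\<bar> \<le> R" unfolding bounded_iff by auto
  have "compact (f ` {-R..R})"
    by (rule compact_continuous_image) (use c in \<open>auto intro: continuous_on_subset\<close>)
  then obtain A where A: "\<And>y. y \<in> f ` {-R..R} \<Longrightarrow> norm y \<le> A" using compact_imp_bounded bounded_iff by metis
  show ?thesis
  proof (rule bdd_suppI[where A="max A 0" and B=R])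
    show "f \<in> borel_measurable borel" by (rule borel_measurable_continuous_onI[OF c])
    show "f x = 0" if "R < \<bar>x\<bar>" for x using R[of x] that by force
    show "norm (f x) \<le> max A 0" for x
    proof (cases "f x = 0")
      case False
      hence "x \<in> {-R..R}" using R[of x] by (auto simp: abs_le_iff)
      thus ?thesis using A[of "f x"] by auto
    qed simp
  qed
qed

section \<open>Whitney intervals, lacunarity and colours of tiles\<close>

lemma whitney_disjoint:
  assumes "\<omega> \<in> whitney G a b" "\<omega>' \<in> whitney G a b" "\<omega> \<inter> \<omega>' \<noteq> {}" "G = shifted_dyadic s" "3 * s \<in> \<int>"
  shows "\<omega> = \<omega>'"
proof -
  have "\<omega> \<in> shifted_dyadic s" "\<omega>' \<in> shifted_dyadic s" using assms by (auto simp: whitney_def whitney_candidates_def)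
  hence "\<omega> \<subseteq> \<omega>' \<or> \<omega>' \<subseteq> \<omega>" using grid_laminar[OF assms(5)] assms(3) unfolding laminar_def by blast
  thus ?thesis using assms(1,2) unfolding whitney_def by blast
qed

lemma lacunary_center:
  assumes "ivl \<omega>" "lacunary c a \<omega>"
  shows "\<bar>center \<omega> - a\<bar> \<le> (\<bar>c\<bar> + 1) * len \<omega>"
proof -
  have "\<bar>a - center \<omega>\<bar> - len \<omega> / 2 \<le> c * len \<omega>"
    using dist_center_le_infdist[OF assms(1), of a] assms(2) by (auto simp: lacunary_def)
  also have "\<dots> \<le> \<bar>c\<bar> * len \<omega>" by (intro mult_right_mono) auto
  finally show ?thesis using ivlD(1)[OF assms(1)] by (simp add: distrib_right abs_minus_commute)
qed

text \<open>Centres of equally long grid intervals lie in a lattice of step \<open>l\<close>, and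
  lacunarity keeps them within \<open>(\<bar>c\<bar> + 1) * l\<close> of \<open>a\<close>. By the
  area condition this bounds the tiles of one index over one interval.\<close>

lemma lacunary_count:
  assumes W: "finite W" "W \<subseteq> shifted_dyadic s" and l: "\<And>\<omega>. \<omega> \<in> W \<Longrightarrow> len \<omega> = l \<and> lacunary c a \<omega>"
  shows "card W \<le> 2 * nat \<lceil>2 * (\<bar>c\<bar> + 1)\<rceil> + 1"
proof (cases "W = {}")
  case False
  then obtain \<omega>0 where w0: "\<omega>0 \<in> W" by blast
  have l0: "l > 0" using l[OF w0] ivlD(1)[OF grid_is_ivl] W w0 by blast
  define M where "M = \<lceil>2 * (\<bar>c\<bar> + 1)\<rceil>"
  define h where "h \<omega> = \<lfloor>(center \<omega> - center \<omega>0) / l\<rfloor>" for \<omega>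
  have h: "of_int (h \<omega>) = (center \<omega> - center \<omega>0) / l" if "\<omega> \<in> W" for \<omega>
  proof -
    have "\<omega> \<in> shifted_dyadic s" "\<omega>0 \<in> shifted_dyadic s" "len \<omega> = l" "len \<omega>0 = l" using that w0 W l by auto
    hence "(center \<omega> - center \<omega>0) / l \<in> \<int>" using grid_center_lattice[of \<omega> s \<omega>0] by simp
    thus ?thesis unfolding h_def by simp
  qed
  have "h \<omega> \<in> {-M..M}" if w: "\<omega> \<in> W" for \<omega>
  proof -
    have b: "\<bar>center \<omega> - a\<bar> \<le> (\<bar>c\<bar> + 1) * l" if "\<omega> \<in> W" for \<omega>
      using lacunary_center[of \<omega> c a] grid_is_ivl[of \<omega> s] W l[OF that] that by auto
    have "\<bar>center \<omega> - center \<omega>0\<bar> \<le> 2 * (\<bar>c\<bar> + 1) * l" using b[OF w] b[OF w0] unfolding mult.assoc by linarith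
    hence "\<bar>(center \<omega> - center \<omega>0) / l\<bar> \<le> 2 * (\<bar>c\<bar> + 1)" using l0 by (simp add: divide_le_eq)
    hence "\<bar>real_of_int (h \<omega>)\<bar> \<le> 2 * (\<bar>c\<bar> + 1)" unfolding h[OF w] .
    hence "\<bar>h \<omega>\<bar> \<le> M" unfolding M_def by linarith
    thus ?thesis by auto
  qed
  moreover have "inj_on h W"
  proof (rule inj_onI)
    fix \<omega> \<omega>' assume a: "\<omega> \<in> W" "\<omega>' \<in> W" "h \<omega> = h \<omega>'"
    hence "(center \<omega> - center \<omega>0) / l = (center \<omega>' - center \<omega>0) / l" using h by metis
    hence "center \<omega> = center \<omega>'" using l0 by simp
    thus "\<omega> = \<omega>'" using grid_center_inj[of \<omega> s \<omega>'] a W l by auto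
  qed
  ultimately have "card W \<le> card {-M..M}" by (intro card_inj_on_le[where f=h]) auto
  also have "\<dots> \<le> 2 * nat M + 1" by simp
  finally show ?thesis unfolding M_def .
qed simp

text \<open>Tiles of one colour have frequency intervals that are disjoint or equal, and there are at most
  \<open>B\<close> colours, because all intervals counted by the colour contain the given one.\<close>

definition colour :: "(nat \<times> tile) set \<Rightarrow> nat \<times> tile \<Rightarrow> nat"
  where "colour T p = card {z \<in> (\<lambda>q. (fst q, snd (snd q))) ` T.
    snd (snd p) \<subseteq> snd z \<and> (snd z \<noteq> snd (snd p) \<or> fst z < fst p)}"

text \<open>In the order by inclusion of frequency intervals, then by index, whatever is above
  \<open>p'\<close> is above \<open>p\<close>, and the pair of \<open>p'\<close> itself is counted
  for \<open>p\<close> only. So the colour changes strictly along chains.\<close>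

lemma colour_less:
  assumes fin: "finite T" and p': "p' \<in> T"
    and above: "snd (snd p) \<subset> snd (snd p') \<or> snd (snd p) = snd (snd p') \<and> fst p' < fst p"
  shows "colour T p' < colour T p"
  unfolding colour_def
proof (rule psubset_card_mono)
  let ?Z = "(\<lambda>q. (fst q, snd (snd q))) ` T"
  show "finite {z \<in> ?Z. snd (snd p) \<subseteq> snd z \<and> (snd z \<noteq> snd (snd p) \<or> fst z < fst p)}" using fin by simp
  let ?z = "(fst p', snd (snd p'))"
  have "?z \<in> {z \<in> ?Z. snd (snd p) \<subseteq> snd z \<and> (snd z \<noteq> snd (snd p) \<or> fst z < fst p)}"
    using p' above by auto
  moreover have "?z \<notin> {z \<in> ?Z. snd (snd p') \<subseteq> snd z \<and> (snd z \<noteq> snd (snd p') \<or> fst z < fst p')}" by simp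
  moreover have "{z \<in> ?Z. snd (snd p') \<subseteq> snd z \<and> (snd z \<noteq> snd (snd p') \<or> fst z < fst p')}
    \<subseteq> {z \<in> ?Z. snd (snd p) \<subseteq> snd z \<and> (snd z \<noteq> snd (snd p) \<or> fst z < fst p)}"
  proof
    fix z assume z: "z \<in> {z \<in> ?Z. snd (snd p') \<subseteq> snd z \<and> (snd z \<noteq> snd (snd p') \<or> fst z < fst p')}"
    show "z \<in> {z \<in> ?Z. snd (snd p) \<subseteq> snd z \<and> (snd z \<noteq> snd (snd p) \<or> fst z < fst p)}"
      using above
    proof
      assume "snd (snd p) \<subset> snd (snd p')"
      thus ?thesis using z by blast
    next
      assume "snd (snd p) = snd (snd p') \<and> fst p' < fst p"
      thus ?thesis using z by auto
    qed
  qed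
  ultimately show "{z \<in> ?Z. snd (snd p') \<subseteq> snd z \<and> (snd z \<noteq> snd (snd p') \<or> fst z < fst p')}
    \<subset> {z \<in> ?Z. snd (snd p) \<subseteq> snd z \<and> (snd z \<noteq> snd (snd p) \<or> fst z < fst p)}" by blast
qed

lemma colour_separates:
  assumes fin: "finite T" and p: "p \<in> T" and p': "p' \<in> T" and eq: "colour T p = colour T p'"
    and G: "snd (snd p) \<in> shifted_dyadic s" "snd (snd p') \<in> shifted_dyadic s" "3 * s \<in> \<int>"
    and ne: "snd (snd p) \<inter> snd (snd p') \<noteq> {}"
  shows "fst p = fst p' \<and> snd (snd p) = snd (snd p')"
proof (rule ccontr)
  assume n: "\<not> (fst p = fst p' \<and> snd (snd p) = snd (snd p'))"
  have "snd (snd p) \<subseteq> snd (snd p') \<or> snd (snd p') \<subseteq> snd (snd p)"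
    using grid_laminar[OF G(3)] G(1,2) ne unfolding laminar_def by blast
  hence "(snd (snd p) \<subset> snd (snd p') \<or> snd (snd p) = snd (snd p') \<and> fst p' < fst p) \<or>
    (snd (snd p') \<subset> snd (snd p) \<or> snd (snd p') = snd (snd p) \<and> fst p < fst p')" using n by auto
  thus False
  proof
    assume "snd (snd p) \<subset> snd (snd p') \<or> snd (snd p) = snd (snd p') \<and> fst p' < fst p"
    from colour_less[OF fin p' this] show False using eq by simp
  next
    assume "snd (snd p') \<subset> snd (snd p) \<or> snd (snd p') = snd (snd p) \<and> fst p < fst p'"
    from colour_less[OF fin p this] show False using eq by simp
  qed
qed

text \<open>For one index, Whitney intervals through a common point coincide. Hence the pairs
  counted have distinct indices \<open>k\<close>, all with \<open>x \<in> {a k..b k}\<close> for a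
  point \<open>x\<close> of the given frequency interval. The pair of \<open>p\<close>, not counted
  by its own colour, makes the bound strict.\<close>

lemma colour_bound:
  fixes a b :: "nat \<Rightarrow> real"
  assumes fin: "finite T" and p: "p \<in> T"
    and W: "\<And>q. q \<in> T \<Longrightarrow> fst q \<in> {1..N} \<and> snd (snd q) \<in> whitney G (a (fst q)) (b (fst q))"
    and B: "\<And>x. (\<Sum>k=1..N. indicat_real {a k..b k} x) \<le> B"
    and G: "G = shifted_dyadic s" "3 * s \<in> \<int>"
  shows "colour T p < nat \<lceil>B\<rceil>"
proof -
  let ?Z = "(\<lambda>q. (fst q, snd (snd q))) ` T"
  let ?Y = "{z \<in> ?Z. snd (snd p) \<subseteq> snd z \<and> (snd z \<noteq> snd (snd p) \<or> fst z < fst p)}"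
  let ?z = "(fst p, snd (snd p))"
  have "snd (snd p) \<in> shifted_dyadic s" using W[OF p] G by (auto simp: whitney_def whitney_candidates_def)
  then obtain x where x: "x \<in> snd (snd p)" using ivlD(6)[OF grid_is_ivl] by blast
  have WZ: "fst z \<in> {1..N}" "snd z \<in> whitney G (a (fst z)) (b (fst z))" if "z \<in> ?Z" for z
    using that W by auto
  have sub: "insert ?z ?Y \<subseteq> ?Z" using p by auto
  have xin: "x \<in> snd z" if "z \<in> insert ?z ?Y" for z using that x by auto
  have "inj_on fst (insert ?z ?Y)"
  proof (rule inj_onI)
    fix z z' assume a: "z \<in> insert ?z ?Y" "z' \<in> insert ?z ?Y" "fst z = fst z'"
    have "snd z \<in> whitney G (a (fst z)) (b (fst z))" "snd z' \<in> whitney G (a (fst z)) (b (fst z))"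
      using WZ(2)[of z] WZ(2)[of z'] a sub by auto
    from whitney_disjoint[OF this _ G] have "snd z = snd z'" using xin[OF a(1)] xin[OF a(2)] by blast
    thus "z = z'" using a(3) by (simp add: prod_eq_iff)
  qed
  hence "card (insert ?z ?Y) \<le> card {k \<in> {1..N}. x \<in> {a k..b k}}"
  proof (rule card_inj_on_le)
    show "fst ` insert ?z ?Y \<subseteq> {k \<in> {1..N}. x \<in> {a k..b k}}"
    proof
      fix k assume "k \<in> fst ` insert ?z ?Y"
      then obtain z where z: "z \<in> insert ?z ?Y" "k = fst z" by blast
      have zZ: "z \<in> ?Z" using z(1) sub by blast
      have "snd z \<subseteq> {a k..b k}" using WZ(2)[OF zZ] z(2) by (auto simp: whitney_def whitney_candidates_def)
      thus "k \<in> {k \<in> {1..N}. x \<in> {a k..b k}}" using xin[OF z(1)] WZ(1)[OF zZ] z(2) by auto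
    qed
  qed simp
  moreover have "card (insert ?z ?Y) = Suc (colour T p)"
    unfolding colour_def using fin by (subst card_insert_disjoint) auto
  moreover have "real (card {k \<in> {1..N}. x \<in> {a k..b k}}) = (\<Sum>k=1..N. indicat_real {a k..b k} x)"
    by (simp add: indicator_def sum.If_cases Int_def)
  ultimately have "real (Suc (colour T p)) \<le> B" using B[of x] by linarith
  thus ?thesis by linarith
qed

text \<open>Origin of the constants: the first from adaptedness of order 0, with 1 added to make it
  at least 1; the second from \<open>wave_packet_lipschitz\<close> with
  \<open>D = \<bar>c\<bar> + 1\<close> given by \<open>lacunary_center\<close>; the multiplicity
  from \<open>lacunary_count\<close>.\<close>

lemma wave_packet_family:
  fixes C :: "nat \<Rightarrow> nat \<Rightarrow> real"
  assumes G: "G = shifted_dyadic s" "3 * s \<in> \<int>"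
    and tc: "\<And>k. k \<in> {1..N} \<Longrightarrow> tile_collection G c (a k) (b k) (\<P> k)"
    and wp: "\<And>k P. k \<in> {1..N} \<Longrightarrow> P \<in> \<P> k \<Longrightarrow> wave_packet 1 10 C P (\<phi> P)"
  defines "T \<equiv> Sigma {1..N} \<P>"
  shows "packet_family {p \<in> T. colour T p = i} \<phi> a (1 + \<bar>C 0 10\<bar> * 2 ^ 10)
    (2 ^ 20 * (2 * pi * (\<bar>c\<bar> + 1) * \<bar>C 0 10\<bar> + \<bar>C 1 10\<bar>)) (2 * nat \<lceil>2 * (\<bar>c\<bar> + 1)\<rceil> + 1) N"
proof -
  have finT: "finite T" unfolding T_def using tc by (intro finite_SigmaI) (auto simp: tile_collection_def)
  have TT: "k \<in> {1..N}" "P \<in> \<P> k" if "(k, P) \<in> T" for k P using that by (auto simp: T_def)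
  have tile: "fst P \<in> shifted_dyadic 0" "snd P \<in> shifted_dyadic s" "len (fst P) * len (snd P) = 1"
    "lacunary c (a k) (snd P)" if "(k, P) \<in> T" for k P
    using tc[OF TT(1)[OF that]] TT(2)[OF that] G(1) by (auto simp: tile_collection_def is_tile_def shifted_dyadic_0)
  have w: "wave_packet 1 10 C P (\<phi> P)" if "(k, P) \<in> T" for k P using wp TT[OF that] by blast
  show ?thesis
  proof
    show "finite {p \<in> T. colour T p = i}" using finT by simp
    show "1 \<le> 1 + \<bar>C 0 10\<bar> * 2 ^ 10" by simp
    show "0 \<le> 2 ^ 20 * (2 * pi * (\<bar>c\<bar> + 1) * \<bar>C 0 10\<bar> + \<bar>C 1 10\<bar>)" by simp
    show "card {P. (k, P) \<in> {p \<in> T. colour T p = i} \<and> fst P = I} \<le> 2 * nat \<lceil>2 * (\<bar>c\<bar> + 1)\<rceil> + 1" for k I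
    proof -
      let ?Q = "{P. (k, P) \<in> {p \<in> T. colour T p = i} \<and> fst P = I}"
      have fQ: "finite ?Q" by (rule finite_subset[of _ "snd ` T"]) (use finT in force)+
      have "card ?Q = card (snd ` ?Q)" by (rule card_image[symmetric]) (auto simp: inj_on_def prod_eq_iff)
      also have "\<dots> \<le> 2 * nat \<lceil>2 * (\<bar>c\<bar> + 1)\<rceil> + 1"
      proof (rule lacunary_count[where s=s and l="1 / len I" and a="a k"])
        fix \<omega> assume "\<omega> \<in> snd ` ?Q"
        then obtain P where P: "(k, P) \<in> T" "fst P = I" "\<omega> = snd P" by blast
        have "len I * len \<omega> = 1" using tile(3)[OF P(1)] P by simp
        hence "len \<omega> = 1 / len I" by (metis nonzero_mult_div_cancel_left mult_zero_left zero_neq_one)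
        thus "len \<omega> = 1 / len I \<and> lacunary c (a k) \<omega>" using tile(4)[OF P(1)] P by simp
      qed (use fQ tile(2) in auto)
      finally show ?thesis .
    qed
    fix k P assume "(k, P) \<in> {p \<in> T. colour T p = i}"
    hence p: "(k, P) \<in> T" "colour T (k, P) = i" by auto
    show "k \<in> {1..N}" by (rule TT(1)[OF p(1)])
    show "fst P \<in> shifted_dyadic 0" "len (fst P) * len (snd P) = 1" using tile[OF p(1)] by auto
    show iv\<omega>: "ivl (snd P)" by (rule grid_is_ivl[OF tile(2)[OF p(1)]])
    have ivI: "ivl (fst P)" by (rule grid_is_ivl[OF tile(1)[OF p(1)]])
    note l = ivlD(1)[OF ivI]
    show "continuous_on UNIV (\<phi> P)" using w[OF p(1)] wave_packet_continuous(1) by (auto simp: wave_packet_def)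
    show "fourier (\<phi> P) \<xi> = 0" if "\<xi> \<notin> snd P" for \<xi> using w[OF p(1)] that by (auto simp: wave_packet_def)
    have A: "L1_adapted 1 10 C P (\<phi> P)" using w[OF p(1)] by (simp add: wave_packet_def)
    show "norm (\<phi> P x) \<le> ((1 + \<bar>C 0 10\<bar> * 2 ^ 10) / len (fst P)) / wt (center (fst P)) (len (fst P)) x ^ 10" for x
    proof -
      have "norm (\<phi> P x) \<le> (\<bar>C 0 10\<bar> * 2 ^ 10 / len (fst P)) / wt (center (fst P)) (len (fst P)) x ^ 10"
        using adapted_norm_le[OF A ivI, of 0 x] by (simp add: nth_deriv_def norm_mult)
      also have "\<dots> \<le> ((1 + \<bar>C 0 10\<bar> * 2 ^ 10) / len (fst P)) / wt (center (fst P)) (len (fst P)) x ^ 10"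
        using l wt_pos[OF l, of "center (fst P)" x] by (intro divide_right_mono) auto
      finally show ?thesis .
    qed
    have "len (snd P) = 1 / len (fst P)" using tile(3)[OF p(1)] l by (simp add: field_simps)
    hence cen: "\<bar>center (snd P) - a k\<bar> \<le> (\<bar>c\<bar> + 1) / len (fst P)"
      using lacunary_center[OF iv\<omega> tile(4)[OF p(1)]] by simp
    show "norm (cis (- 2 * pi * a k * x) * \<phi> P x - cis (- 2 * pi * a k * y) * \<phi> P y)
      \<le> 2 ^ 20 * (2 * pi * (\<bar>c\<bar> + 1) * \<bar>C 0 10\<bar> + \<bar>C 1 10\<bar>) * \<bar>x - y\<bar> / (len (fst P))\<^sup>2 / wt (center (fst P)) (len (fst P)) z ^ 10"
      if "\<bar>x - z\<bar> \<le> len (fst P) / 2" "\<bar>y - z\<bar> \<le> len (fst P) / 2" for x y z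
      by (rule wave_packet_lipschitz[OF w[OF p(1)] ivI cen that])
    fix k' P' assume "(k', P') \<in> {p \<in> T. colour T p = i}" and ne: "snd P \<inter> snd P' \<noteq> {}"
    hence p': "(k', P') \<in> T" "colour T (k', P') = i" by auto
    show "k = k' \<and> snd P = snd P'"
      using colour_separates[OF finT p(1) p'(1), of s] p(2) p'(2) tile(2)[OF p(1)] tile(2)[OF p'(1)] G(2) ne by simp
  qed
qed

lemma model_form_sparse_bound:
  fixes C :: "nat \<Rightarrow> nat \<Rightarrow> real"
  assumes G: "G \<in> dyadic_grids"
    and B: "\<And>x. (\<Sum>k=1..N. indicat_real {a k..b k} x) \<le> B"
    and tc: "\<And>k. k \<in> {1..N} \<Longrightarrow> tile_collection G c (a k) (b k) (\<P> k)"
    and wp: "\<And>k P. k \<in> {1..N} \<Longrightarrow> P \<in> \<P> k \<Longrightarrow> wave_packet 1 10 C P (\<phi> P)"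
    and f: "bdd_supp f" and g: "\<And>k. k \<in> {1..N} \<Longrightarrow> bdd_supp (g k)"
    and C0: "C0 = 1 + \<bar>C 0 10\<bar> * 2 ^ 10" and C1: "C1 = 2 ^ 20 * (2 * pi * (\<bar>c\<bar> + 1) * \<bar>C 0 10\<bar> + \<bar>C 1 10\<bar>)"
    and n: "n = 2 * nat \<lceil>2 * (\<bar>c\<bar> + 1)\<rceil> + 1"
  shows "\<exists>S. finite S \<and> sparse_family (1/6) S \<and> model_form N \<P> \<phi> f g \<le>
    real (nat \<lceil>B\<rceil>) * (7552 * (2560 * C0 * sqrt (1310752 * C0\<^sup>2) + sqrt (40960 * C0\<^sup>2 * real n) * (8 * C1 + 61440 * C0)))
    * (\<Sum>Q\<in>S. len Q * avg 2 Q f * avg 1 Q (l2_norm_fun N g))"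
proof -
  obtain s where s: "G = shifted_dyadic s" "3 * s \<in> \<int>" using dyadic_grids_shift[OF G] by blast
  define T where "T = Sigma {1..N} \<P>"
  define K where "K = 7552 * (2560 * C0 * sqrt (1310752 * C0\<^sup>2) + sqrt (40960 * C0\<^sup>2 * real n) * (8 * C1 + 61440 * C0))"
  have K0: "K \<ge> 0" unfolding K_def C0 C1 by (intro mult_nonneg_nonneg add_nonneg_nonneg) auto
  let ?F = "\<lambda>(k, P). len (fst P) * norm (L2_inner f (\<phi> P)) * norm (L2_inner (g k) (\<phi> P))"
  let ?W = "\<lambda>S. \<Sum>Q\<in>S. len Q * avg 2 Q f * avg 1 Q (l2_norm_fun N g)"
  have finP: "finite (\<P> k)" if "k \<in> {1..N}" for k using tc[OF that] by (simp add: tile_collection_def)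
  have finT: "finite T" unfolding T_def using finP by (intro finite_SigmaI) auto
  have ex: "\<forall>i. \<exists>S. finite S \<and> sparse_family (1/6) S \<and> (\<Sum>p\<in>{p \<in> T. colour T p = i}. ?F p) \<le> K * ?W S"
  proof
    fix i
    have "packet_family {p \<in> T. colour T p = i} \<phi> a C0 C1 n N"
      unfolding T_def C0 C1 n by (rule wave_packet_family[where b=b, OF s tc wp])
    then interpret packet_family "{p \<in> T. colour T p = i}" \<phi> a C0 C1 n N .
    show "\<exists>S. finite S \<and> sparse_family (1/6) S \<and> (\<Sum>p\<in>{p \<in> T. colour T p = i}. ?F p) \<le> K * ?W S"
      unfolding K_def by (rule packet_family_sparse_bound[OF f g])
  qed
  obtain S where S: "\<forall>i. finite (S i) \<and> sparse_family (1/6) (S i) \<and> (\<Sum>p\<in>{p \<in> T. colour T p = i}. ?F p) \<le> K * ?W (S i)"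
    using choice[OF ex] by (elim exE) (rule that)
  let ?m = "nat \<lceil>B\<rceil>"
  have "model_form N \<P> \<phi> f g = (\<Sum>p\<in>T. ?F p)"
    unfolding model_form_def T_def by (rule sum.Sigma) (use finP in auto)
  also have "\<dots> = (\<Sum>i\<in>{..<?m}. \<Sum>p\<in>{p \<in> T. colour T p = i}. ?F p)"
  proof (rule sum.group[symmetric, OF finT])
    show "colour T ` T \<subseteq> {..<?m}"
    proof
      fix i assume "i \<in> colour T ` T"
      then obtain p where p: "p \<in> T" "i = colour T p" by blast
      have "colour T p < ?m"
      proof (rule colour_bound[OF finT p(1) _ B s])
        fix q assume "q \<in> T"
        then obtain k P where q: "q = (k, P)" "k \<in> {1..N}" "P \<in> \<P> k" unfolding T_def by blast
        have "snd P \<in> whitney G (a k) (b k)" using tc[OF q(2)] q(3) unfolding tile_collection_def by blast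
        thus "fst q \<in> {1..N} \<and> snd (snd q) \<in> whitney G (a (fst q)) (b (fst q))" using q by simp
      qed
      thus "i \<in> {..<?m}" using p by simp
    qed
  qed simp
  finally have mf: "model_form N \<P> \<phi> f g = (\<Sum>i\<in>{..<?m}. \<Sum>p\<in>{p \<in> T. colour T p = i}. ?F p)" .
  show ?thesis
  \<comment> \<open>For \<open>B \<le> 0\<close> there are no colours, hence no tiles, and the empty
    family is enough.\<close>
  proof (cases "?m = 0")
    case True
    hence "model_form N \<P> \<phi> f g = 0" using mf by simp
    thus ?thesis using True
      by (intro exI[of _ "{}"]) (simp add: sparse_family_def disjoint_family_on_def)
  next
    case False
    \<comment> \<open>Each colour has its own family; the one with the largest sum serves for all
      colours at the price of the factor \<open>?m\<close>.\<close>
    let ?V = "(\<lambda>i. ?W (S i)) ` {..<?m}"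
    have "0 \<in> {..<?m}" using False by simp
    hence "Max ?V \<in> ?V" by (intro Max_in) blast+
    then obtain i0 where "Max ?V = ?W (S i0)" by blast
    hence i0: "?W (S i) \<le> ?W (S i0)" if "i < ?m" for i using Max_ge[of ?V "?W (S i)"] that by simp
    have "model_form N \<P> \<phi> f g \<le> (\<Sum>i\<in>{..<?m}. K * ?W (S i0))"
      unfolding mf
    proof (rule sum_mono)
      fix i assume "i \<in> {..<?m}"
      hence "K * ?W (S i) \<le> K * ?W (S i0)" using i0[of i] K0 by (intro mult_left_mono) auto
      thus "(\<Sum>p\<in>{p \<in> T. colour T p = i}. ?F p) \<le> K * ?W (S i0)" using S[rule_format, of i] by (blast intro: order_trans)
    qed
    also have "\<dots> = real ?m * K * ?W (S i0)" by simp
    finally show ?thesis using S[rule_format, of i0] unfolding K_def by (intro exI[of _ "S i0"]) simp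
  qed
qed

theorem theorem2p4:
  shows "\<exists>(n0::nat) (M::nat). \<forall>(B::real) (c::real) (C :: nat \<Rightarrow> nat \<Rightarrow> real). \<exists>K>0.
    \<forall>(N::nat) (a :: nat \<Rightarrow> real) (b :: nat \<Rightarrow> real) (G :: real set set)
     (\<P> :: nat \<Rightarrow> tile set) (\<phi> :: tile \<Rightarrow> real \<Rightarrow> complex).
      (\<forall>k\<in>{1..N}. a k < b k) \<and>
      (\<forall>x. (\<Sum>k=1..N. indicat_real {a k..b k} x) \<le> B) \<and>
      G \<in> dyadic_grids \<and>
      (\<forall>k\<in>{1..N}. tile_collection G c (a k) (b k) (\<P> k)) \<and>
      (\<forall>P \<in> (\<Union>k\<in>{1..N}. \<P> k). wave_packet n0 M C P (\<phi> P)) \<longrightarrow>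
      (\<forall>(f :: real \<Rightarrow> complex) (g :: nat \<Rightarrow> real \<Rightarrow> complex).
        test_function f \<and> (\<forall>k\<in>{1..N}. test_function (g k)) \<longrightarrow>
        (\<exists>S. sparse_family (1/6) S \<and>
          ennreal (model_form N \<P> \<phi> f g)
            \<le> ennreal K *
               (\<Sum>\<^sub>\<infinity>I\<in>S. ennreal (len I * avg 2 I f * avg 1 I (l2_norm_fun N g)))))"
proof (rule exI[of _ 1], rule exI[of _ 10], intro allI)
  \<comment> \<open>The orders just chosen: one derivative for the Lipschitz condition, and decay
    10, of which 8 covers the moments in \<open>local_bessel\<close> and 2 the
    integrability.\<close>
  fix B c :: real and C :: "nat \<Rightarrow> nat \<Rightarrow> real"
  define C0 where "C0 = 1 + \<bar>C 0 10\<bar> * 2 ^ 10"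
  define C1 where "C1 = 2 ^ 20 * (2 * pi * (\<bar>c\<bar> + 1) * \<bar>C 0 10\<bar> + \<bar>C 1 10\<bar>)"
  define n where "n = 2 * nat \<lceil>2 * (\<bar>c\<bar> + 1)\<rceil> + 1"
  define K where "K = real (nat \<lceil>B\<rceil>) * (7552 * (2560 * C0 * sqrt (1310752 * C0\<^sup>2) + sqrt (40960 * C0\<^sup>2 * real n) * (8 * C1 + 61440 * C0)))"
  have K0: "K \<ge> 0" unfolding K_def C0_def C1_def by (intro mult_nonneg_nonneg add_nonneg_nonneg) auto
  show "\<exists>K>0. \<forall>(N::nat) (a :: nat \<Rightarrow> real) (b :: nat \<Rightarrow> real) (G :: real set set)
     (\<P> :: nat \<Rightarrow> tile set) (\<phi> :: tile \<Rightarrow> real \<Rightarrow> complex).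
      (\<forall>k\<in>{1..N}. a k < b k) \<and>
      (\<forall>x. (\<Sum>k=1..N. indicat_real {a k..b k} x) \<le> B) \<and>
      G \<in> dyadic_grids \<and>
      (\<forall>k\<in>{1..N}. tile_collection G c (a k) (b k) (\<P> k)) \<and>
      (\<forall>P \<in> (\<Union>k\<in>{1..N}. \<P> k). wave_packet 1 10 C P (\<phi> P)) \<longrightarrow>
      (\<forall>(f :: real \<Rightarrow> complex) (g :: nat \<Rightarrow> real \<Rightarrow> complex).
        test_function f \<and> (\<forall>k\<in>{1..N}. test_function (g k)) \<longrightarrow>
        (\<exists>S. sparse_family (1/6) S \<and>
          ennreal (model_form N \<P> \<phi> f g)
            \<le> ennreal K *
               (\<Sum>\<^sub>\<infinity>I\<in>S. ennreal (len I * avg 2 I f * avg 1 I (l2_norm_fun N g)))))"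
  proof (intro exI[of _ "K + 1"] conjI allI impI)
    \<comment> \<open>\<open>K\<close> vanishes for \<open>B \<le> 0\<close>; adding 1 makes the
      constant positive and only enlarges the right-hand side, whose terms are nonnegative.\<close>
    show "K + 1 > 0" using K0 by simp
    fix N :: nat and a b :: "nat \<Rightarrow> real" and G :: "real set set" and \<P> :: "nat \<Rightarrow> tile set"
      and \<phi> :: "tile \<Rightarrow> real \<Rightarrow> complex" and f :: "real \<Rightarrow> complex" and g :: "nat \<Rightarrow> real \<Rightarrow> complex"
    assume h: "(\<forall>k\<in>{1..N}. a k < b k) \<and>
      (\<forall>x. (\<Sum>k=1..N. indicat_real {a k..b k} x) \<le> B) \<and>
      G \<in> dyadic_grids \<and>
      (\<forall>k\<in>{1..N}. tile_collection G c (a k) (b k) (\<P> k)) \<and>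
      (\<forall>P \<in> (\<Union>k\<in>{1..N}. \<P> k). wave_packet 1 10 C P (\<phi> P))"
      and t: "test_function f \<and> (\<forall>k\<in>{1..N}. test_function (g k))"
    let ?w = "\<lambda>I. len I * avg 2 I f * avg 1 I (l2_norm_fun N g)"
    have "\<exists>S. finite S \<and> sparse_family (1/6) S \<and> model_form N \<P> \<phi> f g \<le> K * (\<Sum>Q\<in>S. ?w Q)"
      unfolding K_def
    proof (rule model_form_sparse_bound[where G=G and a=a and b=b and c=c and C=C])
      show "wave_packet 1 10 C P (\<phi> P)" if "k \<in> {1..N}" "P \<in> \<P> k" for k P using h that by blast
    qed (use h t in \<open>auto simp: C0_def C1_def n_def intro: test_function_bdd_supp\<close>)
    then obtain S where S: "finite S" "sparse_family (1/6) S" "model_form N \<P> \<phi> f g \<le> K * (\<Sum>Q\<in>S. ?w Q)" by blast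
    have w0: "?w Q \<ge> 0" for Q by (simp add: avg_def)
    have "K * (\<Sum>Q\<in>S. ?w Q) \<le> (K + 1) * (\<Sum>Q\<in>S. ?w Q)"
      using w0 by (intro mult_right_mono sum_nonneg) auto
    hence "ennreal (model_form N \<P> \<phi> f g) \<le> ennreal ((K + 1) * (\<Sum>Q\<in>S. ?w Q))"
      using S(3) by (intro ennreal_leI) linarith
    also have "\<dots> = ennreal (K + 1) * (\<Sum>\<^sub>\<infinity>I\<in>S. ennreal (?w I))"
      using K0 w0 S(1) by (simp add: ennreal_mult sum_ennreal sum_nonneg)
    finally show "\<exists>S. sparse_family (1/6) S \<and>
          ennreal (model_form N \<P> \<phi> f g) \<le> ennreal (K + 1) * (\<Sum>\<^sub>\<infinity>I\<in>S. ennreal (?w I))"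
      using S(2) by blast
  qed
qed

end
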